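(* Let $G_1$ and $G_2$ be nontrivial finite groups, and measure word length in the free product $G_1*G_2$ with respect to the generating set $\mathcal S=(G_1\setminus\{1\})\cup(G_2\setminus\{1\})$. Let $k\ge 0$ be a multiple of $4$. The number of distinct conjugacy classes of commutators in $G_1*G_2$ with length $k$ is given by $$\frac{1}{192}\Big((|G_1|-1)(|G_2|-2)^2+(|G_1|-2)^2(|G_2|-1)\Big)k^2(|G_1|-1)^{\frac{k}{4}-1}(|G_2|-1)^{\frac{k}{4}-1}+O_{|G_1|,|G_2|}\left(k(|G_1|-1)^{\frac{k}{4}}(|G_2|-1)^{\frac{k}{4}}\right),$$ where the implied constant depends only on $|G_1|$ and $|G_2|$, and is effectively computable.
   Context: A commutator in a group $G$ is an element of the form $XYX^{-1}Y^{-1}$ with $X,Y\in G$; the set of commutators is closed under conjugation, so a conjugacy class either consists entirely of commutators or contains none. The length of an element $g$ with respect to a symmetric generating set $\mathcal S$ is the least $m$ such that $g$ is a product of $m$ elements of $\mathcal S$. The length of a conjugacy class is the minimum of the lengths of its elements. $O_{|G_1|,|G_2|}(\cdot)$ is the usual big-O notation, with an implied constant depending only on $|G_1|$ and $|G_2|$.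
   Formalization: The estimate is stated for positive multiples k of 4; k = 0 is excluded because there the main and error terms both vanish while there is exactly one class (the identity) of length 0, so the claim fails. *)

theory Defs
  imports Complex_Main "HOL-Algebra.Generated_Groups"
begin

section \<open>Free products of two groups\<close>

text \<open>
  The free product is realised by normal forms: a reduced word is a list of non-identity
  elements taken alternately from the two factors, and multiplication is concatenation
  followed by reduction.
\<close>

definition fp_letters ::
  "('a, 'c) monoid_scheme \<Rightarrow> ('b, 'd) monoid_scheme \<Rightarrow> ('a + 'b) set" where
  "fp_letters G H = (carrier G - {\<one>\<^bsub>G\<^esub>}) <+> (carrier H - {\<one>\<^bsub>H\<^esub>})"

definition fp_words ::
  "('a, 'c) monoid_scheme \<Rightarrow> ('b, 'd) monoid_scheme \<Rightarrow> ('a + 'b) list set" where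
  "fp_words G H =
     {w. set w \<subseteq> fp_letters G H \<and> successively (\<lambda>x y. isl x \<noteq> isl y) w}"

text \<open>Left multiplication of a reduced word by a single letter, followed by reduction.\<close>

fun fp_push ::
  "('a, 'c) monoid_scheme \<Rightarrow> ('b, 'd) monoid_scheme \<Rightarrow> 'a + 'b
     \<Rightarrow> ('a + 'b) list \<Rightarrow> ('a + 'b) list" where
  "fp_push G H (Inl a) (Inl b # w) =
     (if a \<otimes>\<^bsub>G\<^esub> b = \<one>\<^bsub>G\<^esub> then w else Inl (a \<otimes>\<^bsub>G\<^esub> b) # w)"
| "fp_push G H (Inr a) (Inr b # w) =
     (if a \<otimes>\<^bsub>H\<^esub> b = \<one>\<^bsub>H\<^esub> then w else Inr (a \<otimes>\<^bsub>H\<^esub> b) # w)"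
| "fp_push G H x w = x # w"

definition free_product ::
  "('a, 'c) monoid_scheme \<Rightarrow> ('b, 'd) monoid_scheme \<Rightarrow> ('a + 'b) list monoid" where
  "free_product G H =
     \<lparr>carrier = fp_words G H, mult = (\<lambda>v w. foldr (fp_push G H) v w), one = []\<rparr>"

definition fp_inl :: "('a, 'c) monoid_scheme \<Rightarrow> 'a \<Rightarrow> ('a + 'b) list" where
  "fp_inl G a = (if a = \<one>\<^bsub>G\<^esub> then [] else [Inl a])"

definition fp_inr :: "('b, 'd) monoid_scheme \<Rightarrow> 'b \<Rightarrow> ('a + 'b) list" where
  "fp_inr H b = (if b = \<one>\<^bsub>H\<^esub> then [] else [Inr b])"

definition fp_gens ::
  "('a, 'c) monoid_scheme \<Rightarrow> ('b, 'd) monoid_scheme \<Rightarrow> ('a + 'b) list set" where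
  "fp_gens G H = fp_inl G ` (carrier G - {\<one>\<^bsub>G\<^esub>}) \<union> fp_inr H ` (carrier H - {\<one>\<^bsub>H\<^esub>})"

subsection \<open>The free product is a group\<close>

lemma fp_words_Nil [simp]: "[] \<in> fp_words G H"
  by (simp add: fp_words_def)

lemma fp_words_letters: "w \<in> fp_words G H \<Longrightarrow> set w \<subseteq> fp_letters G H"
  by (simp add: fp_words_def)

lemma fp_words_Cons:
  "x # w \<in> fp_words G H \<longleftrightarrow>
     x \<in> fp_letters G H \<and> w \<in> fp_words G H \<and> (w = [] \<or> isl x \<noteq> isl (hd w))"
  by (cases w) (auto simp: fp_words_def)

context
  fixes G :: "('a, 'c) monoid_scheme" and H :: "('b, 'd) monoid_scheme"
  assumes G: "group G" and H: "group H"
begin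

interpretation G: group G by (rule G)
interpretation H: group H by (rule H)

lemma fp_push_closed:
  assumes "x \<in> fp_letters G H" "w \<in> fp_words G H"
  shows "fp_push G H x w \<in> fp_words G H"
  using assms
  by (cases "(G, H, x, w)" rule: fp_push.cases)
     (auto simp: fp_words_Cons fp_letters_def)

lemma fp_foldr_closed:
  assumes "set v \<subseteq> fp_letters G H" "w \<in> fp_words G H"
  shows "foldr (fp_push G H) v w \<in> fp_words G H"
  using assms by (induction v) (auto intro: fp_push_closed)

lemma fp_push_push_Inl:
  assumes "Inl a \<in> fp_letters G H" "Inl b \<in> fp_letters G H" "w \<in> fp_words G H"
  shows "fp_push G H (Inl a) (fp_push G H (Inl b) w) =
    (if a \<otimes>\<^bsub>G\<^esub> b = \<one>\<^bsub>G\<^esub> then w else fp_push G H (Inl (a \<otimes>\<^bsub>G\<^esub> b)) w)"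
proof -
  have ab: "a \<in> carrier G" "b \<in> carrier G" "a \<noteq> \<one>\<^bsub>G\<^esub>" "b \<noteq> \<one>\<^bsub>G\<^esub>"
    using assms by (auto simp: fp_letters_def)
  show ?thesis
  proof (cases "\<exists>c v. w = Inl c # v")
    case True
    then obtain c v where w: "w = Inl c # v" by blast
    have c: "c \<in> carrier G" "c \<noteq> \<one>\<^bsub>G\<^esub>" and v: "v = [] \<or> \<not> isl (hd v)"
      using assms(3) by (auto simp: w fp_words_Cons fp_letters_def)
    have pv: "fp_push G H (Inl x) v = Inl x # v" for x
      using v by (cases v; cases "hd v") auto
    have "a \<otimes>\<^bsub>G\<^esub> (b \<otimes>\<^bsub>G\<^esub> c) = a \<otimes>\<^bsub>G\<^esub> b \<otimes>\<^bsub>G\<^esub> c"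
      using ab c by (simp add: G.m_assoc)
    moreover have "b \<otimes>\<^bsub>G\<^esub> c = \<one>\<^bsub>G\<^esub> \<Longrightarrow> a \<otimes>\<^bsub>G\<^esub> b \<otimes>\<^bsub>G\<^esub> c = a"
      using ab c by (simp add: G.m_assoc)
    moreover have "a \<otimes>\<^bsub>G\<^esub> b = \<one>\<^bsub>G\<^esub> \<Longrightarrow> a \<otimes>\<^bsub>G\<^esub> b \<otimes>\<^bsub>G\<^esub> c = c"
      using c by simp
    ultimately show ?thesis using ab c by (auto simp: w pv)
  next
    case False
    have "fp_push G H (Inl x) w = Inl x # w" for x
      using False by (cases w; cases "hd w") auto
    then show ?thesis by simp
  qed
qed

lemma fp_push_push_Inr:
  assumes "Inr a \<in> fp_letters G H" "Inr b \<in> fp_letters G H" "w \<in> fp_words G H"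
  shows "fp_push G H (Inr a) (fp_push G H (Inr b) w) =
    (if a \<otimes>\<^bsub>H\<^esub> b = \<one>\<^bsub>H\<^esub> then w else fp_push G H (Inr (a \<otimes>\<^bsub>H\<^esub> b)) w)"
proof -
  have ab: "a \<in> carrier H" "b \<in> carrier H" "a \<noteq> \<one>\<^bsub>H\<^esub>" "b \<noteq> \<one>\<^bsub>H\<^esub>"
    using assms by (auto simp: fp_letters_def)
  show ?thesis
  proof (cases "\<exists>c v. w = Inr c # v")
    case True
    then obtain c v where w: "w = Inr c # v" by blast
    have c: "c \<in> carrier H" "c \<noteq> \<one>\<^bsub>H\<^esub>" and v: "v = [] \<or> isl (hd v)"
      using assms(3) by (auto simp: w fp_words_Cons fp_letters_def)
    have pv: "fp_push G H (Inr x) v = Inr x # v" for x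
      using v by (cases v; cases "hd v") auto
    have "a \<otimes>\<^bsub>H\<^esub> (b \<otimes>\<^bsub>H\<^esub> c) = a \<otimes>\<^bsub>H\<^esub> b \<otimes>\<^bsub>H\<^esub> c"
      using ab c by (simp add: H.m_assoc)
    moreover have "b \<otimes>\<^bsub>H\<^esub> c = \<one>\<^bsub>H\<^esub> \<Longrightarrow> a \<otimes>\<^bsub>H\<^esub> b \<otimes>\<^bsub>H\<^esub> c = a"
      using ab c by (simp add: H.m_assoc)
    moreover have "a \<otimes>\<^bsub>H\<^esub> b = \<one>\<^bsub>H\<^esub> \<Longrightarrow> a \<otimes>\<^bsub>H\<^esub> b \<otimes>\<^bsub>H\<^esub> c = c"
      using c by simp
    ultimately show ?thesis using ab c by (auto simp: w pv)
  next
    case False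
    have "fp_push G H (Inr x) w = Inr x # w" for x
      using False by (cases w; cases "hd w") auto
    then show ?thesis by simp
  qed
qed

lemma fp_foldr_push:
  assumes "x \<in> fp_letters G H" "v \<in> fp_words G H" "w \<in> fp_words G H"
  shows "foldr (fp_push G H) (fp_push G H x v) w =
    fp_push G H x (foldr (fp_push G H) v w)"
proof -
  have cl: "foldr (fp_push G H) u w \<in> fp_words G H" if "u \<in> fp_words G H" for u
    using fp_foldr_closed [OF fp_words_letters [OF that] assms(3)] .
  show ?thesis
    using assms(1,2) cl
    by (cases "(G, H, x, v)" rule: fp_push.cases)
       (auto simp: fp_push_push_Inl fp_push_push_Inr fp_words_Cons)
qed

lemma fp_letter_inv:
  assumes "x \<in> fp_letters G H"
  shows "\<exists>y\<in>fp_letters G H. \<forall>w\<in>fp_words G H. fp_push G H y (fp_push G H x w) = w"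
proof (cases x)
  case (Inl a)
  then have a: "a \<in> carrier G" "a \<noteq> \<one>\<^bsub>G\<^esub>" using assms by (auto simp: fp_letters_def)
  then have "Inl (inv\<^bsub>G\<^esub> a) \<in> fp_letters G H" by (auto simp: fp_letters_def)
  moreover from this have "\<forall>w\<in>fp_words G H. fp_push G H (Inl (inv\<^bsub>G\<^esub> a)) (fp_push G H x w) = w"
    using a assms by (auto simp: Inl fp_push_push_Inl)
  ultimately show ?thesis by blast
next
  case (Inr a)
  then have a: "a \<in> carrier H" "a \<noteq> \<one>\<^bsub>H\<^esub>" using assms by (auto simp: fp_letters_def)
  then have "Inr (inv\<^bsub>H\<^esub> a) \<in> fp_letters G H" by (auto simp: fp_letters_def)
  moreover from this have "\<forall>w\<in>fp_words G H. fp_push G H (Inr (inv\<^bsub>H\<^esub> a)) (fp_push G H x w) = w"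
    using a assms by (auto simp: Inr fp_push_push_Inr)
  ultimately show ?thesis by blast
qed

lemma fp_word_inv:
  assumes "w \<in> fp_words G H"
  shows "\<exists>v. set v \<subseteq> fp_letters G H \<and> foldr (fp_push G H) v w = []"
  using assms
proof (induction w)
  case Nil
  show ?case by (rule exI [of _ "[]"]) simp
next
  case (Cons x w)
  then have x: "x \<in> fp_letters G H" and w: "w \<in> fp_words G H"
    and hd: "w = [] \<or> isl x \<noteq> isl (hd w)"
    by (auto simp: fp_words_Cons)
  obtain v where v: "set v \<subseteq> fp_letters G H" "foldr (fp_push G H) v w = []"
    using Cons.IH w by blast
  obtain y where y: "y \<in> fp_letters G H" "fp_push G H y (fp_push G H x w) = w"
    using fp_letter_inv [OF x] w by blast
  have "fp_push G H x w = x # w"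
    using hd by (cases "(G, H, x, w)" rule: fp_push.cases) auto
  then have "foldr (fp_push G H) (v @ [y]) (x # w) = []"
    using v y by simp
  then show ?case using v y by (intro exI [of _ "v @ [y]"]) auto
qed

lemma fp_foldr_Nil:
  assumes "w \<in> fp_words G H"
  shows "foldr (fp_push G H) w [] = w"
  using assms
proof (induction w)
  case (Cons x w)
  then show ?case
    by (cases "(G, H, x, w)" rule: fp_push.cases) (auto simp: fp_words_Cons)
qed simp

lemma fp_foldr_foldr:
  assumes "set u \<subseteq> fp_letters G H" "v \<in> fp_words G H" "w \<in> fp_words G H"
  shows "foldr (fp_push G H) (foldr (fp_push G H) u v) w =
    foldr (fp_push G H) u (foldr (fp_push G H) v w)"
  using assms by (induction u) (auto simp: fp_foldr_push fp_foldr_closed)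

lemma group_free_product: "group (free_product G H)"
proof (rule groupI)
  fix w assume "w \<in> carrier (free_product G H)"
  then have w: "w \<in> fp_words G H" by (simp add: free_product_def)
  obtain v where v: "set v \<subseteq> fp_letters G H" "foldr (fp_push G H) v w = []"
    using fp_word_inv [OF w] by blast
  let ?v = "foldr (fp_push G H) v []"
  have "?v \<in> fp_words G H" "foldr (fp_push G H) ?v w = []"
    using v w by (auto simp: fp_foldr_foldr fp_foldr_closed)
  then show "\<exists>v\<in>carrier (free_product G H). v \<otimes>\<^bsub>free_product G H\<^esub> w = \<one>\<^bsub>free_product G H\<^esub>"
    by (auto simp: free_product_def)
qed (simp_all add: free_product_def fp_foldr_foldr fp_foldr_closed fp_words_letters)

lemma fp_inl_hom: "fp_inl G \<in> hom G (free_product G H)"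
  by (rule homI) (auto simp: fp_inl_def free_product_def fp_words_def fp_letters_def)

lemma fp_inr_hom: "fp_inr H \<in> hom H (free_product G H)"
  by (rule homI) (auto simp: fp_inr_def free_product_def fp_words_def fp_letters_def)

text \<open>The universal property of the coproduct.\<close>

lemma free_product_universal:
  assumes K: "group K" and f: "f \<in> hom G K" and g: "g \<in> hom H K"
  shows "\<exists>h\<in>hom (free_product G H) K.
    (\<forall>a\<in>carrier G. h (fp_inl G a) = f a) \<and> (\<forall>b\<in>carrier H. h (fp_inr H b) = g b)"
proof -
  interpret K: group K by (rule K)
  define l where "l = case_sum f g"
  define h where "h = (\<lambda>w. foldr (\<lambda>x y. l x \<otimes>\<^bsub>K\<^esub> y) w \<one>\<^bsub>K\<^esub>)"
  have h_simps [simp]: "h [] = \<one>\<^bsub>K\<^esub>" "h (x # w) = l x \<otimes>\<^bsub>K\<^esub> h w" for x w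
    by (simp_all add: h_def)
  have l: "l x \<in> carrier K" if "x \<in> fp_letters G H" for x
    using that f g by (auto simp: l_def fp_letters_def hom_def)
  have h: "h w \<in> carrier K" if "set w \<subseteq> fp_letters G H" for w
    using that by (induction w) (auto simp: l)
  have one: "f \<one>\<^bsub>G\<^esub> = \<one>\<^bsub>K\<^esub>" "g \<one>\<^bsub>H\<^esub> = \<one>\<^bsub>K\<^esub>"
    using f g G H K by (auto intro: hom_one)
  have push: "h (fp_push G H x w) = l x \<otimes>\<^bsub>K\<^esub> h w"
    if x: "x \<in> fp_letters G H" and w: "w \<in> fp_words G H" for x w
  proof -
    have sw: "set w \<subseteq> fp_letters G H" using w by (simp add: fp_words_def)
    consider a b v where "x = Inl a" "w = Inl b # v" | a b v where "x = Inr a" "w = Inr b # v"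
      | "fp_push G H x w = x # w"
      by (cases "(G, H, x, w)" rule: fp_push.cases) auto
    then show ?thesis
    proof cases
      case 1
      then have ab: "a \<in> carrier G" "b \<in> carrier G" and v: "h v \<in> carrier K"
        using x sw h by (auto simp: fp_letters_def)
      have fab: "f a \<in> carrier K" "f b \<in> carrier K" using ab f by (auto simp: hom_def)
      have "f (a \<otimes>\<^bsub>G\<^esub> b) \<otimes>\<^bsub>K\<^esub> h v = f a \<otimes>\<^bsub>K\<^esub> (f b \<otimes>\<^bsub>K\<^esub> h v)"
        using hom_mult [OF f ab] fab v by (simp add: K.m_assoc)
      then show ?thesis using v one by (auto simp: 1 l_def)
    next
      case 2
      then have ab: "a \<in> carrier H" "b \<in> carrier H" and v: "h v \<in> carrier K"
        using x sw h by (auto simp: fp_letters_def)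
      have gab: "g a \<in> carrier K" "g b \<in> carrier K" using ab g by (auto simp: hom_def)
      have "g (a \<otimes>\<^bsub>H\<^esub> b) \<otimes>\<^bsub>K\<^esub> h v = g a \<otimes>\<^bsub>K\<^esub> (g b \<otimes>\<^bsub>K\<^esub> h v)"
        using hom_mult [OF g ab] gab v by (simp add: K.m_assoc)
      then show ?thesis using v one by (auto simp: 2 l_def)
    next
      case 3
      then show ?thesis by simp
    qed
  qed
  have mult: "h (foldr (fp_push G H) v w) = h v \<otimes>\<^bsub>K\<^esub> h w"
    if "set v \<subseteq> fp_letters G H" and w: "w \<in> fp_words G H" for v w
    using that(1)
  proof (induction v)
    case Nil
    then show ?case using w h by (simp add: fp_words_def)
  next
    case (Cons x v)
    then show ?case
      using w h l by (simp add: push fp_foldr_closed K.m_assoc fp_words_letters)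
  qed
  have "h \<in> hom (free_product G H) K"
    by (rule homI) (auto simp: free_product_def h mult fp_words_def)
  moreover have "\<forall>a\<in>carrier G. h (fp_inl G a) = f a" "\<forall>b\<in>carrier H. h (fp_inr H b) = g b"
    using hom_in_carrier [OF f] hom_in_carrier [OF g] one
    by (auto simp: fp_inl_def fp_inr_def l_def)
  ultimately show ?thesis by blast
qed

lemma free_product_universal_unique:
  assumes K: "group K"
    and h: "h \<in> hom (free_product G H) K" "h' \<in> hom (free_product G H) K"
    and eq: "\<And>a. a \<in> carrier G \<Longrightarrow> h (fp_inl G a) = h' (fp_inl G a)"
      "\<And>b. b \<in> carrier H \<Longrightarrow> h (fp_inr H b) = h' (fp_inr H b)"
    and "w \<in> carrier (free_product G H)"
  shows "h w = h' w"
proof -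
  have "w \<in> fp_words G H" using assms(6) by (simp add: free_product_def)
  then show ?thesis
  proof (induction w)
    case Nil
    show ?case
      using hom_one [OF h(1) group_free_product K] hom_one [OF h(2) group_free_product K]
      by (simp add: free_product_def)
  next
    case (Cons x w)
    have x: "x \<in> fp_letters G H" and w: "w \<in> fp_words G H"
      and hd: "w = [] \<or> isl x \<noteq> isl (hd w)"
      using Cons.prems by (auto simp: fp_words_Cons)
    have "fp_push G H x w = x # w"
      using hd by (cases "(G, H, x, w)" rule: fp_push.cases) auto
    then have xw: "x # w = [x] \<otimes>\<^bsub>free_product G H\<^esub> w" by (simp add: free_product_def)
    have "[x] \<in> carrier (free_product G H)" "w \<in> carrier (free_product G H)"
      using x w by (simp_all add: free_product_def fp_words_Cons)
    moreover have "h [x] = h' [x]"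
    proof (cases x)
      case (Inl a)
      then have "a \<in> carrier G" "a \<noteq> \<one>\<^bsub>G\<^esub>" using x by (auto simp: fp_letters_def)
      then show ?thesis using Inl eq(1) [of a] by (simp add: fp_inl_def)
    next
      case (Inr b)
      then have "b \<in> carrier H" "b \<noteq> \<one>\<^bsub>H\<^esub>" using x by (auto simp: fp_letters_def)
      then show ?thesis using Inr eq(2) [of b] by (simp add: fp_inr_def)
    qed
    ultimately show ?case
      using hom_mult [OF h(1)] hom_mult [OF h(2)] Cons.IH [OF w] by (simp add: xw)
  qed
qed

end

section \<open>Word length and conjugacy classes\<close>

definition word_length :: "('a, 'b) monoid_scheme \<Rightarrow> 'a set \<Rightarrow> 'a \<Rightarrow> nat" where
  "word_length G S g =
     (LEAST m. \<exists>xs. length xs = m \<and> set xs \<subseteq> S \<and> foldr (\<otimes>\<^bsub>G\<^esub>) xs \<one>\<^bsub>G\<^esub> = g)"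

definition conjugacy_class :: "('a, 'b) monoid_scheme \<Rightarrow> 'a \<Rightarrow> 'a set" where
  "conjugacy_class G g = (\<lambda>x. x \<otimes>\<^bsub>G\<^esub> g \<otimes>\<^bsub>G\<^esub> inv\<^bsub>G\<^esub> x) ` carrier G"

definition conjugacy_classes :: "('a, 'b) monoid_scheme \<Rightarrow> 'a set set" where
  "conjugacy_classes G = conjugacy_class G ` carrier G"

definition class_length :: "('a, 'b) monoid_scheme \<Rightarrow> 'a set \<Rightarrow> 'a set \<Rightarrow> nat" where
  "class_length G S C = (LEAST m. \<exists>g\<in>C. word_length G S g = m)"

text \<open>
  The library's \<open>derived_set G (carrier G)\<close> is the set of commutators of \<open>G\<close>
  (not the subgroup they generate).
\<close>

definition commutator_classes ::
  "('a, 'b) monoid_scheme \<Rightarrow> 'a set \<Rightarrow> nat \<Rightarrow> 'a set set" where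
  "commutator_classes G S k =
     {C \<in> conjugacy_classes G. C \<subseteq> derived_set G (carrier G) \<and> class_length G S C = k}"

section \<open>Computable functions\<close>

text \<open>
  The total recursive functions of arity \<open>n\<close>, as functions on argument lists; only their
  values on lists of length \<open>n\<close> are meaningful.
\<close>

inductive recursive_fun :: "nat \<Rightarrow> (nat list \<Rightarrow> nat) \<Rightarrow> bool" where
  zero: "recursive_fun n (\<lambda>_. 0)"
| succ: "recursive_fun 1 (\<lambda>xs. Suc (xs ! 0))"
| proj: "i < n \<Longrightarrow> recursive_fun n (\<lambda>xs. xs ! i)"
| comp: "recursive_fun (length gs) f \<Longrightarrow> \<forall>g\<in>set gs. recursive_fun n g \<Longrightarrow>
    recursive_fun n (\<lambda>xs. f (map (\<lambda>g. g xs) gs))"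
| prec: "recursive_fun n f \<Longrightarrow> recursive_fun (Suc (Suc n)) g \<Longrightarrow>
    recursive_fun (Suc n)
      (\<lambda>xs. rec_nat (f (tl xs)) (\<lambda>i r. g (i # r # tl xs)) (hd xs))"
| mini: "recursive_fun (Suc n) f \<Longrightarrow> \<forall>xs. length xs = n \<longrightarrow> (\<exists>y. f (y # xs) = 0) \<Longrightarrow>
    recursive_fun n (\<lambda>xs. LEAST y. f (y # xs) = 0)"

definition computable2 :: "(nat \<Rightarrow> nat \<Rightarrow> nat) \<Rightarrow> bool" where
  "computable2 c \<longleftrightarrow> (\<exists>f. recursive_fun 2 f \<and> (\<forall>m n. c m n = f [m, n]))"

end

theory Submission
  imports Defs
begin

text \<open>
  Minimising the lengths of \<open>X, Y, Z\<close> among all ways of writing a commutator, up to conjugacy, as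
  \<open>X \<alpha>\<^sub>1 Y \<beta>\<^sub>1 Z \<alpha>\<^sub>2 X\<inverse> \<beta>\<^sub>2 Y\<inverse> \<alpha>\<^sub>3 Z\<inverse> \<beta>\<^sub>3\<close>, with the \<open>\<alpha>\<close>'s in one factor and
  \<open>\<alpha>\<^sub>2\<alpha>\<^sub>1\<alpha>\<^sub>3 = 1\<close>, and likewise for the \<open>\<beta>\<close>'s, gives Wicks' theorem: either none of the
  twelve entries is trivial and the word is cyclically reduced, or one of \<open>X, Y, Z\<close> is empty.
  The second kind has one length parameter less and only contributes to the error term. For the
  first kind and length \<open>k\<close> divisible by 4, the \<open>\<alpha>\<close>'s and \<open>\<beta>\<close>'s lie in the same factor, and
  the number of such forms is 6 times the main term, up to the error term.

  Cyclic rotation gives six forms for each class, fewer only if the word is periodic. Conversely,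
  a form pairs almost all positions of its cyclic word so that \<open>w(\<sigma> i) = (w i)\<inverse>\<close>. Two forms
  of one cyclic word give two pairings. If they nowhere agree, then the positions fall into classes
  on which the word is determined by one letter, most of them of size at least 3, which leaves about
  \<open>k/3\<close> instead of \<open>k/2\<close> free letters. If they agree somewhere, then the two forms have a piece in
  common, and the same argument applies to the remaining positions unless the forms are rotations
  of each other.
\<close>

section \<open>Wicks forms in an arbitrary group\<close>

text \<open>The constant 192 is 16 * 2 * 6: with \<open>k = 4 * K\<close> there are about K^2/2
  triples of odd piece lengths with sum \<open>2 * K - 3\<close>, each shape carries the same number
  of forms, and a class has six forms.

  The obstacle is that the error may exceed \<open>Q ^ K\<close>, where \<open>Q\<close> is (|G| -
  1)(|H| - 1), only by a factor linear in \<open>K\<close>, whereas overlapping forms are summed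
  over two shapes and a rotation, about K^5 choices. If the two pairings nowhere agree, a choice
  contributes about Q^(2K/3), and the gap Q^(K/3) absorbs the polynomial. If a piece of length
  \<open>a\<close> is shared, the gap is only Q^(n/6) with n = 2K - 2 - a, but then at most n^2
  choices remain for each \<open>a\<close>. Both arguments need \<open>Q\<close> to be at least 2,
  which holds as soon as a generic form exists.

  The factors may have different orders, so letters at even and at odd positions are counted
  separately. This is possible because the piece lengths are odd, which makes the pairings preserve
  parity.\<close>

context group
begin

lemma inv_l_cancel: "x \<in> carrier G \<Longrightarrow> y \<in> carrier G \<Longrightarrow> inv x \<otimes> (x \<otimes> y) = y"
  by (simp add: m_assoc [symmetric])

lemma inv_r_cancel: "x \<in> carrier G \<Longrightarrow> y \<in> carrier G \<Longrightarrow> x \<otimes> (inv x \<otimes> y) = y"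
  by (simp add: m_assoc [symmetric])

text \<open>Right association, inverses pushed inwards and cancellation of neighbours: with these an
  identity valid in every group is proved by bringing both sides to the same freely reduced
  word.\<close>

lemmas free_group_simps = m_assoc inv_mult_group inv_l_cancel inv_r_cancel

text \<open>A hexagon with opposite sides \<open>X\<close>, \<open>Y\<close>, \<open>Z\<close>
  identified is a torus with two vertices; the \<open>a\<close> entries sit at the corners of one
  vertex, the \<open>b\<close> entries at the other. The product around a vertex is trivial, which
  eliminates the third entry of each family.\<close>

definition wicks :: "'a \<Rightarrow> 'a \<Rightarrow> 'a \<Rightarrow> 'a \<Rightarrow> 'a \<Rightarrow> 'a \<Rightarrow> 'a \<Rightarrow> 'a" where
  "wicks X Y Z a1 a2 b1 b2 =
     X \<otimes> a1 \<otimes> Y \<otimes> b1 \<otimes> Z \<otimes> a2 \<otimes> inv X \<otimes> b2 \<otimes> inv Y \<otimes> (inv a1 \<otimes> inv a2) \<otimes> inv Z \<otimes> (inv b1 \<otimes> inv b2)"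

lemma wicks_commutator:
  assumes "{X, Y, Z, a1, a2, b1, b2} \<subseteq> carrier G"
  shows "wicks X Y Z a1 a2 b1 b2 \<in> derived_set G (carrier G)"
proof -
  \<comment> \<open>\<open>u v\<close> is the first half of the form together with
    \<open>inv X\<close>. In \<open>inv u\<close> times \<open>inv v\<close> the inner
    \<open>inv X\<close> and \<open>X\<close> cancel, which leaves exactly the two eliminated
    entries.\<close>
  define u where "u = X \<otimes> a1 \<otimes> Y \<otimes> inv b2"
  define v where "v = b2 \<otimes> b1 \<otimes> Z \<otimes> a2 \<otimes> inv X"
  have "u \<in> carrier G" "v \<in> carrier G" using assms by (auto simp: u_def v_def)
  moreover have "wicks X Y Z a1 a2 b1 b2 = u \<otimes> v \<otimes> inv u \<otimes> inv v"
    using assms by (simp add: wicks_def u_def v_def free_group_simps)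
  ultimately show ?thesis by blast
qed

text \<open>Moving \<open>X a1\<close> from the front to the back yields a form of the same kind
  with the two families of entries exchanged; \<open>a1\<close> returns as the eliminated entry of
  its family. By this symmetry one piece or junction stands for all.\<close>

lemma wicks_rotate:
  assumes "{X, Y, Z, a1, a2, b1, b2} \<subseteq> carrier G"
  shows "wicks Y Z (inv X) b1 b2 a2 (inv a1 \<otimes> inv a2) =
    inv (X \<otimes> a1) \<otimes> wicks X Y Z a1 a2 b1 b2 \<otimes> inv (inv (X \<otimes> a1))"
  using assms by (simp add: wicks_def free_group_simps)

end

section \<open>Reduced words\<close>

locale two_groups =
  fixes G :: "'a monoid" and H :: "'b monoid"
  assumes group_G: "group G" and group_H: "group H"
begin

sublocale G: group G by (rule group_G)
sublocale H: group H by (rule group_H)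

abbreviation F :: "('a + 'b) list monoid" where "F \<equiv> free_product G H"
abbreviation W :: "('a + 'b) list set" where "W \<equiv> fp_words G H"
abbreviation fp_mult :: "('a + 'b) list \<Rightarrow> ('a + 'b) list \<Rightarrow> ('a + 'b) list" (infixl "\<cdot>" 70)
  where "(\<cdot>) \<equiv> mult F"

sublocale F: group "free_product G H" by (rule group_free_product [OF group_G group_H])

lemma carrier_F [simp]: "carrier F = W" and one_F [simp]: "\<one>\<^bsub>F\<^esub> = []"
  by (simp_all add: free_product_def)

lemma mult_F: "u \<cdot> v = foldr (fp_push G H) u v"
  by (simp add: free_product_def)

lemma mult_Nil [simp]: "w \<in> W \<Longrightarrow> [] \<cdot> w = w" "w \<in> W \<Longrightarrow> w \<cdot> [] = w"
  using F.l_one F.r_one unfolding carrier_F one_F by blast+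

lemma inv_Nil [simp]: "inv\<^bsub>F\<^esub> [] = []"
  using F.inv_one unfolding one_F .

lemma mult_closed [simp]: "u \<in> W \<Longrightarrow> v \<in> W \<Longrightarrow> u \<cdot> v \<in> W"
  and inv_closed [simp]: "u \<in> W \<Longrightarrow> inv\<^bsub>F\<^esub> u \<in> W"
  using F.m_closed F.inv_closed unfolding carrier_F by blast+

definition joinable :: "('a + 'b) list \<Rightarrow> ('a + 'b) list \<Rightarrow> bool" where
  "joinable u v \<longleftrightarrow> u = [] \<or> v = [] \<or> isl (last u) \<noteq> isl (hd v)"

definition linv :: "'a + 'b \<Rightarrow> 'a + 'b" where
  "linv x = (case x of Inl a \<Rightarrow> Inl (inv\<^bsub>G\<^esub> a) | Inr b \<Rightarrow> Inr (inv\<^bsub>H\<^esub> b))"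

lemma isl_linv [simp]: "isl (linv x) = isl x"
  by (cases x) (auto simp: linv_def)

lemma linv_closed: "x \<in> fp_letters G H \<Longrightarrow> linv x \<in> fp_letters G H"
  by (auto simp: linv_def fp_letters_def)

lemma linv_linv: "x \<in> fp_letters G H \<Longrightarrow> linv (linv x) = x"
  by (auto simp: linv_def fp_letters_def)

lemma push_joinable: "joinable [x] w \<Longrightarrow> fp_push G H x w = x # w"
  by (cases "(G, H, x, w)" rule: fp_push.cases) (auto simp: joinable_def)

lemma words_append: "u @ v \<in> W \<longleftrightarrow> u \<in> W \<and> v \<in> W \<and> joinable u v"
  by (auto simp: fp_words_def successively_append_iff joinable_def)

lemma words_Cons: "x # w \<in> W \<longleftrightarrow> x \<in> fp_letters G H \<and> w \<in> W \<and> joinable [x] w"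
  by (auto simp: fp_words_Cons joinable_def)

lemma words_letter: "w \<in> W \<Longrightarrow> x \<in> set w \<Longrightarrow> x \<in> fp_letters G H"
  by (auto simp: fp_words_def)

lemma mult_append:
  assumes "u \<in> W" "v \<in> W" "joinable u v"
  shows "u \<cdot> v = u @ v"
  using assms
proof (induction u)
  case Nil
  then show ?case by (simp add: mult_F)
next
  case (Cons x u)
  have *: "joinable u v" "joinable [x] (u @ v)" "u \<in> W"
    using Cons.prems by (auto simp: joinable_def words_Cons split: if_splits)
  then show ?case using Cons.IH [OF *(3) Cons.prems(2) *(1)] by (simp add: mult_F push_joinable)
qed

lemma letter_mult:
  assumes "x \<in> fp_letters G H" "y \<in> fp_letters G H" "isl x = isl y"
  shows "([x] \<cdot> [y] = [] \<and> y = linv x) \<or>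
    (\<exists>z. [x] \<cdot> [y] = [z] \<and> isl z = isl x \<and> z \<in> fp_letters G H \<and> y \<noteq> linv x)"
proof (cases x)
  case (Inl a)
  then obtain b where y: "y = Inl b" using assms(3) by (cases y) auto
  have c: "a \<in> carrier G" "b \<in> carrier G" "b \<noteq> \<one>\<^bsub>G\<^esub>" "a \<noteq> \<one>\<^bsub>G\<^esub>"
    using assms Inl y by (auto simp: fp_letters_def)
  have "a \<otimes>\<^bsub>G\<^esub> b = \<one>\<^bsub>G\<^esub> \<longleftrightarrow> b = inv\<^bsub>G\<^esub> a"
    using c by (metis G.inv_equality G.inv_inv G.r_inv)
  then show ?thesis using c by (auto simp: Inl y mult_F linv_def fp_letters_def)
next
  case (Inr a)
  then obtain b where y: "y = Inr b" using assms(3) by (cases y) auto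
  have c: "a \<in> carrier H" "b \<in> carrier H" "b \<noteq> \<one>\<^bsub>H\<^esub>" "a \<noteq> \<one>\<^bsub>H\<^esub>"
    using assms Inr y by (auto simp: fp_letters_def)
  have "a \<otimes>\<^bsub>H\<^esub> b = \<one>\<^bsub>H\<^esub> \<longleftrightarrow> b = inv\<^bsub>H\<^esub> a"
    using c by (metis H.inv_equality H.inv_inv H.r_inv)
  then show ?thesis using c by (auto simp: Inr y mult_F linv_def fp_letters_def)
qed

lemma letter_word: "[x] \<in> W \<longleftrightarrow> x \<in> fp_letters G H"
  by (simp add: words_Cons joinable_def)

lemma inv_letter:
  assumes "x \<in> fp_letters G H"
  shows "inv\<^bsub>F\<^esub> [x] = [linv x]"
proof (rule F.inv_equality)
  have "linv x \<in> fp_letters G H" "x = linv (linv x)" using assms by (auto simp: linv_closed linv_linv)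
  then show "[linv x] \<cdot> [x] = \<one>\<^bsub>F\<^esub>"
    using letter_mult [of "linv x" x] assms by auto
qed (use assms linv_closed in \<open>auto simp: letter_word\<close>)

definition winv :: "('a + 'b) list \<Rightarrow> ('a + 'b) list" where
  "winv w = rev (map linv w)"

lemma winv_simps [simp]:
  "length (winv w) = length w" "winv w = [] \<longleftrightarrow> w = []" "winv [] = []"
  "winv (u @ v) = winv v @ winv u" "winv [x] = [linv x]"
  by (auto simp: winv_def)

lemma isl_hd_winv [simp]: "w \<noteq> [] \<Longrightarrow> isl (hd (winv w)) = isl (last w)"
  and isl_last_winv [simp]: "w \<noteq> [] \<Longrightarrow> isl (last (winv w)) = isl (hd w)"
  by (auto simp: winv_def hd_rev last_rev last_map hd_map)

lemma joinable_winv [simp]: "joinable (winv u) (winv v) \<longleftrightarrow> joinable v u"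
  by (auto simp: joinable_def)

lemma inv_word: "w \<in> W \<Longrightarrow> inv\<^bsub>F\<^esub> w = winv w"
proof (induction w)
  case Nil
  show ?case by simp
next
  case (Cons x w)
  then have *: "[x] \<in> W" "w \<in> W" "joinable [x] w" "x \<in> fp_letters G H"
    by (auto simp: words_Cons joinable_def)
  have "inv\<^bsub>F\<^esub> (x # w) = inv\<^bsub>F\<^esub> ([x] \<cdot> w)"
    using mult_append [of "[x]" w] * by simp
  also have "\<dots> = inv\<^bsub>F\<^esub> w \<cdot> inv\<^bsub>F\<^esub> [x]"
    using * by (simp add: F.inv_mult_group)
  also have "\<dots> = winv w \<cdot> winv [x]"
    using Cons.IH * by (simp add: inv_letter)
  also have "\<dots> = winv w @ winv [x]"
  proof (rule mult_append)
    show "winv w \<in> W" using Cons.IH [OF *(2)] *(2) F.inv_closed [of w] by simp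
    show "joinable (winv w) (winv [x])" using *(3) by (simp only: joinable_winv)
  qed (use * linv_closed in \<open>simp add: letter_word\<close>)
  finally show ?case by (simp add: winv_def)
qed

lemma winv_closed: "w \<in> W \<Longrightarrow> winv w \<in> W"
  using inv_word F.inv_closed by fastforce

lemma winv_winv: "w \<in> W \<Longrightarrow> winv (winv w) = w"
  by (metis F.inv_inv carrier_F inv_word winv_closed)

lemma length_inv [simp]: "w \<in> W \<Longrightarrow> length (inv\<^bsub>F\<^esub> w) = length w"
  by (simp add: inv_word)

lemma inv_eq_Nil [simp]: "w \<in> W \<Longrightarrow> inv\<^bsub>F\<^esub> w = [] \<longleftrightarrow> w = []"
  by (simp add: inv_word)

lemma length_push: "length (fp_push G H x w) \<le> Suc (length w)"
  by (cases "(G, H, x, w)" rule: fp_push.cases) auto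

lemma length_mult: "length (u \<cdot> v) \<le> length u + length v"
  by (induction u) (auto simp: mult_F intro: le_trans [OF length_push])

lemma word_snocE:
  assumes "w \<in> W" "w \<noteq> []"
  obtains u x where "w = u @ [x]" "u \<in> W" "x \<in> fp_letters G H" "[x] \<in> W"
    "w = u \<cdot> [x]" "joinable u [x]" "x = last w"
proof -
  have "w = butlast w @ [last w]" using assms by simp
  moreover from this have "butlast w \<in> W" "[last w] \<in> W" "joinable (butlast w) [last w]"
    using assms words_append [of "butlast w" "[last w]"] by auto
  ultimately show ?thesis using that [of "butlast w" "last w"] mult_append letter_word by auto
qed

lemma word_ConsE:
  assumes "w \<in> W" "w \<noteq> []"
  obtains u x where "w = x # u" "u \<in> W" "x \<in> fp_letters G H" "[x] \<in> W"
    "w = [x] \<cdot> u" "joinable [x] u" "x = hd w"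
proof -
  have "w = [hd w] @ tl w" using assms by simp
  moreover from this have "tl w \<in> W" "[hd w] \<in> W" "joinable [hd w] (tl w)"
    using assms words_append [of "[hd w]" "tl w"] by auto
  ultimately show ?thesis using that [of "hd w" "tl w"] mult_append [of "[hd w]" "tl w"] letter_word by auto
qed

lemma word_length_eq:
  assumes "w \<in> W"
  shows "word_length F (fp_gens G H) w = length w"
proof -
  have gens: "fp_gens G H = (\<lambda>x. [x]) ` fp_letters G H"
    by (auto simp: fp_gens_def fp_letters_def fp_inl_def fp_inr_def image_iff)
  have up: "set v \<subseteq> fp_letters G H \<Longrightarrow> foldr (\<cdot>) (map (\<lambda>x. [x]) v) [] = foldr (fp_push G H) v []" for v
    by (induction v) (auto simp: mult_F)
  have 1: "\<exists>xs. length xs = length w \<and> set xs \<subseteq> fp_gens G H \<and> foldr (\<cdot>) xs \<one>\<^bsub>F\<^esub> = w"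
    using assms up [OF fp_words_letters [OF assms]] fp_foldr_Nil [OF group_G group_H assms]
    by (intro exI [of _ "map (\<lambda>x. [x]) w"]) (auto simp: gens dest: words_letter)
  have lo: "set xs \<subseteq> fp_gens G H \<Longrightarrow> length (foldr (\<cdot>) xs []) \<le> length xs" for xs
  proof (induction xs)
    case (Cons x xs)
    then have "length x = 1" by (auto simp: gens)
    then show ?case using length_mult [of x "foldr (\<cdot>) xs []"] Cons by auto
  qed simp
  show ?thesis
    unfolding word_length_def by (rule Least_equality) (use 1 lo in auto)
qed

section \<open>Cyclically reduced words\<close>

definition cyc_reduced :: "('a + 'b) list \<Rightarrow> bool" where
  "cyc_reduced w \<longleftrightarrow> w \<in> W \<and> w \<noteq> [] \<and> isl (hd w) \<noteq> isl (last w)"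

lemma cyc_reduced_append: "cyc_reduced (u @ v) \<longleftrightarrow>
    u @ v \<noteq> [] \<and> u \<in> W \<and> v \<in> W \<and> joinable u v \<and> (if u = [] \<or> v = [] then isl (hd (u @ v)) \<noteq> isl (last (u @ v)) else joinable v u)"
  by (auto simp: cyc_reduced_def words_append joinable_def)

lemma cyc_reduced_rotate1: "cyc_reduced (x # w) \<longleftrightarrow> cyc_reduced (w @ [x])"
  using cyc_reduced_append [of "[x]" w] cyc_reduced_append [of w "[x]"] by auto

text \<open>The two ends of \<open>w\<close> lie in different factors, so \<open>x\<close> can
  interact with only one of them. It either cancels there, which moves a letter to the other end, or
  it does not, and then both ends of the result lie in the factor of \<open>x\<close>.\<close>

lemma conj_letter_cases:
  assumes w: "cyc_reduced w" and x: "x \<in> fp_letters G H"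
  obtains r where "[x] \<cdot> w \<cdot> [linv x] = rotate r w" "cyc_reduced (rotate r w)"
  | v y z where "[x] \<cdot> w \<cdot> [linv x] = y # v @ [z]" "y # v @ [z] \<in> W"
      "isl y = isl x" "isl z = isl x" "length w \<le> length (y # v @ [z])"
proof -
  have wW: "w \<in> W" "w \<noteq> []" and ne: "isl (hd w) \<noteq> isl (last w)" using w by (auto simp: cyc_reduced_def)
  have xW: "[x] \<in> W" "[linv x] \<in> W" "linv x \<in> fp_letters G H"
    using x linv_closed by (auto simp: letter_word)
  show ?thesis
  proof (cases "isl x = isl (hd w)")
    case True
    obtain u y where u: "w = y # u" "u \<in> W" "y \<in> fp_letters G H" "[y] \<in> W" "w = [y] \<cdot> u" "joinable [y] u"
      using word_ConsE [OF wW] by metis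
    have une: "u \<noteq> []" using ne unfolding u(1) by (cases u) simp_all
    have last: "isl (last u) \<noteq> isl x" using ne True une unfolding u(1) by simp
    have j: "joinable u [linv x]" using last by (auto simp: joinable_def)
    have uW: "u @ [linv x] \<in> W" using u(2) xW j words_append by blast
    have e: "[x] \<cdot> w \<cdot> [linv x] = ([x] \<cdot> [y]) \<cdot> (u @ [linv x])"
      using mult_append [OF u(2) xW(2) j] u(2,4) xW u(5) uW by (simp add: F.m_assoc)
    have xy: "isl x = isl y" using True u(1) by simp
    from letter_mult [OF x u(3) xy] show ?thesis
    proof (elim disjE exE conjE)
      assume "[x] \<cdot> [y] = []" "y = linv x"
      then have "[x] \<cdot> w \<cdot> [linv x] = rotate 1 w" using e u(1) uW by (simp add: mult_F)
      moreover have "cyc_reduced (rotate 1 w)" using w u(1) cyc_reduced_rotate1 by simp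
      ultimately show ?thesis using that(1) by blast
    next
      fix z assume z: "[x] \<cdot> [y] = [z]" "isl z = isl x" "z \<in> fp_letters G H"
      have j2: "joinable [z] (u @ [linv x])" using u(6) z une xy by (auto simp: joinable_def)
      have "[x] \<cdot> w \<cdot> [linv x] = z # u @ [linv x]"
        using e z mult_append [OF _ uW j2] by (simp add: letter_word)
      moreover have "z # u @ [linv x] \<in> W" using words_Cons [of z "u @ [linv x]"] z j2 uW by auto
      ultimately show ?thesis using that(2) [of z u "linv x"] z True u(1) by auto
    qed
  next
    case False
    then have F: "isl x = isl (last w)" using ne by auto
    obtain u y where u: "w = u @ [y]" "u \<in> W" "y \<in> fp_letters G H" "[y] \<in> W" "w = u \<cdot> [y]" "joinable u [y]"
      using word_snocE [OF wW] by metis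
    have une: "u \<noteq> []" using ne unfolding u(1) by (cases u) simp_all
    have hd: "isl (hd u) \<noteq> isl x" using ne F une unfolding u(1) by simp
    have j: "joinable [x] u" using hd by (auto simp: joinable_def)
    have uW: "x # u \<in> W" using u(2) x j words_Cons by blast
    have e: "[x] \<cdot> w \<cdot> [linv x] = (x # u) \<cdot> ([y] \<cdot> [linv x])"
      using mult_append [OF xW(1) u(2) j] u(2,4) xW u(5) uW by (simp add: F.m_assoc [symmetric])
    have yx: "isl y = isl (linv x)" using F u(1) by simp
    from letter_mult [OF u(3) xW(3) yx] show ?thesis
    proof (elim disjE exE conjE)
      assume "[y] \<cdot> [linv x] = []" "linv x = linv y"
      moreover from this have "x = y" using linv_linv [OF x] linv_linv [OF u(3)] by metis
      ultimately have 1: "[x] \<cdot> w \<cdot> [linv x] = y # u"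
        using e uW by simp
      have 2: "y # u = rotate (length u) w" by (simp add: u(1) rotate_append)
      have "cyc_reduced (y # u)" using w u(1) cyc_reduced_rotate1 by simp
      then show ?thesis using that(1) [of "length u"] 1 2 by simp
    next
      fix z assume z: "[y] \<cdot> [linv x] = [z]" "isl z = isl y" "z \<in> fp_letters G H"
      have j2: "joinable (x # u) [z]" using u(6) z une yx by (auto simp: joinable_def)
      have "[x] \<cdot> w \<cdot> [linv x] = x # u @ [z]"
        using e z mult_append [OF uW _ j2] by (simp add: letter_word)
      moreover have "x # u @ [z] \<in> W" using words_append [of "x # u" "[z]"] z j2 uW letter_word by auto
      ultimately show ?thesis using that(2) [of x u z] z F u(1) by auto
    qed
  qed
qed

text \<open>The induction strips the letter of \<open>g\<close> that meets \<open>w\<close> first.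
  As long as letters cancel, \<open>w\<close> is merely rotated. Once one does not cancel, both ends
  lie in its factor, and the rest of \<open>g\<close>, being reduced, attaches on both sides without
  cancellation; the result then begins and ends in the same factor.\<close>

lemma conj_cyc_reduced:
  assumes "g \<in> W" "cyc_reduced w"
  defines "u \<equiv> g \<cdot> w \<cdot> inv\<^bsub>F\<^esub> g"
  shows "length w \<le> length u \<and> (cyc_reduced u \<longrightarrow> (\<exists>r. u = rotate r w))"
  using assms(1,2) unfolding u_def
proof (induction g arbitrary: w rule: rev_induct)
  case Nil
  have "w \<in> W" using Nil by (simp add: cyc_reduced_def)
  then have "[] \<cdot> w \<cdot> inv\<^bsub>F\<^esub> [] = w" by simp
  then show ?case by (auto intro: exI [of _ 0])
next
  case (snoc x g)
  have g: "g \<in> W" "x \<in> fp_letters G H" "[x] \<in> W" "joinable g [x]" "[linv x] \<in> W"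
    using snoc.prems(1) linv_closed by (auto simp: words_append letter_word)
  have w: "w \<in> W" using snoc.prems by (simp add: cyc_reduced_def)
  have e: "(g @ [x]) \<cdot> w \<cdot> inv\<^bsub>F\<^esub> (g @ [x]) =
      g \<cdot> ([x] \<cdot> w \<cdot> [linv x]) \<cdot> inv\<^bsub>F\<^esub> g"
    using g(1,3,5) w unfolding mult_append [OF g(1,3,4), symmetric]
    by (simp add: F.m_assoc F.inv_mult_group inv_letter [OF g(2)])
  show ?case
  proof (cases rule: conj_letter_cases [OF snoc.prems(2) g(2)])
    case (1 r)
    then show ?thesis using snoc.IH [OF g(1) 1(2)] e by (auto simp: rotate_rotate)
  next
    case (2 v y z)
    have yv: "y # v @ [z] \<in> W" by fact
    have j1: "joinable g (y # v @ [z])" using g(4) 2(3) by (auto simp: joinable_def)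
    have j2: "joinable (y # v @ [z]) (winv g)"
      using g(4) 2(4) by (auto simp: joinable_def)
    have 3: "g \<cdot> (y # v @ [z]) \<cdot> inv\<^bsub>F\<^esub> g = g @ (y # v @ [z]) @ winv g"
    proof -
      have "(y # v @ [z]) \<cdot> winv g = (y # v @ [z]) @ winv g"
        by (rule mult_append [OF yv winv_closed [OF g(1)] j2])
      moreover have "(y # v @ [z]) @ winv g \<in> W"
        using words_append yv winv_closed [OF g(1)] j2 by blast
      moreover have "joinable g ((y # v @ [z]) @ winv g)" using j1 by (auto simp: joinable_def)
      ultimately show ?thesis
        using g(1) yv winv_closed [OF g(1)] mult_append by (simp add: inv_word F.m_assoc)
    qed
    have "\<not> cyc_reduced (g @ (y # v @ [z]) @ winv g)"
      using 2(3,4) by (cases "g = []") (auto simp: cyc_reduced_def)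
    then show ?thesis using e 2 3 by auto
  qed
qed

lemma class_lengthI:
  assumes "C \<in> conjugacy_classes F" "w \<in> C" "cyc_reduced w"
  shows "class_length F (fp_gens G H) C = length w"
proof -
  obtain c where c: "c \<in> W" "C = conjugacy_class F c" using assms(1) by (auto simp: conjugacy_classes_def)
  obtain p where p: "p \<in> W" "w = p \<cdot> c \<cdot> inv\<^bsub>F\<^esub> p" using assms(2) unfolding c(2) conjugacy_class_def by auto
  have w: "w \<in> W" using assms(3) by (simp add: cyc_reduced_def)
  have "length w \<le> word_length F (fp_gens G H) u" if u: "u \<in> C" for u
  proof -
    obtain q where q: "q \<in> W" "u = q \<cdot> c \<cdot> inv\<^bsub>F\<^esub> q" using u unfolding c(2) conjugacy_class_def by auto
    have "c = inv\<^bsub>F\<^esub> p \<cdot> w \<cdot> p"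
      using p c(1) by (simp add: F.free_group_simps)
    then have uq: "u = (q \<cdot> inv\<^bsub>F\<^esub> p) \<cdot> w \<cdot> inv\<^bsub>F\<^esub> (q \<cdot> inv\<^bsub>F\<^esub> p)"
      using q p(1) w by (simp add: F.free_group_simps)
    have g: "q \<cdot> inv\<^bsub>F\<^esub> p \<in> W" using q(1) p(1) by simp
    moreover have "u \<in> W" using q c(1) by simp
    ultimately show ?thesis using conj_cyc_reduced [OF g assms(3)] uq by (simp add: word_length_eq)
  qed
  moreover have "word_length F (fp_gens G H) w = length w" using w by (rule word_length_eq)
  ultimately show ?thesis
    unfolding class_length_def using assms(2) by (intro Least_equality) auto
qed

section \<open>Wicks' theorem\<close>

text \<open>The embedded copy of \<open>G\<close> for \<open>True\<close> and of \<open>H\<close>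
  for \<open>False\<close>, with \<open>[]\<close> as identity.\<close>

definition factor :: "bool \<Rightarrow> ('a + 'b) list set" where
  "factor i = {w \<in> W. w = [] \<or> (\<exists>x. w = [x] \<and> isl x = i)}"

lemma factor_word: "w \<in> factor i \<Longrightarrow> w \<in> W"
  and Nil_factor [simp]: "[] \<in> factor i"
  by (auto simp: factor_def)

lemma letter_factor: "[x] \<in> W \<Longrightarrow> isl x = i \<Longrightarrow> [x] \<in> factor i"
  unfolding factor_def by blast

lemma factor_length: "w \<in> factor i \<Longrightarrow> length w \<le> 1"
  by (auto simp: factor_def)

lemma factor_inv [simp]: "w \<in> factor i \<Longrightarrow> inv\<^bsub>F\<^esub> w \<in> factor i"
  by (auto simp: factor_def inv_word letter_word linv_closed)

lemma factor_nonempty: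
  assumes "w \<in> factor i" "w \<noteq> []"
  shows "\<exists>x. w = [x] \<and> isl x = i \<and> x \<in> fp_letters G H"
  using assms by (auto simp: factor_def letter_word)

lemma factor_mult [simp]:
  assumes "u \<in> factor i" "v \<in> factor i"
  shows "u \<cdot> v \<in> factor i"
proof (cases "u = [] \<or> v = []")
  case True
  then show ?thesis using assms factor_word by auto
next
  case False
  then obtain x y where xy: "u = [x]" "v = [y]" "isl x = i" "isl y = i"
      "x \<in> fp_letters G H" "y \<in> fp_letters G H"
    using assms factor_nonempty by metis
  then have "isl x = isl y" by simp
  from letter_mult [OF xy(5,6) this] show ?thesis
    unfolding xy(1,2) using xy(3) by (elim disjE conjE exE) (simp_all add: letter_factor letter_word)
qed

section \<open>Minimal representatives of a set closed under conjugation\<close>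

definition rep :: "('a + 'b) list set \<Rightarrow> bool \<Rightarrow> bool \<Rightarrow> ('a + 'b) list \<Rightarrow> ('a + 'b) list \<Rightarrow> ('a + 'b) list \<Rightarrow>
    ('a + 'b) list \<Rightarrow> ('a + 'b) list \<Rightarrow> ('a + 'b) list \<Rightarrow> ('a + 'b) list \<Rightarrow> bool" where
  "rep C i j X Y Z a1 a2 b1 b2 \<longleftrightarrow> {X, Y, Z} \<subseteq> W \<and> {a1, a2} \<subseteq> factor i \<and> {b1, b2} \<subseteq> factor j \<and>
     F.wicks X Y Z a1 a2 b1 b2 \<in> C"

text \<open>The last summand breaks ties in favour of both families of entries lying in one factor;
  some moves below keep the total length and only achieve this. Lengths are doubled so that saving
  one letter still pays when equal factors become distinct, as in
  \<open>minrep_junction\<close>.\<close>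

definition cost :: "bool \<Rightarrow> bool \<Rightarrow> ('a + 'b) list \<Rightarrow> ('a + 'b) list \<Rightarrow> ('a + 'b) list \<Rightarrow> nat" where
  "cost i j X Y Z = 2 * (length X + length Y + length Z) + (if i = j then 0 else 1)"

definition minrep :: "('a + 'b) list set \<Rightarrow> bool \<Rightarrow> bool \<Rightarrow> ('a + 'b) list \<Rightarrow> ('a + 'b) list \<Rightarrow> ('a + 'b) list \<Rightarrow>
    ('a + 'b) list \<Rightarrow> ('a + 'b) list \<Rightarrow> ('a + 'b) list \<Rightarrow> ('a + 'b) list \<Rightarrow> bool" where
  "minrep C i j X Y Z a1 a2 b1 b2 \<longleftrightarrow> rep C i j X Y Z a1 a2 b1 b2 \<and>
     (\<forall>i' j' X' Y' Z' a1' a2' b1' b2'. rep C i' j' X' Y' Z' a1' a2' b1' b2' \<longrightarrow> cost i j X Y Z \<le> cost i' j' X' Y' Z')"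

lemma minrepD:
  assumes "minrep C i j X Y Z a1 a2 b1 b2"
  shows "rep C i j X Y Z a1 a2 b1 b2" "X \<in> W" "Y \<in> W" "Z \<in> W"
    "a1 \<in> factor i" "a2 \<in> factor i" "b1 \<in> factor j" "b2 \<in> factor j"
    "F.wicks X Y Z a1 a2 b1 b2 \<in> C" "a1 \<in> W" "a2 \<in> W" "b1 \<in> W" "b2 \<in> W"
proof -
  show "rep C i j X Y Z a1 a2 b1 b2" using assms unfolding minrep_def by (rule conjunct1)
  then show "X \<in> W" "Y \<in> W" "Z \<in> W" "a1 \<in> factor i" "a2 \<in> factor i" "b1 \<in> factor j" "b2 \<in> factor j"
    "F.wicks X Y Z a1 a2 b1 b2 \<in> C" "a1 \<in> W" "a2 \<in> W" "b1 \<in> W" "b2 \<in> W"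
    by (simp_all add: rep_def factor_word [of _ i] factor_word [of _ j])
qed

lemma minrep_least:
  "minrep C i j X Y Z a1 a2 b1 b2 \<Longrightarrow> rep C i' j' X' Y' Z' a1' a2' b1' b2' \<Longrightarrow> cost i j X Y Z \<le> cost i' j' X' Y' Z'"
  unfolding minrep_def by blast

lemma minrep_exists:
  assumes "rep C i j X Y Z a1 a2 b1 b2"
  shows "\<exists>i j X Y Z a1 a2 b1 b2. minrep C i j X Y Z a1 a2 b1 b2"
proof -
  define P where "P = (\<lambda>(i, j, X, Y, Z, a1, a2, b1, b2). rep C i j X Y Z a1 a2 b1 b2)"
  define m where "m = (\<lambda>(i, j, X, Y, Z, a1 :: ('a + 'b) list, a2 :: ('a + 'b) list, b1 :: ('a + 'b) list, b2 :: ('a + 'b) list). cost i j X Y Z)"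
  have "P (i, j, X, Y, Z, a1, a2, b1, b2)" using assms by (simp add: P_def)
  then obtain t where "P t" and least: "\<And>s. P s \<Longrightarrow> m t \<le> m s"
    using ex_has_least_nat [of P _ m] by blast
  obtain i j X Y Z s where t: "t = (i, j, X, Y, Z, s)" by (cases t) auto
  obtain a1 a2 b1 b2 where s: "s = (a1, a2, b1, b2)" by (cases s) auto
  have "minrep C i j X Y Z a1 a2 b1 b2"
    unfolding minrep_def
  proof (intro conjI allI impI)
    show "rep C i j X Y Z a1 a2 b1 b2" using \<open>P t\<close> by (simp add: t s P_def)
    fix i' j' X' Y' Z' a1' a2' b1' b2'
    assume "rep C i' j' X' Y' Z' a1' a2' b1' b2'"
    then have "P (i', j', X', Y', Z', a1', a2', b1', b2')" by (simp add: P_def)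
    from least [OF this] show "cost i j X Y Z \<le> cost i' j' X' Y' Z'" by (simp add: t s m_def)
  qed
  then show ?thesis by blast
qed

definition conj_closed :: "('a + 'b) list set \<Rightarrow> bool" where
  "conj_closed C \<longleftrightarrow> C \<subseteq> W \<and> (\<forall>g\<in>W. \<forall>c\<in>C. g \<cdot> c \<cdot> inv\<^bsub>F\<^esub> g \<in> C)"

lemma conj_closedD: "conj_closed C \<Longrightarrow> g \<in> W \<Longrightarrow> c \<in> C \<Longrightarrow> g \<cdot> c \<cdot> inv\<^bsub>F\<^esub> g \<in> C"
  by (simp add: conj_closed_def)

lemma conj_closed_eq:
  "conj_closed C \<Longrightarrow> g \<in> W \<Longrightarrow> c \<in> C \<Longrightarrow> d = g \<cdot> c \<cdot> inv\<^bsub>F\<^esub> g \<Longrightarrow> d \<in> C"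
  by (simp add: conj_closed_def)

lemma cancel_F [simp]: "x \<in> W \<Longrightarrow> inv\<^bsub>F\<^esub> x \<cdot> x = []" "x \<in> W \<Longrightarrow> x \<cdot> inv\<^bsub>F\<^esub> x = []"
  using F.l_inv F.r_inv unfolding carrier_F one_F by blast+

text \<open>The cost is symmetric in the pieces and in the two factors, hence invariant under
  rotation. What is proved about one place of every minimal representative therefore holds at all
  six.\<close>

lemma minrep_rotate:
  assumes C: "conj_closed C" and m: "minrep C i j X Y Z a1 a2 b1 b2"
  shows "minrep C j i Y Z (inv\<^bsub>F\<^esub> X) b1 b2 a2 (inv\<^bsub>F\<^esub> a1 \<cdot> inv\<^bsub>F\<^esub> a2)"
proof -
  note d = minrepD [OF m]
  have "F.wicks Y Z (inv\<^bsub>F\<^esub> X) b1 b2 a2 (inv\<^bsub>F\<^esub> a1 \<cdot> inv\<^bsub>F\<^esub> a2) \<in> C"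
    using d(2-13) by (intro conj_closed_eq [OF C _ d(9), of "inv\<^bsub>F\<^esub> (X \<cdot> a1)"] F.wicks_rotate) auto
  then have 1: "rep C j i Y Z (inv\<^bsub>F\<^esub> X) b1 b2 a2 (inv\<^bsub>F\<^esub> a1 \<cdot> inv\<^bsub>F\<^esub> a2)"
    using d(2-13) by (simp add: rep_def)
  have "cost j i Y Z (inv\<^bsub>F\<^esub> X) = cost i j X Y Z"
    using d(2) by (simp add: cost_def eq_commute)
  then show ?thesis
    unfolding minrep_def using 1 minrep_least [OF m] by metis
qed

text \<open>Half a turn returns each piece, inverted, to its own place. It thus preserves the
  pattern of empty pieces while exchanging the families of entries, and serves as a mirror in the
  degenerate cases.\<close>

lemma minrep_rotate3:
  assumes C: "conj_closed C" and m: "minrep C i j X Y Z a1 a2 b1 b2"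
  shows "minrep C j i (inv\<^bsub>F\<^esub> X) (inv\<^bsub>F\<^esub> Y) (inv\<^bsub>F\<^esub> Z) b2 (inv\<^bsub>F\<^esub> b1 \<cdot> inv\<^bsub>F\<^esub> b2)
    (inv\<^bsub>F\<^esub> a1 \<cdot> inv\<^bsub>F\<^esub> a2) a1"
  using minrep_rotate [OF C minrep_rotate [OF C minrep_rotate [OF C m]]] minrepD [OF m]
  by (simp add: F.free_group_simps)

text \<open>A last letter \<open>x\<close> of \<open>X\<close> in the factor of the \<open>a\<close>
  entries could be moved into \<open>a1\<close> and its inverse into \<open>a2\<close>; the product
  \<open>a2 a1\<close>, and with it the third entry, would stay the same.\<close>

lemma minrep_end:
  assumes m: "minrep C i j X Y Z a1 a2 b1 b2" and X: "X \<noteq> []"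
  shows "isl (last X) \<noteq> i"
proof
  assume l: "isl (last X) = i"
  note d = minrepD [OF m]
  obtain u x where u: "X = u @ [x]" "u \<in> W" "[x] \<in> W" "X = u \<cdot> [x]" "x = last X"
    using word_snocE [OF d(2) X] by metis
  have x: "[x] \<in> factor i" using letter_factor [OF u(3)] l unfolding u(5) by simp
  have "F.wicks u Y Z ([x] \<cdot> a1) (a2 \<cdot> inv\<^bsub>F\<^esub> [x]) b1 b2 = F.wicks X Y Z a1 a2 b1 b2"
    using u(2,3) d(2-13) unfolding u(4) by (simp add: F.wicks_def F.free_group_simps)
  then have "rep C i j u Y Z ([x] \<cdot> a1) (a2 \<cdot> inv\<^bsub>F\<^esub> [x]) b1 b2"
    using d u(2) x by (simp add: rep_def)
  from minrep_least [OF m this] show False by (simp add: cost_def u(1))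
qed

lemma minrep_ends:
  assumes C: "conj_closed C" and m: "minrep C i j X Y Z a1 a2 b1 b2"
  shows "X \<noteq> [] \<Longrightarrow> isl (last X) \<noteq> i \<and> isl (hd X) \<noteq> j"
    "Y \<noteq> [] \<Longrightarrow> isl (last Y) \<noteq> j \<and> isl (hd Y) \<noteq> i"
    "Z \<noteq> [] \<Longrightarrow> isl (last Z) \<noteq> i \<and> isl (hd Z) \<noteq> j"
proof -
  note d = minrepD [OF m]
  note m1 = minrep_rotate [OF C m]
  note m2 = minrep_rotate [OF C m1]
  note m3 = minrep_rotate [OF C m2]
  note m4 = minrep_rotate [OF C m3]
  note m5 = minrep_rotate [OF C m4]
  show "X \<noteq> [] \<Longrightarrow> isl (last X) \<noteq> i \<and> isl (hd X) \<noteq> j"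
    using minrep_end [OF m] minrep_end [OF m3] d by (simp add: inv_word)
  show "Y \<noteq> [] \<Longrightarrow> isl (last Y) \<noteq> j \<and> isl (hd Y) \<noteq> i"
    using minrep_end [OF m1] minrep_end [OF m4] d by (simp add: inv_word)
  show "Z \<noteq> [] \<Longrightarrow> isl (last Z) \<noteq> i \<and> isl (hd Z) \<noteq> j"
    using minrep_end [OF m2] minrep_end [OF m5] d by (simp add: inv_word)
qed

text \<open>If \<open>a1\<close> is trivial, the letters \<open>x\<close> and \<open>y\<close>
  meeting there lie in the other factor and can become a new family of entries \<open>x y\<close>,
  \<open>x\<inverse>\<close>, \<open>y\<inverse>\<close>, while \<open>a2\<close> is absorbed into
  \<open>Z\<close>. Two letters are saved and at most one is added.\<close>

lemma minrep_junction:
  assumes C: "conj_closed C" and m: "minrep C i j X Y Z a1 a2 b1 b2" and ne: "X \<noteq> []" "Y \<noteq> []"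
  shows "a1 \<noteq> []"
proof
  assume a1: "a1 = []"
  note d = minrepD [OF m]
  obtain u x where u: "X = u @ [x]" "u \<in> W" "[x] \<in> W" "X = u \<cdot> [x]" "x = last X"
    using word_snocE [OF d(2) ne(1)] by metis
  obtain v y where v: "Y = y # v" "v \<in> W" "[y] \<in> W" "Y = [y] \<cdot> v" "y = hd Y"
    using word_ConsE [OF d(3) ne(2)] by metis
  have i: "isl x = (\<not> i)" "isl y = (\<not> i)"
    using minrep_ends(1,2) [OF C m] ne unfolding u(5) v(5) by blast+
  note xy = letter_factor [OF u(3) i(1)] letter_factor [OF v(3) i(2)]
  have "F.wicks u v (Z \<cdot> a2) ([x] \<cdot> [y]) (inv\<^bsub>F\<^esub> [x]) b1 b2 = F.wicks X Y Z [] a2 b1 b2"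
    using u(2,3) v(2,3) d(2-13) unfolding u(4) v(4) by (simp add: F.wicks_def F.free_group_simps)
  then have "rep C (\<not> i) j u v (Z \<cdot> a2) ([x] \<cdot> [y]) (inv\<^bsub>F\<^esub> [x]) b1 b2"
    using d u(2) v(2) xy a1 by (simp add: rep_def)
  from minrep_least [OF m this] show False
    using length_mult [of Z a2] factor_length [OF d(6)] by (auto simp: cost_def u(1) v(1) split: if_splits)
qed

lemma minrep_junction_YZ:
  assumes C: "conj_closed C" and m: "minrep C i j X Y Z a1 a2 b1 b2" and ne: "Y \<noteq> []" "Z \<noteq> []"
  shows "b1 \<noteq> []" "inv\<^bsub>F\<^esub> a1 \<cdot> inv\<^bsub>F\<^esub> a2 \<noteq> []"
proof -
  note d = minrepD [OF m]
  note m1 = minrep_rotate [OF C m]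
  note m4 = minrep_rotate [OF C minrep_rotate3 [OF C m]]
  show "b1 \<noteq> []" using minrep_junction [OF C m1] ne by simp
  show "inv\<^bsub>F\<^esub> a1 \<cdot> inv\<^bsub>F\<^esub> a2 \<noteq> []" using minrep_junction [OF C m4] ne d by simp
qed

text \<open>With \<open>X\<close> empty, \<open>a2\<close> and \<open>b2\<close> touch. If they
  cancel, \<open>Z\<close> meets \<open>Y\<inverse>\<close> directly: the last letters of
  \<open>Y\<close> and \<open>Z\<close> turn into entries of the other factor, and the old entries
  regroup into a single family after conjugation by \<open>a1\<inverse>\<close>. Two letters are
  saved.\<close>

lemma minrep_same_factor:
  assumes C: "conj_closed C" and m: "minrep C i i [] Y Z a1 a2 b1 b2" and ne: "Y \<noteq> []" "Z \<noteq> []"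
  shows "a2 \<cdot> b2 \<noteq> []"
proof
  assume ab: "a2 \<cdot> b2 = []"
  note d = minrepD [OF m]
  have b2: "b2 = inv\<^bsub>F\<^esub> a2"
    using ab d(11,13) F.inv_equality [of a2 b2] F.inv_inv [of b2] by simp
  obtain u y where u: "Y = u @ [y]" "u \<in> W" "[y] \<in> W" "Y = u \<cdot> [y]" "y = last Y"
    using word_snocE [OF d(3) ne(1)] by metis
  obtain v z where v: "Z = v @ [z]" "v \<in> W" "[z] \<in> W" "Z = v \<cdot> [z]" "z = last Z"
    using word_snocE [OF d(4) ne(2)] by metis
  have i: "isl y = (\<not> i)" "isl z = (\<not> i)"
    using minrep_ends(2,3) [OF C m] ne unfolding u(5) v(5) by blast+
  note yz = letter_factor [OF u(3) i(1)] letter_factor [OF v(3) i(2)]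
  have "F.wicks u [] v [y] ([z] \<cdot> inv\<^bsub>F\<^esub> [y]) b1 (inv\<^bsub>F\<^esub> (a2 \<cdot> a1)) =
      inv\<^bsub>F\<^esub> a1 \<cdot> F.wicks [] Y Z a1 a2 b1 b2 \<cdot> inv\<^bsub>F\<^esub> (inv\<^bsub>F\<^esub> a1)"
    using u(2,3) v(2,3) d(2-13) unfolding u(4) v(4) b2 by (simp add: F.wicks_def F.free_group_simps)
  then have "F.wicks u [] v [y] ([z] \<cdot> inv\<^bsub>F\<^esub> [y]) b1 (inv\<^bsub>F\<^esub> (a2 \<cdot> a1)) \<in> C"
    using conj_closed_eq [OF C _ d(9)] d(10) inv_closed by blast
  then have "rep C (\<not> i) i u [] v [y] ([z] \<cdot> inv\<^bsub>F\<^esub> [y]) b1 (inv\<^bsub>F\<^esub> (a2 \<cdot> a1))"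
    using d u(2) v(2) yz by (simp add: rep_def)
  from minrep_least [OF m this] show False by (auto simp: cost_def u(1) v(1))
qed

text \<open>The ends of \<open>Y\<close> and \<open>Z\<close> at the \<open>a\<close> entries lie in
  the factor \<open>j\<close>. If \<open>a1\<close> is trivial, the first letter of \<open>Y\<close>
  becomes an entry in \<open>j\<close> and \<open>a2\<close> is absorbed into \<open>Z\<close>;
  symmetrically for \<open>a2\<close>. The total length does not grow and both families now lie in
  \<open>j\<close>, so the tie-break of \<open>cost\<close> decides.\<close>

lemma minrep_distinct_factors:
  assumes C: "conj_closed C" and m: "minrep C i j [] Y Z a1 a2 b1 b2" and ij: "i \<noteq> j"
  shows "Y \<noteq> [] \<Longrightarrow> a1 \<noteq> []" "Z \<noteq> [] \<Longrightarrow> a2 \<noteq> []"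
proof -
  note d = minrepD [OF m]
  assume ne: "Y \<noteq> []"
  show "a1 \<noteq> []"
  proof
    assume a1: "a1 = []"
    obtain u y where u: "Y = y # u" "u \<in> W" "[y] \<in> W" "Y = [y] \<cdot> u" "y = hd Y"
      using word_ConsE [OF d(3) ne(1)] by metis
    have "isl y = j" using minrep_ends(2) [OF C m] ne ij unfolding u(5) by blast
    note y = letter_factor [OF u(3) this]
    have "F.wicks [] u (Z \<cdot> a2) [y] [] b1 b2 = F.wicks [] Y Z [] a2 b1 b2"
      using u(2,3) d(2-13) unfolding u(4) by (simp add: F.wicks_def F.free_group_simps)
    then have "rep C j j [] u (Z \<cdot> a2) [y] [] b1 b2"
      using d u(2) y a1 by (simp add: rep_def)
    from minrep_least [OF m this] show False
      using length_mult [of Z a2] factor_length [OF d(6)] ij by (auto simp: cost_def u(1))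
  qed
next
  note d = minrepD [OF m]
  assume ne: "Z \<noteq> []"
  show "a2 \<noteq> []"
  proof
    assume a2: "a2 = []"
    obtain v z where v: "Z = v @ [z]" "v \<in> W" "[z] \<in> W" "Z = v \<cdot> [z]" "z = last Z"
      using word_snocE [OF d(4) ne] by metis
    have "isl z = j" using minrep_ends(3) [OF C m] ne ij unfolding v(5) by blast
    note z = letter_factor [OF v(3) this]
    have "F.wicks [] (a1 \<cdot> Y) v [] [z] b1 b2 = F.wicks [] Y Z a1 [] b1 b2"
      using v(2,3) d(2-13) unfolding v(4) by (simp add: F.wicks_def F.free_group_simps)
    then have "rep C j j [] (a1 \<cdot> Y) v [] [z] b1 b2"
      using d v(2) z a2 by (simp add: rep_def)
    from minrep_least [OF m this] show False
      using length_mult [of a1 Y] factor_length [OF d(5)] ij by (auto simp: cost_def v(1))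
  qed
qed

text \<open>\<open>?Q\<close> is everything between \<open>Z\<close> and \<open>Z\<inverse>\<close>.
  If it is trivial, the value does not depend on \<open>Z\<close>, and \<open>[]\<close> would be
  cheaper.\<close>

lemma minrep_one_piece_same:
  assumes m: "minrep C i i [] [] Z a1 a2 b1 b2" and ne: "Z \<noteq> []"
  shows "a2 \<cdot> b2 \<cdot> (inv\<^bsub>F\<^esub> a1 \<cdot> inv\<^bsub>F\<^esub> a2) \<noteq> []" (is "?Q \<noteq> []")
proof
  assume Q: "?Q = []"
  note d = minrepD [OF m]
  have "F.wicks [] [] V a1 a2 b1 b2 = a1 \<cdot> b1 \<cdot> V \<cdot> ?Q \<cdot> inv\<^bsub>F\<^esub> V \<cdot> (inv\<^bsub>F\<^esub> b1 \<cdot> inv\<^bsub>F\<^esub> b2)"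
    if "V \<in> W" for V
    using d(10-13) that by (simp add: F.wicks_def F.m_assoc)
  then have "F.wicks [] [] V a1 a2 b1 b2 = a1 \<cdot> inv\<^bsub>F\<^esub> b2" if "V \<in> W" for V
    using d(10-13) that unfolding Q by (simp add: F.free_group_simps)
  then have "rep C i i [] [] [] a1 a2 b1 b2" using d by (simp add: rep_def)
  from minrep_least [OF m this] show False using ne by (simp add: cost_def)
qed

text \<open>If the third \<open>a\<close> entry is trivial, then \<open>a2\<close> inverts
  \<open>a1\<close>, and \<open>a1\<close> can play the role of a piece of length at most 1, while
  the last letter of \<open>Z\<close> joins the entries in \<open>j\<close>. Again only the
  tie-break improves.\<close>

lemma minrep_one_piece_distinct:
  assumes C: "conj_closed C" and m: "minrep C i j [] [] Z a1 a2 b1 b2" and ij: "i \<noteq> j" and ne: "Z \<noteq> []"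
  shows "inv\<^bsub>F\<^esub> a1 \<cdot> inv\<^bsub>F\<^esub> a2 \<noteq> []"
proof
  assume a3: "inv\<^bsub>F\<^esub> a1 \<cdot> inv\<^bsub>F\<^esub> a2 = []"
  note d = minrepD [OF m]
  have a2: "a2 = inv\<^bsub>F\<^esub> a1"
    using a3 d(10,11) F.inv_equality [of "inv\<^bsub>F\<^esub> a1" "inv\<^bsub>F\<^esub> a2"] F.inv_inv [of a2] by simp
  obtain v z where v: "Z = v @ [z]" "v \<in> W" "[z] \<in> W" "Z = v \<cdot> [z]" "z = last Z"
    using word_snocE [OF d(4) ne] by metis
  have "isl z = j" using minrep_ends(3) [OF C m] ne ij unfolding v(5) by blast
  note z = letter_factor [OF v(3) this]
  have "F.wicks [] a1 v [] ([z] \<cdot> inv\<^bsub>F\<^esub> b2) b1 b2 = F.wicks [] [] Z a1 a2 b1 b2"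
    using v(2,3) d(2-13) unfolding v(4) a2 by (simp add: F.wicks_def F.free_group_simps)
  then have "rep C j j [] a1 v [] ([z] \<cdot> inv\<^bsub>F\<^esub> b2) b1 b2"
    using d v(2) z by (simp add: rep_def)
  from minrep_least [OF m this] show False
    using factor_length [OF d(5)] ij by (auto simp: cost_def v(1))
qed

section \<open>Products of reduced blocks, generic forms and their words\<close>

lemma mult_concat:
  assumes "set us \<subseteq> W - {[]}" "successively (\<lambda>u v. isl (last u) \<noteq> isl (hd v)) us"
  shows "foldr (\<cdot>) us [] = concat us" "concat us \<in> W"
proof -
  have "foldr (\<cdot>) us [] = concat us \<and> concat us \<in> W" using assms
  proof (induction us)
    case (Cons u us)
    then have "successively (\<lambda>u v. isl (last u) \<noteq> isl (hd v)) us" by (cases us) simp_all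
    with Cons have IH: "foldr (\<cdot>) us [] = concat us" "concat us \<in> W" and u: "u \<in> W" by simp_all
    have "joinable u (concat us)"
      using Cons.prems by (cases us) (simp_all add: joinable_def)
    then show ?case using mult_append [OF u IH(2)] IH u by (simp add: words_append)
  qed simp
  then show "foldr (\<cdot>) us [] = concat us" "concat us \<in> W" by simp_all
qed

lemma concat_cyc_reduced:
  assumes "set us \<subseteq> W - {[]}" "successively (\<lambda>u v. isl (last u) \<noteq> isl (hd v)) us" "us \<noteq> []"
    "isl (hd (hd us)) \<noteq> isl (last (last us))"
  shows "cyc_reduced (concat us)"
proof -
  have "hd us \<noteq> []" "last us \<noteq> []" using assms(1) hd_in_set [OF assms(3)] last_in_set [OF assms(3)] by blast+
  moreover have "concat us = hd us @ concat (tl us)" "concat us = concat (butlast us) @ last us"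
    using assms(3) by (metis concat.simps(2) list.collapse, metis append_butlast_last_id concat_append concat.simps append_Nil2)
  ultimately have "concat us \<noteq> []" "hd (concat us) = hd (hd us)" "last (concat us) = last (last us)"
    by (simp, metis hd_append2, metis last_appendR)
  then show ?thesis using mult_concat(2) [OF assms(1,2)] assms(4) by (simp add: cyc_reduced_def)
qed

lemma length_product: "length (foldr (\<cdot>) us []) \<le> sum_list (map length us)"
proof (induction us)
  case (Cons u us)
  then show ?case using length_mult [of u "foldr (\<cdot>) us []"] by simp
qed simp

lemma word_parity: "w \<in> W \<Longrightarrow> w \<noteq> [] \<Longrightarrow> (isl (hd w) = isl (last w)) = odd (length w)"
proof (induction w)
  case (Cons x w)
  then show ?case by (cases "w = []") (auto simp: words_Cons joinable_def)
qed simp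

lemma factor_ends:
  assumes "a \<in> factor i" "a \<noteq> []"
  shows "isl (hd a) = i" "isl (last a) = i"
  using factor_nonempty [OF assms] by force+

lemma class_conj_closed:
  assumes "C \<in> conjugacy_classes F"
  shows "conj_closed C"
proof -
  obtain c where c: "c \<in> W" "C = (\<lambda>x. x \<cdot> c \<cdot> inv\<^bsub>F\<^esub> x) ` W"
    using assms by (auto simp: conjugacy_classes_def conjugacy_class_def)
  have "g \<cdot> d \<cdot> inv\<^bsub>F\<^esub> g \<in> C" if g: "g \<in> W" and d: "d \<in> C" for g d
  proof -
    obtain x where x: "x \<in> W" "d = x \<cdot> c \<cdot> inv\<^bsub>F\<^esub> x" using d c by auto
    have "g \<cdot> d \<cdot> inv\<^bsub>F\<^esub> g = (g \<cdot> x) \<cdot> c \<cdot> inv\<^bsub>F\<^esub> (g \<cdot> x)"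
      using g x c(1) by (simp add: F.free_group_simps)
    moreover have "g \<cdot> x \<in> W" using g x by simp
    ultimately show ?thesis unfolding c(2) by blast
  qed
  moreover have "C \<subseteq> W" using c by auto
  ultimately show ?thesis by (simp add: conj_closed_def)
qed

lemma class_length_le:
  assumes "C \<in> conjugacy_classes F" "w \<in> C"
  shows "class_length F (fp_gens G H) C \<le> length w"
proof -
  have "w \<in> W" using class_conj_closed [OF assms(1)] assms(2) by (auto simp: conj_closed_def)
  then show ?thesis
    unfolding class_length_def using assms(2) by (intro Least_le bexI [of _ w]) (simp_all add: word_length_eq)
qed

definition generic :: "bool \<Rightarrow> bool \<Rightarrow> ('a + 'b) list \<Rightarrow> ('a + 'b) list \<Rightarrow> ('a + 'b) list \<Rightarrow>
    ('a + 'b) list \<Rightarrow> ('a + 'b) list \<Rightarrow> ('a + 'b) list \<Rightarrow> ('a + 'b) list \<Rightarrow> bool" where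
  "generic i j X Y Z a1 a2 b1 b2 \<longleftrightarrow> {X, Y, Z} \<subseteq> W - {[]} \<and> {a1, a2} \<subseteq> factor i - {[]} \<and> {b1, b2} \<subseteq> factor j - {[]} \<and>
     inv\<^bsub>F\<^esub> a1 \<cdot> inv\<^bsub>F\<^esub> a2 \<noteq> [] \<and> inv\<^bsub>F\<^esub> b1 \<cdot> inv\<^bsub>F\<^esub> b2 \<noteq> [] \<and>
     isl (hd X) = (\<not> j) \<and> isl (last X) = (\<not> i) \<and> isl (hd Y) = (\<not> i) \<and> isl (last Y) = (\<not> j) \<and>
     isl (hd Z) = (\<not> j) \<and> isl (last Z) = (\<not> i)"

lemma wicks_product:
  assumes "{X, Y, Z, a1, a2, b1, b2} \<subseteq> W"
  shows "F.wicks X Y Z a1 a2 b1 b2 = foldr (\<cdot>) [X, a1, Y, b1, Z, a2, winv X, b2, winv Y,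
    inv\<^bsub>F\<^esub> a1 \<cdot> inv\<^bsub>F\<^esub> a2, winv Z, inv\<^bsub>F\<^esub> b1 \<cdot> inv\<^bsub>F\<^esub> b2] []"
  using assms by (simp add: F.wicks_def F.m_assoc flip: inv_word)

lemma wicks_length:
  assumes "{X, Y, Z} \<subseteq> W" "{a1, a2} \<subseteq> factor i" "{b1, b2} \<subseteq> factor j"
  shows "length (F.wicks X Y Z a1 a2 b1 b2) \<le> 2 * (length X + length Y + length Z) + 6"
proof -
  have W: "{X, Y, Z, a1, a2, b1, b2} \<subseteq> W" using assms factor_word by auto
  have "inv\<^bsub>F\<^esub> a1 \<cdot> inv\<^bsub>F\<^esub> a2 \<in> factor i" "inv\<^bsub>F\<^esub> b1 \<cdot> inv\<^bsub>F\<^esub> b2 \<in> factor j" using assms by simp_all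
  then have "length (inv\<^bsub>F\<^esub> a1 \<cdot> inv\<^bsub>F\<^esub> a2) \<le> 1" "length (inv\<^bsub>F\<^esub> b1 \<cdot> inv\<^bsub>F\<^esub> b2) \<le> 1"
    by (simp_all only: factor_length)
  moreover have "length a1 \<le> 1" "length a2 \<le> 1" "length b1 \<le> 1" "length b2 \<le> 1"
    using assms factor_length by blast+
  ultimately show ?thesis
    unfolding wicks_product [OF W] by (intro le_trans [OF length_product]) simp
qed

lemma generic_word:
  assumes "generic i j X Y Z a1 a2 b1 b2"
  defines "a3 \<equiv> inv\<^bsub>F\<^esub> a1 \<cdot> inv\<^bsub>F\<^esub> a2" and "b3 \<equiv> inv\<^bsub>F\<^esub> b1 \<cdot> inv\<^bsub>F\<^esub> b2"
  shows "F.wicks X Y Z a1 a2 b1 b2 = X @ a1 @ Y @ b1 @ Z @ a2 @ winv X @ b2 @ winv Y @ a3 @ winv Z @ b3" (is "_ = ?w")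
    and "cyc_reduced (F.wicks X Y Z a1 a2 b1 b2)"
    and "length (F.wicks X Y Z a1 a2 b1 b2) = 2 * (length X + length Y + length Z) + 6"
proof -
  let ?us = "[X, a1, Y, b1, Z, a2, winv X, b2, winv Y, a3, winv Z, b3]"
  have W: "X \<in> W" "Y \<in> W" "Z \<in> W" and ne: "X \<noteq> []" "Y \<noteq> []" "Z \<noteq> []"
    and fac: "a1 \<in> factor i" "a2 \<in> factor i" "b1 \<in> factor j" "b2 \<in> factor j"
    and fne: "a1 \<noteq> []" "a2 \<noteq> []" "a3 \<noteq> []" "b1 \<noteq> []" "b2 \<noteq> []" "b3 \<noteq> []"
    and ends: "isl (hd X) = (\<not> j)" "isl (last X) = (\<not> i)" "isl (hd Y) = (\<not> i)" "isl (last Y) = (\<not> j)"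
     "isl (hd Z) = (\<not> j)" "isl (last Z) = (\<not> i)"
    using assms by (simp_all add: generic_def)
  have fac3: "a3 \<in> factor i" "b3 \<in> factor j" using fac by (simp_all add: a3_def b3_def)
  note fac_ends = fac [THEN factor_ends(1)] fac [THEN factor_ends(2)] fac3 [THEN factor_ends(1)] fac3 [THEN factor_ends(2)]
  note fW = fac [THEN factor_word] fac3 [THEN factor_word]
  have us: "set ?us \<subseteq> W - {[]}" using W ne fne fW winv_closed by simp
  have succ: "successively (\<lambda>u v. isl (last u) \<noteq> isl (hd v)) ?us"
    using fne ne by (simp add: fac_ends ends)
  have "F.wicks X Y Z a1 a2 b1 b2 = foldr (\<cdot>) ?us []"
    using wicks_product [of X Y Z a1 a2 b1 b2] W fW unfolding a3_def b3_def by simp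
  also have "\<dots> = concat ?us" by (rule mult_concat [OF us succ])
  finally have eq: "F.wicks X Y Z a1 a2 b1 b2 = concat ?us" .
  then show "F.wicks X Y Z a1 a2 b1 b2 = ?w" by simp
  show "cyc_reduced (F.wicks X Y Z a1 a2 b1 b2)"
    unfolding eq using fne ne by (intro concat_cyc_reduced [OF us succ]) (simp_all add: fac_ends ends)
  have "length a1 = 1" "length a2 = 1" "length a3 = 1" "length b1 = 1" "length b2 = 1" "length b3 = 1"
    using fne fac fac3 factor_nonempty by (metis length_Cons list.size(3) One_nat_def)+
  then show "length (F.wicks X Y Z a1 a2 b1 b2) = 2 * (length X + length Y + length Z) + 6"
    unfolding eq by simp
qed

text \<open>For the degenerate cases: after merging neighbouring entries of one factor, the blocks
  of a suitable conjugate no longer interact, not even cyclically, so nothing but their lengths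
  matters.\<close>

lemma product_class_length:
  assumes C: "C \<in> conjugacy_classes F" and w: "w \<in> C" and g: "g \<in> W"
    and eq: "foldr (\<cdot>) us [] = g \<cdot> w \<cdot> inv\<^bsub>F\<^esub> g"
    and us: "set us \<subseteq> W - {[]}" "successively (\<lambda>u v. isl (last u) \<noteq> isl (hd v)) us" "us \<noteq> []"
    "isl (hd (hd us)) \<noteq> isl (last (last us))"
  shows "class_length F (fp_gens G H) C = sum_list (map length us)"
proof -
  have "concat us \<in> C"
    using conj_closedD [OF class_conj_closed [OF C] g w] eq mult_concat(1) [OF us(1,2)] by simp
  from class_lengthI [OF C this concat_cyc_reduced [OF us]] show ?thesis by (simp add: length_concat)
qed

section \<open>Class lengths of representatives with an empty piece\<close>

lemma length_two_pieces_same: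
  assumes C: "C \<in> conjugacy_classes F" and m: "minrep C i i [] Y Z a1 a2 b1 b2" and ne: "Y \<noteq> []" "Z \<noteq> []"
  shows "2 * (length Y + length Z) \<le> class_length F (fp_gens G H) C"
proof -
  note cc = class_conj_closed [OF C]
  note d = minrepD [OF m]
  define a3 b3 where "a3 = inv\<^bsub>F\<^esub> a1 \<cdot> inv\<^bsub>F\<^esub> a2" and "b3 = inv\<^bsub>F\<^esub> b1 \<cdot> inv\<^bsub>F\<^esub> b2"
  have fac3: "a3 \<in> factor i" "b3 \<in> factor i" using d(5-8) by (simp_all add: a3_def b3_def)
  note W3 = fac3 [THEN factor_word]
  have 1: "a2 \<cdot> b2 \<noteq> []" by (rule minrep_same_factor [OF cc m ne])
  have 2: "b3 \<cdot> a1 \<noteq> []"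
    using minrep_same_factor [of C i "inv\<^bsub>F\<^esub> Y" "inv\<^bsub>F\<^esub> Z"] minrep_rotate3 [OF cc m] cc ne d(3,4) unfolding b3_def by simp
  have 3: "b1 \<noteq> []" "a3 \<noteq> []" using minrep_junction_YZ [OF cc m ne] unfolding a3_def by simp_all
  \<comment> \<open>Without \<open>X\<close> the entries \<open>a2\<close> and \<open>b2\<close>
    become neighbours in one factor, and so do \<open>b3\<close> and \<open>a1\<close> cyclically.
    Each pair merges into one block, after conjugation by \<open>b3\<close>; minimality keeps both
    blocks nontrivial.\<close>
  let ?us = "[b3 \<cdot> a1, Y, b1, Z, a2 \<cdot> b2, winv Y, a3, winv Z]"
  have fac: "b3 \<cdot> a1 \<in> factor i" "a2 \<cdot> b2 \<in> factor i" using fac3 d(5-8) by simp_all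
  note fe = factor_ends [OF fac(1) 2] factor_ends [OF fac(2) 1] factor_ends [OF d(7) 3(1)] factor_ends [OF fac3(1) 3(2)]
  have ends: "isl (hd Y) = (\<not> i)" "isl (last Y) = (\<not> i)" "isl (hd Z) = (\<not> i)" "isl (last Z) = (\<not> i)"
    using minrep_ends(2,3) [OF cc m] ne by blast+
  have "class_length F (fp_gens G H) C = sum_list (map length ?us)"
  proof (rule product_class_length [OF C d(9) W3(2)])
    show "foldr (\<cdot>) ?us [] = b3 \<cdot> F.wicks [] Y Z a1 a2 b1 b2 \<cdot> inv\<^bsub>F\<^esub> b3"
      using d(2-13) W3 unfolding a3_def b3_def
      by (simp add: F.wicks_def F.free_group_simps flip: inv_word)
    show "set ?us \<subseteq> W - {[]}" using d(2-13) W3 1 2 3 ne winv_closed by simp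
    show "successively (\<lambda>u v. isl (last u) \<noteq> isl (hd v)) ?us"
      using ne by (simp add: fe ends)
    show "isl (hd (hd ?us)) \<noteq> isl (last (last ?us))" using ne by (simp add: fe ends)
  qed simp
  then show ?thesis by simp
qed

lemma length_two_pieces_distinct:
  assumes C: "C \<in> conjugacy_classes F" and m: "minrep C i (\<not> i) [] Y Z a1 a2 b1 b2" and ne: "Y \<noteq> []" "Z \<noteq> []"
  shows "2 * (length Y + length Z) \<le> class_length F (fp_gens G H) C"
proof -
  note cc = class_conj_closed [OF C]
  note d = minrepD [OF m]
  define a3 b3 where "a3 = inv\<^bsub>F\<^esub> a1 \<cdot> inv\<^bsub>F\<^esub> a2" and "b3 = inv\<^bsub>F\<^esub> b1 \<cdot> inv\<^bsub>F\<^esub> b2"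
  have fac3: "a3 \<in> factor i" "b3 \<in> factor (\<not> i)" using d(5-8) by (simp_all add: a3_def b3_def)
  note W3 = fac3 [THEN factor_word]
  have m3: "minrep C (\<not> i) i [] (inv\<^bsub>F\<^esub> Y) (inv\<^bsub>F\<^esub> Z) b2 b3 a3 a1"
    using minrep_rotate3 [OF cc m] unfolding a3_def b3_def by simp
  have 1: "a1 \<noteq> []" "a2 \<noteq> []" using minrep_distinct_factors [OF cc m] ne by simp_all
  have 2: "b2 \<noteq> []" "b3 \<noteq> []" using minrep_distinct_factors [OF cc m3] ne d(3,4) by simp_all
  have 3: "b1 \<noteq> []" "a3 \<noteq> []" using minrep_junction_YZ [OF cc m ne] unfolding a3_def by simp_all
  \<comment> \<open>The two families lie in different factors here, so touching entries stay
    separate blocks.\<close>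
  let ?us = "[a1, Y, b1, Z, a2, b2, winv Y, a3, winv Z, b3]"
  note fe = factor_ends [OF d(5) 1(1)] factor_ends [OF d(6) 1(2)] factor_ends [OF d(7) 3(1)] factor_ends [OF d(8) 2(1)]
    factor_ends [OF fac3(1) 3(2)] factor_ends [OF fac3(2) 2(2)]
  have ends: "isl (hd Y) = (\<not> i)" "isl (last Y) = i" "isl (hd Z) = i" "isl (last Z) = (\<not> i)"
    using minrep_ends(2,3) [OF cc m] ne by blast+
  have "class_length F (fp_gens G H) C = sum_list (map length ?us)"
  proof (rule product_class_length [OF C d(9) fp_words_Nil])
    show "foldr (\<cdot>) ?us [] = [] \<cdot> F.wicks [] Y Z a1 a2 b1 b2 \<cdot> inv\<^bsub>F\<^esub> []"
      using d(2-13) W3 unfolding a3_def b3_def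
      by (simp add: F.wicks_def F.free_group_simps flip: inv_word)
    show "set ?us \<subseteq> W - {[]}" using d(2-13) W3 1 2 3 ne winv_closed by simp
    show "successively (\<lambda>u v. isl (last u) \<noteq> isl (hd v)) ?us"
      using ne by (simp add: fe ends)
    show "isl (hd (hd ?us)) \<noteq> isl (last (last ?us))" using ne by (simp add: fe ends)
  qed simp
  then show ?thesis by simp
qed

lemma length_one_piece_same:
  assumes C: "C \<in> conjugacy_classes F" and m: "minrep C i i [] [] Z a1 a2 b1 b2" and ne: "Z \<noteq> []"
  shows "2 * length Z \<le> class_length F (fp_gens G H) C"
proof -
  note cc = class_conj_closed [OF C]
  note d = minrepD [OF m]
  define a3 b3 where "a3 = inv\<^bsub>F\<^esub> a1 \<cdot> inv\<^bsub>F\<^esub> a2" and "b3 = inv\<^bsub>F\<^esub> b1 \<cdot> inv\<^bsub>F\<^esub> b2"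
  have fac3: "a3 \<in> factor i" "b3 \<in> factor i" using d(5-8) by (simp_all add: a3_def b3_def)
  note W3 = fac3 [THEN factor_word]
  have m3: "minrep C i i [] [] (inv\<^bsub>F\<^esub> Z) b2 b3 a3 a1"
    using minrep_rotate3 [OF cc m] unfolding a3_def b3_def by simp
  \<comment> \<open>On either side of \<open>Z\<close> three entries of one factor collapse into
    one. \<open>P\<close> is what \<open>Q\<close> becomes under half a turn, so a single
    nontriviality lemma serves both.\<close>
  define P Q where "P = b3 \<cdot> a1 \<cdot> b1" and "Q = a2 \<cdot> b2 \<cdot> a3"
  have 1: "Q \<noteq> []" using minrep_one_piece_same [OF m ne] unfolding Q_def a3_def .
  have "b1 = inv\<^bsub>F\<^esub> b2 \<cdot> inv\<^bsub>F\<^esub> b3" using d(2-13) by (simp add: b3_def F.free_group_simps)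
  then have 2: "P \<noteq> []" using minrep_one_piece_same [OF m3] ne d(4) unfolding P_def by simp
  have fac: "P \<in> factor i" "Q \<in> factor i" using fac3 d(5-8) by (simp_all add: P_def Q_def)
  note PQ = fac [THEN factor_word]
  let ?us = "[P, Z, Q, winv Z]"
  note fe = factor_ends [OF fac(1) 2] factor_ends [OF fac(2) 1]
  have ends: "isl (hd Z) = (\<not> i)" "isl (last Z) = (\<not> i)"
    using minrep_ends(3) [OF cc m] ne by blast+
  have "class_length F (fp_gens G H) C = sum_list (map length ?us)"
  proof (rule product_class_length [OF C d(9) W3(2)])
    show "foldr (\<cdot>) ?us [] = b3 \<cdot> F.wicks [] [] Z a1 a2 b1 b2 \<cdot> inv\<^bsub>F\<^esub> b3"
      using d(2-13) W3 unfolding P_def Q_def a3_def b3_def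
      by (simp add: F.wicks_def F.free_group_simps flip: inv_word)
    show "set ?us \<subseteq> W - {[]}" using d(2-13) PQ 1 2 ne winv_closed by simp
    show "successively (\<lambda>u v. isl (last u) \<noteq> isl (hd v)) ?us"
      using ne by (simp add: fe ends)
    show "isl (hd (hd ?us)) \<noteq> isl (last (last ?us))" using ne by (simp add: fe ends)
  qed simp
  then show ?thesis by simp
qed

text \<open>With \<open>a1\<close> trivial, \<open>b3\<close> and \<open>b1\<close> touch cyclically
  and their product is a conjugate of \<open>b2\<inverse>\<close>. If \<open>b2\<close> were trivial
  the form would be the identity, which positive length excludes.\<close>

lemma length_one_piece_trivial:
  assumes C: "C \<in> conjugacy_classes F" and m: "minrep C i (\<not> i) [] [] Z [] a2 b1 b2" and ne: "Z \<noteq> []"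
    and pos: "class_length F (fp_gens G H) C > 0"
  shows "2 * length Z \<le> class_length F (fp_gens G H) C"
proof -
  note cc = class_conj_closed [OF C]
  note d = minrepD [OF m]
  define b3 where "b3 = inv\<^bsub>F\<^esub> b1 \<cdot> inv\<^bsub>F\<^esub> b2"
  have b2: "b2 \<noteq> []"
  proof
    assume "b2 = []"
    then have "F.wicks [] [] Z [] a2 b1 b2 = []"
      using d(2-13) by (simp add: F.wicks_def F.free_group_simps)
    then show False using class_length_le [OF C d(9)] pos by simp
  qed
  have fac: "b3 \<cdot> b1 \<in> factor (\<not> i)" using d(5-8) by (simp add: b3_def)
  have b31: "b3 \<cdot> b1 \<noteq> []"
  proof
    assume "b3 \<cdot> b1 = []"
    then have "b1 \<cdot> (b3 \<cdot> b1) \<cdot> inv\<^bsub>F\<^esub> b1 = []" using d(12) by simp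
    then have "inv\<^bsub>F\<^esub> b2 = []" using d(12,13) by (simp add: b3_def F.free_group_simps)
    then show False using b2 d(13) by simp
  qed
  have a2: "a2 \<noteq> []" using minrep_distinct_factors(2) [OF cc m] ne by simp
  let ?us = "[b3 \<cdot> b1, Z, a2, b2, inv\<^bsub>F\<^esub> a2, winv Z]"
  have W3: "b3 \<in> W" using d(12,13) by (simp add: b3_def)
  have a2': "inv\<^bsub>F\<^esub> a2 \<in> factor i" "inv\<^bsub>F\<^esub> a2 \<noteq> []" using d(6,11) a2 by simp_all
  note fe = factor_ends [OF fac b31] factor_ends [OF d(6) a2] factor_ends [OF d(8) b2] factor_ends [OF a2']
  have ends: "isl (hd Z) = i" "isl (last Z) = (\<not> i)"
    using minrep_ends(3) [OF cc m] ne by blast+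
  have "class_length F (fp_gens G H) C = sum_list (map length ?us)"
  proof (rule product_class_length [OF C d(9) W3])
    show "foldr (\<cdot>) ?us [] = b3 \<cdot> F.wicks [] [] Z [] a2 b1 b2 \<cdot> inv\<^bsub>F\<^esub> b3"
      using d(2-13) W3 unfolding b3_def
      by (simp add: F.wicks_def F.free_group_simps flip: inv_word)
    show "set ?us \<subseteq> W - {[]}" using d(2-13) W3 a2 b2 b31 ne winv_closed by simp
    show "successively (\<lambda>u v. isl (last u) \<noteq> isl (hd v)) ?us"
      using ne by (simp add: fe ends)
    show "isl (hd (hd ?us)) \<noteq> isl (last (last ?us))" using ne by (simp add: fe ends)
  qed simp
  then show ?thesis by simp
qed

text \<open>A trivial \<open>b2\<close> is a trivial \<open>a1\<close> after half a turn. Otherwise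
  all six entries are nontrivial and, lying alternately in the two factors where they touch, form
  blocks of their own.\<close>

lemma length_one_piece_distinct:
  assumes C: "C \<in> conjugacy_classes F" and m: "minrep C i (\<not> i) [] [] Z a1 a2 b1 b2" and ne: "Z \<noteq> []"
    and pos: "class_length F (fp_gens G H) C > 0"
  shows "2 * length Z \<le> class_length F (fp_gens G H) C"
proof -
  note cc = class_conj_closed [OF C]
  note d = minrepD [OF m]
  define a3 b3 where "a3 = inv\<^bsub>F\<^esub> a1 \<cdot> inv\<^bsub>F\<^esub> a2" and "b3 = inv\<^bsub>F\<^esub> b1 \<cdot> inv\<^bsub>F\<^esub> b2"
  have fac3: "a3 \<in> factor i" "b3 \<in> factor (\<not> i)" using d(5-8) by (simp_all add: a3_def b3_def)
  note W3 = fac3 [THEN factor_word]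
  have m3: "minrep C (\<not> i) (\<not> \<not> i) [] [] (inv\<^bsub>F\<^esub> Z) b2 b3 a3 a1"
    using minrep_rotate3 [OF cc m] unfolding a3_def b3_def by simp
  consider "a1 = []" | "b2 = []" | "a1 \<noteq> []" "b2 \<noteq> []" by blast
  then show ?thesis
  proof cases
    case 1
    show ?thesis using length_one_piece_trivial [OF C _ ne pos] m unfolding 1 by blast
  next
    case 2
    have "inv\<^bsub>F\<^esub> Z \<noteq> []" using ne d(4) by simp
    then have "2 * length (inv\<^bsub>F\<^esub> Z) \<le> class_length F (fp_gens G H) C"
      by (rule length_one_piece_trivial [OF C m3 [unfolded 2] _ pos])
    then show ?thesis using d(4) by simp
  next
    case 3
    have 1: "a2 \<noteq> []" using minrep_distinct_factors(2) [OF cc m] ne by simp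
    have 2: "b3 \<noteq> []" using minrep_distinct_factors(2) [OF cc m3] ne d(4) by simp
    have a3: "a3 \<noteq> []" using minrep_one_piece_distinct [OF cc m _ ne] unfolding a3_def by simp
    have "b1 = inv\<^bsub>F\<^esub> b2 \<cdot> inv\<^bsub>F\<^esub> b3" using d(2-13) by (simp add: b3_def F.free_group_simps)
    then have b1: "b1 \<noteq> []" using minrep_one_piece_distinct [OF cc m3] ne d(4) by simp
    let ?us = "[b3, a1, b1, Z, a2, b2, a3, winv Z]"
    note fe = factor_ends [OF d(5) 3(1)] factor_ends [OF d(6) 1] factor_ends [OF d(7) b1] factor_ends [OF d(8) 3(2)]
      factor_ends [OF fac3(1) a3] factor_ends [OF fac3(2) 2]
    have ends: "isl (hd Z) = i" "isl (last Z) = (\<not> i)"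
      using minrep_ends(3) [OF cc m] ne by blast+
    have "class_length F (fp_gens G H) C = sum_list (map length ?us)"
    proof (rule product_class_length [OF C d(9) W3(2)])
      show "foldr (\<cdot>) ?us [] = b3 \<cdot> F.wicks [] [] Z a1 a2 b1 b2 \<cdot> inv\<^bsub>F\<^esub> b3"
        using d(2-13) W3 unfolding a3_def b3_def
        by (simp add: F.wicks_def F.free_group_simps flip: inv_word)
      show "set ?us \<subseteq> W - {[]}" using d(2-13) W3 1 2 3 a3 b1 ne winv_closed by simp
      show "successively (\<lambda>u v. isl (last u) \<noteq> isl (hd v)) ?us"
        using ne by (simp add: fe ends)
      show "isl (hd (hd ?us)) \<noteq> isl (last (last ?us))" using ne by (simp add: fe ends)
    qed simp
    then show ?thesis by simp
  qed
qed

lemma minrep_generic: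
  assumes C: "conj_closed C" and m: "minrep C i j X Y Z a1 a2 b1 b2" and ne: "X \<noteq> []" "Y \<noteq> []" "Z \<noteq> []"
  shows "generic i j X Y Z a1 a2 b1 b2"
proof -
  note d = minrepD [OF m]
  note m1 = minrep_rotate [OF C m]
  note m2 = minrep_rotate [OF C m1]
  have nX: "inv\<^bsub>F\<^esub> X \<noteq> []" "inv\<^bsub>F\<^esub> Y \<noteq> []" using ne d by simp_all
  have "a1 \<noteq> []" by (rule minrep_junction [OF C m ne(1,2)])
  moreover have "b1 \<noteq> []" "inv\<^bsub>F\<^esub> a1 \<cdot> inv\<^bsub>F\<^esub> a2 \<noteq> []" by (fact minrep_junction_YZ [OF C m ne(2,3)])+
  moreover have "a2 \<noteq> []" "inv\<^bsub>F\<^esub> b1 \<cdot> inv\<^bsub>F\<^esub> b2 \<noteq> []" by (fact minrep_junction_YZ [OF C m1 ne(3) nX(1)])+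
  moreover have "b2 \<noteq> []" by (fact minrep_junction_YZ(1) [OF C m2 nX(1,2)])
  moreover have "isl (hd X) = (\<not> j)" "isl (last X) = (\<not> i)" "isl (hd Y) = (\<not> i)" "isl (last Y) = (\<not> j)"
     "isl (hd Z) = (\<not> j)" "isl (last Z) = (\<not> i)"
    using minrep_ends [OF C m] ne by blast+
  ultimately show ?thesis using d(2-8) ne by (simp add: generic_def)
qed

text \<open>Up to rotation every pattern with an empty piece has \<open>X\<close> empty and either
  \<open>Y\<close> empty or \<open>Z\<close> nonempty; this leaves the patterns with zero, one or
  two nonempty pieces in fixed places.\<close>

lemma minrep_degenerate_length:
  assumes C: "C \<in> conjugacy_classes F" and m: "minrep C i j [] Y Z a1 a2 b1 b2" and YZ: "Y = [] \<or> Z \<noteq> []"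
    and pos: "class_length F (fp_gens G H) C > 0"
  shows "2 * (length Y + length Z) \<le> class_length F (fp_gens G H) C"
proof -
  consider "Y = []" "Z = []" | "Y = []" "Z \<noteq> []" | "Y \<noteq> []" "Z \<noteq> []" using YZ by blast
  then show ?thesis
  proof cases
    case 2
    then have m': "minrep C i j [] [] Z a1 a2 b1 b2" using m by simp
    show ?thesis
    proof (cases "i = j")
      case True
      show ?thesis using length_one_piece_same [OF C _ 2(2)] m' 2(1) True by simp
    next
      case False
      then have "j = (\<not> i)" by blast
      then show ?thesis using length_one_piece_distinct [OF C _ 2(2) pos] m' 2(1) by simp
    qed
  next
    case 3
    show ?thesis
    proof (cases "i = j")
      case True
      show ?thesis using length_two_pieces_same [OF C _ 3] m True by simp
    next
      case False
      then have "j = (\<not> i)" by blast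
      then show ?thesis using length_two_pieces_distinct [OF C _ 3] m by simp
    qed
  qed simp
qed

text \<open>
  Generic forms with \<open>i \<noteq> j\<close> have length congruent to 2 modulo 4;
  this is where divisibility by 4 enters.
\<close>

theorem commutator_class_cases:
  assumes C: "C \<in> conjugacy_classes F" "C \<subseteq> derived_set F (carrier F)"
    and k: "class_length F (fp_gens G H) C = k" "k > 0" "4 dvd k"
  obtains (generic) i X Y Z a1 a2 b1 b2 where "generic i i X Y Z a1 a2 b1 b2" "F.wicks X Y Z a1 a2 b1 b2 \<in> C"
  | (degenerate) i j Y Z a1 a2 b1 b2 where "rep C i j [] Y Z a1 a2 b1 b2"
      "2 * (length Y + length Z) \<le> k" "k \<le> 2 * (length Y + length Z) + 6"
proof -
  have cc: "conj_closed C" by (rule class_conj_closed [OF C(1)])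
  have "C \<noteq> {}" using C(1) F.one_closed by (auto simp: conjugacy_classes_def conjugacy_class_def)
  then obtain u v where uv: "u \<in> W" "v \<in> W" "u \<cdot> v \<cdot> inv\<^bsub>F\<^esub> u \<cdot> inv\<^bsub>F\<^esub> v \<in> C"
    using C(2) by fastforce
  \<comment> \<open>A commutator is a Wicks form with empty \<open>Z\<close> and trivial entries, so
    representatives exist.\<close>
  then have "rep C True True u v [] [] [] [] []"
    by (simp add: rep_def F.wicks_def)
  then obtain i j X Y Z a1 a2 b1 b2 where m: "minrep C i j X Y Z a1 a2 b1 b2"
    using minrep_exists by metis
  note d = minrepD [OF m]
  show thesis
  proof (cases "X = [] \<or> Y = [] \<or> Z = []")
    case False
    then have ne: "X \<noteq> []" "Y \<noteq> []" "Z \<noteq> []" by simp_all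
    have gen: "generic i j X Y Z a1 a2 b1 b2" by (rule minrep_generic [OF cc m ne])
    have len: "k = 2 * (length X + length Y + length Z) + 6"
      using class_lengthI [OF C(1) d(9) generic_word(2) [OF gen]] generic_word(3) [OF gen] k(1) by simp
    \<comment> \<open>A piece has one end in the factor \<open>\<not> i\<close> and the other in
      \<open>\<not> j\<close>, and its letters alternate.\<close>
    have par: "odd (length X) = (i = j)" "odd (length Y) = (i = j)" "odd (length Z) = (i = j)"
      using word_parity [of X] word_parity [of Y] word_parity [of Z] gen unfolding generic_def by simp_all blast+
    have "i = j"
    proof (rule ccontr)
      assume "i \<noteq> j"
      then have "even (length X + length Y + length Z)" using par by simp
      then obtain r where "length X + length Y + length Z = 2 * r" by blast
      then have "k = 4 * (r + 1) + 2" using len by simp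
      then show False using k(3) by presburger
    qed
    then show thesis using that(1) gen d(9) by blast
  next
    case True
    have deg: thesis if m': "minrep C i j [] Y Z a1 a2 b1 b2" "Y = [] \<or> Z \<noteq> []" for i j Y Z a1 a2 b1 b2
    proof -
      note d' = minrepD [OF m'(1)]
      have "k \<le> 2 * (length Y + length Z) + 6"
        using class_length_le [OF C(1) d'(9)] wicks_length [of "[]" Y Z a1 a2 i b1 b2 j] d'(2-8) k(1) by simp
      moreover have "2 * (length Y + length Z) \<le> k"
        using minrep_degenerate_length [OF C(1) m'] k(1,2) by simp
      ultimately show thesis using degenerate [OF d'(1)] by blast
    qed
    note m1 = minrep_rotate [OF cc m]
    note m2 = minrep_rotate [OF cc m1]
    note e = inv_eq_Nil [OF d(2)] inv_eq_Nil [OF d(3)]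
    show thesis
    proof (cases "X = [] \<and> (Y = [] \<or> Z \<noteq> [])")
      case True
      then show thesis using deg [of i j Y Z] m by blast
    next
      case f1: False
      show thesis
      proof (cases "Y = [] \<and> (Z = [] \<or> X \<noteq> [])")
        case True
        then show thesis using deg [of j i Z "inv\<^bsub>F\<^esub> X"] m1 e by metis
      next
        case f2: False
        then have "Z = []" "X = [] \<or> Y \<noteq> []" using \<open>X = [] \<or> Y = [] \<or> Z = []\<close> f1 by blast+
        then show thesis using deg [of i j "inv\<^bsub>F\<^esub> X" "inv\<^bsub>F\<^esub> Y"] m2 e by metis
      qed
    qed
  qed
qed

end

section \<open>Functions compatible with two partial pairings\<close>

text \<open>
  The edges of \<open>f\<close> and \<open>g\<close> form a graph on \<open>P\<close>. A component has at least three points if it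
  contains a point where \<open>f\<close> and \<open>g\<close> disagree, and at least two if it contains a point where
  they agree. Hence every component has total weight at least 6 if points of disagreement get
  weight 2, points of agreement weight 3 and all other points weight 6.
\<close>

lemma card_compatible_functions:
  fixes f g :: "'p \<Rightarrow> 'p" and S :: "('p \<Rightarrow> 'v) set"
  assumes P: "finite P" and D: "D \<subseteq> P" "D' \<subseteq> P"
    and f: "\<And>x. x \<in> D \<Longrightarrow> f x \<in> D \<and> f (f x) = x \<and> f x \<noteq> x"
    and g: "\<And>x. x \<in> D' \<Longrightarrow> g x \<in> D' \<and> g (g x) = x \<and> g x \<noteq> x"
    and L: "finite L" and S: "\<And>s x. s \<in> S \<Longrightarrow> x \<in> P \<Longrightarrow> s x \<in> L"
    and Sf: "\<And>s t x. s \<in> S \<Longrightarrow> t \<in> S \<Longrightarrow> x \<in> D \<Longrightarrow> s x = t x \<Longrightarrow> s (f x) = t (f x)"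
    and Sg: "\<And>s t x. s \<in> S \<Longrightarrow> t \<in> S \<Longrightarrow> x \<in> D' \<Longrightarrow> s x = t x \<Longrightarrow> s (g x) = t (g x)"
  shows "\<exists>m. card ((\<lambda>s. restrict s P) ` S) \<le> card L ^ m \<and>
    6 * m \<le> 2 * card P + card {x \<in> D \<inter> D'. f x = g x} + 4 * card (P - D \<inter> D')"
proof -
  define e where "e = {(x, f x) | x. x \<in> D} \<union> {(x, g x) | x. x \<in> D'}"
  define R where "R = e\<^sup>* \<inter> P \<times> P"
  have "sym e" unfolding e_def sym_def using f g by fastforce
  then have "sym (e\<^sup>*)" by (rule sym_rtrancl)
  then have R: "equiv P R"
    unfolding R_def equiv_def refl_on_def sym_def trans_def by (blast intro: rtrancl_trans)
  define Q where "Q = P // R"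
  have Q: "finite Q" "\<And>c. c \<in> Q \<Longrightarrow> c \<subseteq> P" "\<And>c. c \<in> Q \<Longrightarrow> c \<noteq> {}"
    unfolding Q_def using finite_quotient [OF P] R in_quotient_imp_subset [OF R] in_quotient_imp_non_empty [OF R]
    by (auto simp: equiv_type)
  have closed: "f x \<in> c" if "c \<in> Q" "x \<in> c" "x \<in> D" for c x
  proof -
    have "(x, f x) \<in> R" using that f D by (auto simp: R_def e_def)
    then show ?thesis using that in_quotient_imp_closed [OF R] unfolding Q_def by metis
  qed
  have closed': "g x \<in> c" if "c \<in> Q" "x \<in> c" "x \<in> D'" for c x
  proof -
    have "(x, g x) \<in> R" using that g D by (auto simp: R_def e_def)
    then show ?thesis using that in_quotient_imp_closed [OF R] unfolding Q_def by metis
  qed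
  define wt :: "'p \<Rightarrow> nat" where
    "wt x = (if x \<in> D \<inter> D' then if f x = g x then 3 else 2 else 6)" for x
  have wt2: "wt x \<ge> 2" for x by (simp add: wt_def)
  have heavy: "6 \<le> sum wt c" if c: "c \<in> Q" for c
  proof -
    have fin: "finite c" using Q(2) [OF c] P by (rule finite_subset)
    obtain x where x: "x \<in> c" using Q(3) [OF c] by blast
    have sub: "sum wt A \<le> sum wt c" if "A \<subseteq> c" for A using fin that by (simp add: sum_mono2)
    consider "x \<notin> D \<inter> D'" | "x \<in> D \<inter> D'" "f x = g x" | "x \<in> D \<inter> D'" "f x \<noteq> g x" by blast
    then show ?thesis
    proof cases
      case 1
      then show ?thesis using sub [of "{x}"] x by (auto simp: wt_def)
    next
      case 2
      then have "f x \<in> D \<inter> D'" "f (f x) = g (f x)" "f x \<noteq> x" using f [of x] g [of x] by auto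
      then have "sum wt {x, f x} = 6" using 2 by (simp add: wt_def)
      then show ?thesis using sub [of "{x, f x}"] x closed [OF c x] 2 by auto
    next
      case 3
      have "distinct [x, f x, g x]" using 3 f [of x] g [of x] by auto
      then have "sum wt {x, f x, g x} = wt x + wt (f x) + wt (g x)" by simp
      then have "6 \<le> sum wt {x, f x, g x}" using wt2 [of x] wt2 [of "f x"] wt2 [of "g x"] by linarith
      then show ?thesis using sub [of "{x, f x, g x}"] x closed [OF c x] closed' [OF c x] 3 by auto
    qed
  qed
  have disj: "\<forall>A\<in>Q. \<forall>B\<in>Q. A \<noteq> B \<longrightarrow> A \<inter> B = {}"
    using quotient_disj [OF R] unfolding Q_def by blast
  have "sum wt P = sum wt (\<Union>Q)" unfolding Q_def using Union_quotient [OF R] by simp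
  also have "\<dots> = (\<Sum>c\<in>Q. sum wt c)"
    using Q(2) P disj by (subst sum.Union_disjoint) (auto intro: finite_subset)
  finally have "6 * card Q \<le> sum wt P"
    using sum_bounded_below [of Q 6 "sum wt"] heavy by (simp add: mult.commute)
  also have "sum wt P = 2 * card P + card {x \<in> D \<inter> D'. f x = g x} + 4 * card (P - D \<inter> D')"
  proof -
    have count: "(\<Sum>x\<in>P. if x \<in> A then n else 0) = n * card (P \<inter> A)" for n :: nat and A
      using P by (simp add: sum.If_cases)
    have "sum wt P = (\<Sum>x\<in>P. 2 + (if x \<in> {x \<in> D \<inter> D'. f x = g x} then 1 else 0) + (if x \<in> P - D \<inter> D' then 4 else 0))"
      by (intro sum.cong) (auto simp: wt_def)
    also have "\<dots> = 2 * card P + card (P \<inter> {x \<in> D \<inter> D'. f x = g x}) + 4 * card (P \<inter> (P - D \<inter> D'))"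
      unfolding sum.distrib count by simp
    also have "P \<inter> {x \<in> D \<inter> D'. f x = g x} = {x \<in> D \<inter> D'. f x = g x}" using D by auto
    also have "P \<inter> (P - D \<inter> D') = P - D \<inter> D'" by auto
    finally show ?thesis .
  qed
  finally have bound: "6 * card Q \<le> 2 * card P + card {x \<in> D \<inter> D'. f x = g x} + 4 * card (P - D \<inter> D')" .
  define r where "r c = (SOME x. x \<in> c)" for c :: "'p set"
  have r: "r c \<in> c" if "c \<in> Q" for c using Q(3) [OF that] unfolding r_def by (auto intro: someI)
  have rP: "r c \<in> P" if "c \<in> Q" for c using r [OF that] Q(2) [OF that] by blast
  have agree: "s y = t y" if "(x, y) \<in> e\<^sup>*" "s \<in> S" "t \<in> S" "s x = t x" for s t x y
    using that
  proof (induction rule: rtrancl_induct)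
    case (step y z)
    then have "s y = t y" by blast
    then show ?case using step(2) Sf [OF \<open>s \<in> S\<close> \<open>t \<in> S\<close>] Sg [OF \<open>s \<in> S\<close> \<open>t \<in> S\<close>] unfolding e_def by auto
  qed simp
  define h where "h = (\<lambda>u :: 'p \<Rightarrow> 'v. restrict (\<lambda>c. u (r c)) Q)"
  have "inj_on h ((\<lambda>s. restrict s P) ` S)"
  proof (rule inj_onI, clarsimp)
    fix s t assume st: "s \<in> S" "t \<in> S" "h (restrict s P) = h (restrict t P)"
    show "restrict s P = restrict t P"
    proof (rule restrict_ext)
      fix y assume y: "y \<in> P"
      define c where "c = R `` {y}"
      have c: "c \<in> Q" "y \<in> c" using y by (auto simp: c_def Q_def quotientI R_def)
      have "s (r c) = t (r c)"
        using fun_cong [OF st(3), of c] c(1) rP [OF c(1)] by (simp add: h_def)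
      moreover have "(r c, y) \<in> R"
        using r [OF c(1)] R unfolding c_def equiv_def sym_def by blast
      ultimately show "s y = t y" using agree st by (auto simp: R_def)
    qed
  qed
  moreover have "h ` ((\<lambda>s. restrict s P) ` S) \<subseteq> Q \<rightarrow>\<^sub>E L"
    using rP S unfolding h_def by (auto simp: PiE_def)
  ultimately have "card ((\<lambda>s. restrict s P) ` S) \<le> card (Q \<rightarrow>\<^sub>E L)"
    using Q(1) L by (intro card_inj_on_le [of h]) (auto intro: finite_PiE)
  also have "\<dots> = card L ^ card Q" using Q(1) by (simp add: card_PiE)
  finally show ?thesis using bound by blast
qed

section \<open>The pairing of positions in a generic Wicks form\<close>

text \<open>
  A generic word of shape \<open>(a, b, c)\<close> is
  \<open>X \<alpha>\<^sub>1 Y \<beta>\<^sub>1 Z \<alpha>\<^sub>2 X\<inverse> \<beta>\<^sub>2 Y\<inverse> \<alpha>\<^sub>3 Z\<inverse> \<beta>\<^sub>3\<close> with \<open>a, b, c\<close> the lengths of \<open>X, Y, Z\<close>;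
  each position inside a piece is paired with the position of the inverse letter.
\<close>

definition half :: "nat \<Rightarrow> nat \<Rightarrow> nat \<Rightarrow> nat" where "half a b c = a + b + c + 3"

definition paired :: "nat \<Rightarrow> nat \<Rightarrow> nat \<Rightarrow> nat set" where
  "paired a b c = {..<2 * half a b c} -
     {a, a + b + 1, half a b c - 1, half a b c + a, half a b c + a + b + 1, 2 * half a b c - 1}"

text \<open>A piece of length \<open>n\<close> starting at \<open>l\<close> has its inverse starting
  at \<open>half a b c + l\<close>, so mates add up to \<open>half a b c + 2 * l + n - 1\<close>.
  The branches are these reflections for \<open>l\<close> equal to \<open>0\<close>,
  \<open>a + 1\<close> and \<open>a + b + 2\<close>.\<close>

definition pairing :: "nat \<Rightarrow> nat \<Rightarrow> nat \<Rightarrow> nat \<Rightarrow> nat" where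
  "pairing a b c p =
     (if p < a then half a b c + (a - 1 - p)
      else if p < a + 1 + b then half a b c + (2 * a + b + 1 - p)
      else if p < half a b c then half a b c + (2 * a + 2 * b + c + 3 - p)
      else if p < half a b c + a then half a b c + a - 1 - p
      else if p < half a b c + a + 1 + b then half a b c + 2 * a + b + 1 - p
      else half a b c + 2 * a + 2 * b + c + 3 - p)"

text \<open>Describing an offset and its mirror image by \<open>q + q' + 1 = n\<close> avoids
  truncated subtraction and treats the three pieces uniformly.\<close>

lemma pairing_value:
  assumes "(l, n) \<in> {(0, a), (a + 1, b), (a + b + 2, c)}" "q + q' + 1 = n"
  shows "pairing a b c (l + q) = half a b c + l + q'" "pairing a b c (half a b c + l + q') = l + q"
    "l + q \<in> paired a b c" "half a b c + l + q' \<in> paired a b c" "l + q < half a b c"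
  using assms(1) by (elim insertE; use assms(2) in \<open>simp add: pairing_def paired_def half_def\<close>)+

lemma pairedE:
  assumes "p \<in> paired a b c"
  obtains l n q q' where "(l, n) \<in> {(0, a), (a + 1, b), (a + b + 2, c)}" "q + q' + 1 = n"
    "p = l + q \<or> p = half a b c + l + q'"
proof -
  note goal = that
  have *: thesis if "(l, n) \<in> {(0, a), (a + 1, b), (a + b + 2, c)}" "l \<le> r" "r < l + n"
      "p = r \<or> p = half a b c + r" for l n r
  proof (cases "p = r")
    case True
    show thesis by (rule goal [OF \<open>(l, n) \<in> _\<close>, of "r - l" "n - 1 - (r - l)"]) (use that True in auto)
  next
    case False
    show thesis by (rule goal [OF \<open>(l, n) \<in> _\<close>, of "n - 1 - (r - l)" "r - l"]) (use that False in auto)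
  qed
  define r where "r = (if p < half a b c then p else p - half a b c)"
  have r: "p = r \<or> p = half a b c + r" "r < half a b c" "r \<noteq> a" "r \<noteq> a + b + 1" "r \<noteq> half a b c - 1"
    using assms by (auto simp: r_def paired_def)
  consider "r < a" | "a + 1 \<le> r" "r < a + 1 + b" | "a + b + 2 \<le> r" "r < a + b + 2 + c"
    using r unfolding half_def by linarith
  then show thesis
    by cases (use * [of 0 a r] * [of "a + 1" b r] * [of "a + b + 2" c r] r(1) in simp_all)
qed

lemma pairing:
  assumes "p \<in> paired a b c"
  shows "pairing a b c p \<in> paired a b c" "pairing a b c (pairing a b c p) = p" "pairing a b c p \<noteq> p"
    "pairing a b c p < 2 * half a b c"
proof -
  obtain l n q q' where q: "(l, n) \<in> {(0, a), (a + 1, b), (a + b + 2, c)}" "q + q' + 1 = n"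
    "p = l + q \<or> p = half a b c + l + q'"
    using assms(1) by (rule pairedE)
  note v = pairing_value [OF q(1,2)]
  show 1: "pairing a b c p \<in> paired a b c" and "pairing a b c (pairing a b c p) = p"
    using q(3) v by (elim disjE; simp)+
  show "pairing a b c p \<noteq> p"
    using q(3) v(1,2,5) by (elim disjE) simp_all
  show "pairing a b c p < 2 * half a b c" using 1 by (simp add: paired_def)
qed

text \<open>In an alternating word all positions of one parity carry letters of one factor. Pairings
  respecting parity can be analysed for the two factors separately.\<close>

lemma pairing_even:
  assumes "p \<in> paired a b c" "odd a" "odd b" "odd c"
  shows "even (pairing a b c p) = even p"
proof -
  obtain l n q q' where q: "(l, n) \<in> {(0, a), (a + 1, b), (a + b + 2, c)}" "q + q' + 1 = n"
    "p = l + q \<or> p = half a b c + l + q'"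
    using assms(1) by (rule pairedE)
  have "odd n" using q(1) assms(2-4) by auto
  then have "even (q + q')" using q(2) by presburger
  moreover have "even (half a b c)" using assms(2-4) by (simp add: half_def)
  ultimately show ?thesis using q(3) pairing_value(1,2) [OF q(1,2)] by auto
qed

text \<open>Dropping \<open>X\<close> and its entry renumbers the positions by \<open>a + 1\<close>.
  Only the mates of positions in \<open>X\<inverse>\<close> wrap around to the end, which is why the
  equation is taken modulo the length.\<close>

lemma pairing_rotate:
  assumes "p \<in> paired a b c" "a \<le> p"
  shows "a + 1 \<le> p" "p - (a + 1) \<in> paired b c a"
    "(pairing b c a (p - (a + 1)) + (a + 1)) mod (2 * half a b c) = pairing a b c p"
proof -
  show 1: "a + 1 \<le> p" using assms by (auto simp: paired_def)
  have h: "half b c a = half a b c" by (simp add: half_def)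
  obtain l n q q' where q: "(l, n) \<in> {(0, a), (a + 1, b), (a + b + 2, c)}" "q + q' + 1 = n"
    "p = l + q \<or> p = half a b c + l + q'"
    using assms(1) by (rule pairedE)
  show "p - (a + 1) \<in> paired b c a" using assms by (auto simp: paired_def half_def)
  have lt: "pairing a b c p < 2 * half a b c" using pairing(4) [OF assms(1)] .
  note v = pairing_value(1,2) [OF q(1,2)]
  consider "(l, n) = (0, a)" | "(l, n) = (a + 1, b)" | "(l, n) = (a + b + 2, c)" using q(1) by blast
  then have "pairing b c a (p - (a + 1)) + (a + 1) = pairing a b c p \<or>
    pairing b c a (p - (a + 1)) + (a + 1) = pairing a b c p + 2 * half a b c"
  proof cases
    case 1
    have "p = half a b c + q'" using q 1 assms(2) by auto
    then have "p - (a + 1) = b + c + 2 + q'" "pairing a b c p = q" using v 1 by (auto simp: half_def)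
    then show ?thesis using pairing_value(1) [of "b + c + 2" a b c a q' q] q(2) 1 by (auto simp: half_def)
  next
    case 2
    have "p - (a + 1) = q \<and> pairing a b c p = half a b c + (a + 1) + q' \<or>
        p - (a + 1) = half a b c + q' \<and> pairing a b c p = a + 1 + q" using q(3) v 2 by auto
    then show ?thesis using pairing_value(1,2) [of 0 b b c a q q'] q(2) 2 h by auto
  next
    case 3
    have "p - (a + 1) = b + 1 + q \<and> pairing a b c p = half a b c + (a + b + 2) + q' \<or>
        p - (a + 1) = half a b c + (b + 1) + q' \<and> pairing a b c p = a + b + 2 + q" using q(3) v 3 by auto
    then show ?thesis using pairing_value(1,2) [of "b + 1" c b c a q q'] q(2) 3 h by auto
  qed
  then show "(pairing b c a (p - (a + 1)) + (a + 1)) mod (2 * half a b c) = pairing a b c p" using lt by auto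
qed

section \<open>Generic forms\<close>

context two_groups
begin

type_synonym (in -) ('x, 'y) form = "('x + 'y) list \<times> ('x + 'y) list \<times> ('x + 'y) list \<times>
  ('x + 'y) list \<times> ('x + 'y) list \<times> ('x + 'y) list \<times> ('x + 'y) list"

definition forms :: "bool \<Rightarrow> nat \<Rightarrow> nat \<Rightarrow> nat \<Rightarrow> ('a, 'b) form set" where
  "forms i a b c = {(X, Y, Z, a1, a2, b1, b2). generic i i X Y Z a1 a2 b1 b2 \<and>
     length X = a \<and> length Y = b \<and> length Z = c}"

definition form_word :: "('a, 'b) form \<Rightarrow> ('a + 'b) list" where
  "form_word = (\<lambda>(X, Y, Z, a1, a2, b1, b2). F.wicks X Y Z a1 a2 b1 b2)"

definition rot :: "('a, 'b) form \<Rightarrow> ('a, 'b) form" where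
  "rot = (\<lambda>(X, Y, Z, a1, a2, b1, b2). (Y, Z, inv\<^bsub>F\<^esub> X, b1, b2, a2, inv\<^bsub>F\<^esub> a1 \<cdot> inv\<^bsub>F\<^esub> a2))"

lemma formsE:
  assumes "t \<in> forms i a b c"
  obtains X Y Z x1 x2 x3 y1 y2 y3 where "t = (X, Y, Z, [x1], [x2], [y1], [y2])"
    "generic i i X Y Z [x1] [x2] [y1] [y2]" "length X = a" "length Y = b" "length Z = c"
    "inv\<^bsub>F\<^esub> [x1] \<cdot> inv\<^bsub>F\<^esub> [x2] = [x3]" "inv\<^bsub>F\<^esub> [y1] \<cdot> inv\<^bsub>F\<^esub> [y2] = [y3]"
    "form_word t = X @ [x1] @ Y @ [y1] @ Z @ [x2] @ winv X @ [y2] @ winv Y @ [x3] @ winv Z @ [y3]"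
    "x2 \<noteq> linv x1" "X \<in> W" "Y \<in> W" "Z \<in> W" "X \<noteq> []" "[x1] \<in> W" "[x2] \<in> W" "[y1] \<in> W" "[y2] \<in> W"
proof -
  obtain X Y Z a1 a2 s where t1: "t = (X, Y, Z, a1, a2, s)" by (cases t) auto
  obtain b1 b2 where t2: "s = (b1, b2)" by (cases s)
  have gen: "generic i i X Y Z a1 a2 b1 b2" and len: "length X = a" "length Y = b" "length Z = c"
    using assms by (simp_all add: t1 t2 forms_def)
  have fac: "a1 \<in> factor i" "a2 \<in> factor i" "b1 \<in> factor i" "b2 \<in> factor i" "a1 \<noteq> []" "a2 \<noteq> []" "b1 \<noteq> []" "b2 \<noteq> []"
    and fac3: "inv\<^bsub>F\<^esub> a1 \<cdot> inv\<^bsub>F\<^esub> a2 \<noteq> []" "inv\<^bsub>F\<^esub> b1 \<cdot> inv\<^bsub>F\<^esub> b2 \<noteq> []"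
    and XW: "X \<in> W" "Y \<in> W" "Z \<in> W" "X \<noteq> []"
    using gen by (simp_all add: generic_def)
  have fac3': "inv\<^bsub>F\<^esub> a1 \<cdot> inv\<^bsub>F\<^esub> a2 \<in> factor i" "inv\<^bsub>F\<^esub> b1 \<cdot> inv\<^bsub>F\<^esub> b2 \<in> factor i" using fac by simp_all
  obtain x1 where x1: "a1 = [x1]" "x1 \<in> fp_letters G H" using factor_nonempty fac by metis
  obtain x2 where x2: "a2 = [x2]" using factor_nonempty fac by metis
  obtain y1 where y1: "b1 = [y1]" using factor_nonempty fac by metis
  obtain y2 where y2: "b2 = [y2]" using factor_nonempty fac by metis
  obtain x3 where x3: "inv\<^bsub>F\<^esub> a1 \<cdot> inv\<^bsub>F\<^esub> a2 = [x3]" using factor_nonempty fac3 fac3' by metis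
  obtain y3 where y3: "inv\<^bsub>F\<^esub> b1 \<cdot> inv\<^bsub>F\<^esub> b2 = [y3]" using factor_nonempty fac3 fac3' by metis
  have W: "a1 \<in> W" "a2 \<in> W" "b1 \<in> W" "b2 \<in> W" using fac factor_word by blast+
  have "x2 \<noteq> linv x1"
  proof
    assume "x2 = linv x1"
    then have "a2 = inv\<^bsub>F\<^esub> a1" using x1 x2 by (simp add: inv_letter)
    then show False using fac3(1) W(1) F.inv_inv [of a1] by simp
  qed
  moreover have "form_word t = X @ [x1] @ Y @ [y1] @ Z @ [x2] @ winv X @ [y2] @ winv Y @ [x3] @ winv Z @ [y3]"
    using generic_word(1) [OF gen] by (simp add: form_word_def t1 t2 x1(1) x2 y1 y2 x3 [unfolded x1(1) x2] y3 [unfolded y1 y2])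
  ultimately show thesis
    using that [of X Y Z x1 x2 y1 y2 x3 y3] t1 t2 gen len x3 y3 W XW unfolding x1(1) x2 y1 y2 by simp
qed

lemma form_word_props:
  assumes "t \<in> forms i a b c"
  shows "cyc_reduced (form_word t)" "form_word t \<in> W" "length (form_word t) = 2 * half a b c"
    "isl (hd (form_word t)) = (\<not> i)" "odd a" "odd b" "odd c"
proof -
  obtain X Y Z x1 x2 x3 y1 y2 y3 where t: "t = (X, Y, Z, [x1], [x2], [y1], [y2])"
    and gen: "generic i i X Y Z [x1] [x2] [y1] [y2]" and len: "length X = a" "length Y = b" "length Z = c"
    and w: "form_word t = X @ [x1] @ Y @ [y1] @ Z @ [x2] @ winv X @ [y2] @ winv Y @ [x3] @ winv Z @ [y3]"
    by (rule formsE [OF assms])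
  show 1: "cyc_reduced (form_word t)" using generic_word(2) [OF gen] by (simp add: form_word_def t)
  then show "form_word t \<in> W" by (simp add: cyc_reduced_def)
  show "length (form_word t) = 2 * half a b c" using len by (simp add: w half_def)
  show "isl (hd (form_word t)) = (\<not> i)" using gen by (auto simp: w generic_def)
  show "odd a" "odd b" "odd c"
    using word_parity [of X] word_parity [of Y] word_parity [of Z] gen len unfolding generic_def by simp_all
qed

lemma form_word_commutator:
  assumes "t \<in> forms i a b c"
  shows "form_word t \<in> derived_set F (carrier F)"
proof -
  obtain X Y Z x1 x2 x3 y1 y2 y3 where t: "t = (X, Y, Z, [x1], [x2], [y1], [y2])"
    and "X \<in> W" "Y \<in> W" "Z \<in> W" "[x1] \<in> W" "[x2] \<in> W" "[y1] \<in> W" "[y2] \<in> W"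
    by (rule formsE [OF assms])
  then show ?thesis using F.wicks_commutator [of X Y Z "[x1]" "[x2]" "[y1]" "[y2]"] by (simp add: form_word_def t)
qed

lemma nth_winv: "q < length B \<Longrightarrow> winv B ! q = linv (B ! (length B - 1 - q))"
  by (simp add: winv_def rev_nth nth_map)

lemma nth_paired_block:
  assumes "w = pre @ B @ mid @ winv B @ post" "length pre = l" "length B + length mid = h" "q + q' + 1 = length B"
  shows "w ! (h + l + q') = linv (w ! (l + q))"
proof -
  have "w ! (l + q) = B ! q" using assms by (simp add: nth_append)
  moreover have "h + l + q' = length (pre @ B @ mid) + q'" using assms by simp
  then have "w ! (h + l + q') = winv B ! q'"
    unfolding assms(1) using assms(4) by (metis append.assoc nth_append_length_plus nth_append winv_simps(1) less_add_one add.commute add_lessD1 add.assoc)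
  moreover have "winv B ! q' = linv (B ! q)" using assms(4) by (subst nth_winv) (auto intro!: arg_cong [of _ _ "\<lambda>n. linv (B ! n)"])
  ultimately show ?thesis by simp
qed

lemma form_word_paired:
  assumes t: "t \<in> forms i a b c" and p: "p \<in> paired a b c"
  shows "form_word t ! pairing a b c p = linv (form_word t ! p)"
proof -
  obtain X Y Z x1 x2 x3 y1 y2 y3 where len: "length X = a" "length Y = b" "length Z = c"
    and w: "form_word t = X @ [x1] @ Y @ [y1] @ Z @ [x2] @ winv X @ [y2] @ winv Y @ [x3] @ winv Z @ [y3]"
    by (rule formsE [OF t])
  have letter: "form_word t ! r \<in> fp_letters G H" if "r < 2 * half a b c" for r
    using form_word_props(2,3) [OF t] that words_letter nth_mem by metis
  obtain l n q q' where q: "(l, n) \<in> {(0, a), (a + 1, b), (a + b + 2, c)}" "q + q' + 1 = n"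
    "p = l + q \<or> p = half a b c + l + q'"
    using p by (rule pairedE)
  have 1: "form_word t ! (half a b c + l + q') = linv (form_word t ! (l + q))"
  proof -
    consider "(l, n) = (0, a)" | "(l, n) = (a + 1, b)" | "(l, n) = (a + b + 2, c)" using q(1) by blast
    then show ?thesis
    proof cases
      case 1
      then show ?thesis using q(2) len w
        by (intro nth_paired_block [where B = X and pre = "[]" and mid = "[x1] @ Y @ [y1] @ Z @ [x2]"]) (auto simp: half_def)
    next
      case 2
      then show ?thesis using q(2) len w
        by (intro nth_paired_block [where B = Y and pre = "X @ [x1]" and mid = "[y1] @ Z @ [x2] @ winv X @ [y2]"]) (auto simp: half_def)
    next
      case 3
      then show ?thesis using q(2) len w
        by (intro nth_paired_block [where B = Z and pre = "X @ [x1] @ Y @ [y1]" and mid = "[x2] @ winv X @ [y2] @ winv Y @ [x3]"]) (auto simp: half_def)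
    qed
  qed
  have "l + q < 2 * half a b c" using pairing_value(5) [OF q(1,2)] by simp
  then show ?thesis
    using q(3) 1 pairing_value(1,2) [OF q(1,2)] linv_linv [OF letter [of "l + q"]] by auto
qed

text \<open>These positions hold \<open>a1\<close>, just after \<open>X\<close>, and
  \<open>a2\<close>, just before \<open>X\<inverse>\<close>; they are not inverse because the third
  entry is nontrivial. So the mirror symmetry of a piece cannot continue past its end.\<close>

lemma form_word_special:
  assumes t: "t \<in> forms i a b c"
  shows "form_word t ! (half a b c - 1) \<noteq> linv (form_word t ! a)"
proof -
  obtain X Y Z x1 x2 x3 y1 y2 y3 where len: "length X = a" "length Y = b" "length Z = c"
    and w: "form_word t = X @ [x1] @ Y @ [y1] @ Z @ [x2] @ winv X @ [y2] @ winv Y @ [x3] @ winv Z @ [y3]"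
    and "x2 \<noteq> linv x1"
    by (rule formsE [OF t])
  moreover have "form_word t ! (half a b c - 1) = x2" using len by (simp add: w half_def nth_append)
  moreover have "form_word t ! a = x1" using len by (simp add: w nth_append)
  ultimately show ?thesis by simp
qed

lemma rot_forms:
  assumes t: "t \<in> forms i a b c"
  shows "rot t \<in> forms i b c a" "form_word (rot t) = rotate (a + 1) (form_word t)"
    "(rot ^^ 6) t = t"
proof -
  obtain X Y Z x1 x2 x3 y1 y2 y3 where tt: "t = (X, Y, Z, [x1], [x2], [y1], [y2])"
    and gen: "generic i i X Y Z [x1] [x2] [y1] [y2]" and len: "length X = a" "length Y = b" "length Z = c"
    and x3: "inv\<^bsub>F\<^esub> [x1] \<cdot> inv\<^bsub>F\<^esub> [x2] = [x3]" and y3: "inv\<^bsub>F\<^esub> [y1] \<cdot> inv\<^bsub>F\<^esub> [y2] = [y3]"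
    and w: "form_word t = X @ [x1] @ Y @ [y1] @ Z @ [x2] @ winv X @ [y2] @ winv Y @ [x3] @ winv Z @ [y3]"
    and W: "X \<in> W" "Y \<in> W" "Z \<in> W" "[x1] \<in> W" "[x2] \<in> W" "[y1] \<in> W" "[y2] \<in> W"
    by (rule formsE [OF t])
  have r: "rot t = (Y, Z, winv X, [y1], [y2], [x2], [x3])" 
    unfolding rot_def tt prod.case x3 inv_word [OF W(1)] ..
  have x3': "inv\<^bsub>F\<^esub> [x2] \<cdot> inv\<^bsub>F\<^esub> [x3] = [x1]"
    unfolding x3 [symmetric] using W by (simp add: F.free_group_simps)
  have "[x3] \<in> factor i" unfolding x3 [symmetric] using gen by (simp add: generic_def)
  then have gen': "generic i i Y Z (winv X) [y1] [y2] [x2] [x3]"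
    using gen W winv_closed x3' unfolding generic_def by (simp add: y3)
  then show "rot t \<in> forms i b c a" using len by (simp add: forms_def r)
  have "form_word (rot t) = Y @ [y1] @ Z @ [x2] @ winv X @ [y2] @ winv Y @ [x3] @ winv Z @ [y3] @ X @ [x1]"
    using generic_word(1) [OF gen'] by (simp add: form_word_def r y3 x3' winv_winv W)
  also have "\<dots> = rotate (length (X @ [x1])) ((X @ [x1]) @ Y @ [y1] @ Z @ [x2] @ winv X @ [y2] @ winv Y @ [x3] @ winv Z @ [y3])"
    by (simp only: rotate_append) simp
  finally show "form_word (rot t) = rotate (a + 1) (form_word t)" by (simp add: w len)
  show "(rot ^^ 6) t = t"
    using W by (simp add: rot_def tt eval_nat_numeral F.free_group_simps)
qed

text \<open>Each rotation strips the leading piece with its entry and lowers the position, until it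
  falls into the first piece; \<open>r\<close> accumulates the shifts. Comparisons of forms then
  only have to be made on first pieces.\<close>

lemma move_to_first_piece:
  assumes "t \<in> forms i a b c" "p \<in> paired a b c"
  shows "\<exists>n a' b' c' p' r. (rot ^^ n) t \<in> forms i a' b' c' \<and> p' < a' \<and> half a' b' c' = half a b c \<and>
    form_word ((rot ^^ n) t) = rotate r (form_word t) \<and> (p' + r) mod (2 * half a b c) = p \<and>
    (pairing a' b' c' p' + r) mod (2 * half a b c) = pairing a b c p"
  using assms
proof (induction p arbitrary: t a b c rule: less_induct)
  case (less p t a b c)
  show ?case
  proof (cases "p < a")
    case True
    have "p < 2 * half a b c" using less.prems(2) by (simp add: paired_def)
    then show ?thesis using True less.prems pairing(4) [OF less.prems(2)]
      by (intro exI [of _ 0] exI [of _ a] exI [of _ b] exI [of _ c] exI [of _ p] exI [of _ "0 :: nat"]) simp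
  next
    case False
    then have ap: "a \<le> p" by simp
    note pr = pairing_rotate [OF less.prems(2) ap]
    note rt = rot_forms [OF less.prems(1)]
    have h: "half b c a = half a b c" by (simp add: half_def)
    have "p - (a + 1) < p" using pr(1) by simp
    from less.IH [OF this rt(1) pr(2)] obtain n a' b' c' p' r where
      *: "(rot ^^ n) (rot t) \<in> forms i a' b' c'" "p' < a'" "half a' b' c' = half a b c"
      "form_word ((rot ^^ n) (rot t)) = rotate r (form_word (rot t))" "(p' + r) mod (2 * half a b c) = p - (a + 1)"
      "(pairing a' b' c' p' + r) mod (2 * half a b c) = pairing b c a (p - (a + 1))"
      unfolding h by blast
    have plt: "p < 2 * half a b c" using less.prems(2) by (simp add: paired_def)
    have mod_shift: "(n + (r + (a + 1))) mod m = ((n + r) mod m + (a + 1)) mod m" for n m :: nat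
      by (metis add.assoc mod_add_left_eq)
    have "(p' + (r + (a + 1))) mod (2 * half a b c) = ((p' + r) mod (2 * half a b c) + (a + 1)) mod (2 * half a b c)"
      by (rule mod_shift)
    also have "\<dots> = p" unfolding *(5) using pr(1) plt by simp
    finally have 1: "(p' + (r + (a + 1))) mod (2 * half a b c) = p" .
    have "(pairing a' b' c' p' + (r + (a + 1))) mod (2 * half a b c) =
        ((pairing a' b' c' p' + r) mod (2 * half a b c) + (a + 1)) mod (2 * half a b c)"
      by (rule mod_shift)
    also have "\<dots> = pairing a b c p" unfolding *(6) by (rule pr(3))
    finally have 2: "(pairing a' b' c' p' + (r + (a + 1))) mod (2 * half a b c) = pairing a b c p" .
    have 3: "(rot ^^ Suc n) t = (rot ^^ n) (rot t)" by (simp add: funpow_swap1)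
    have "form_word ((rot ^^ Suc n) t) = rotate (r + (a + 1)) (form_word t)"
      unfolding 3 *(4) rt(2) rotate_rotate ..
    then show ?thesis using *(1-3) 1 2 unfolding 3 [symmetric] by blast
  qed
qed

text \<open>
  If two pairings agree somewhere, the pieces around that place have the same centre, so one
  contains the other. They are equal because the two letters beyond the end of a piece are never
  inverse to each other.
\<close>

lemma piece_maximal:
  assumes t: "t \<in> forms i a b c" and t': "t' \<in> forms i' a' b' c'"
    and w: "form_word t' = rotate r (form_word t)"
    and p: "p < a" "p' < a'" "(p' + r) mod (2 * half a b c) = p" "a' + 2 * p = a + 2 * p'"
  shows "a \<le> a'"
proof (rule ccontr)
  assume "\<not> a \<le> a'"
  then have lt: "a' < a" by simp
  define k where "k = 2 * half a b c"
  note len = form_word_props(3) [OF t] form_word_props(3) [OF t']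
  have h: "half a' b' c' = half a b c" using len w by simp
  \<comment> \<open>The amount by which the longer first piece protrudes on each side beyond the
    shorter one with the same centre.\<close>
  define e where "e = p - p'"
  have e: "p = p' + e" "a = a' + 2 * e" "e > 0" using p(4) lt unfolding e_def by simp_all
  have shift: "(p' + d + r) mod k = p + d" if "p + d < k" for d
  proof -
    have "(p' + d + r) mod k = ((p' + r) mod k + d) mod k" by (metis add.assoc add.commute mod_add_left_eq)
    then show ?thesis using p(3) that unfolding k_def by simp
  qed
  have nth: "form_word t' ! n = form_word t ! ((n + r) mod k)" if "n < k" for n
    using that len h unfolding w k_def by (simp add: nth_rotate add.commute)
  have 1: "form_word t' ! a' = form_word t ! (a' + e)"
    using shift [of "a' - p'"] nth [of a'] p(2) e unfolding k_def half_def by (simp add: add.commute)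
  have 2: "form_word t' ! (half a b c - 1) = form_word t ! (half a b c - 1 + e)"
    using shift [of "half a b c - 1 - p'"] nth [of "half a b c - 1"] p(2) e unfolding k_def half_def by simp
  have "a' + e \<in> paired a b c" using e by (simp add: paired_def half_def)
  moreover have "pairing a b c (a' + e) = half a b c - 1 + e" using e by (simp add: pairing_def half_def)
  ultimately have "form_word t ! (half a b c - 1 + e) = linv (form_word t ! (a' + e))"
    using form_word_paired [OF t, of "a' + e"] by simp
  then show False using form_word_special [OF t'] 1 2 h by simp
qed

lemma common_piece:
  assumes t: "t \<in> forms i a b c" and t': "t' \<in> forms i' a' b' c'"
    and w: "form_word t' = rotate r (form_word t)"
    and p: "p < a" "p' < a'" "(p' + r) mod (2 * half a b c) = p"
      "(pairing a' b' c' p' + r) mod (2 * half a b c) = pairing a b c p"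
  shows "a = a'" "form_word t' = form_word t"
proof -
  define k where "k = 2 * half a b c"
  note len = form_word_props(3) [OF t] form_word_props(3) [OF t']
  have h: "half a' b' c' = half a b c" using len w by simp
  have kpos: "k > 0" by (simp add: k_def half_def)
  define m m' where "m = (p' + r) div k" and "m' = (pairing a' b' c' p' + r) div k"
  have "int (p' + r) = int p + int k * int m" "int (pairing a' b' c' p' + r) = int (pairing a b c p) + int k * int m'"
    using p(3,4) mult_div_mod_eq [of k "p' + r"] mult_div_mod_eq [of k "pairing a' b' c' p' + r"]
    unfolding m_def m'_def k_def by (metis add.commute of_nat_add of_nat_mult)+
  moreover have "pairing a' b' c' p' = half a b c + (a' - 1 - p')" "pairing a b c p = half a b c + (a - 1 - p)"
    using p(1,2) h by (simp_all add: pairing_def)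
  \<comment> \<open>A common position with a common mate fixes the centre of the piece modulo the
    word length. The two sides differ by less than that length, so the congruence is an
    equality.\<close>
  ultimately have eq: "(int a' - 2 * int p') - (int a - 2 * int p) = int k * (int m' - int m)"
    using p(1,2) by (simp add: of_nat_diff algebra_simps)
  have "a < half a b c" "a' < half a b c" using h by (simp_all add: half_def)
  then have "\<bar>(int a' - 2 * int p') - (int a - 2 * int p)\<bar> < int k"
    using p(1,2) unfolding k_def by linarith
  then have "\<bar>int m' - int m\<bar> * int k < 1 * int k" unfolding eq by (simp add: abs_mult mult.commute)
  then have "int m' - int m = 0" using kpos mult_less_cancel_right_pos [of "int k" "\<bar>int m' - int m\<bar>" 1] by simp
  then have c: "a' + 2 * p = a + 2 * p'" using eq by simp
  have le: "a \<le> a'" by (rule piece_maximal [OF t t' w p(1-3) c])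
  have pk: "p < k" "p' < k" using p(1,2) h unfolding k_def half_def by simp_all
  define s where "s = k - r mod k"
  have rs: "(r + s) mod k = 0"
  proof -
    have "(r + s) mod k = (r mod k + s) mod k" by (simp add: mod_add_left_eq)
    also have "r mod k + s = k" using kpos mod_less_divisor [OF kpos, of r] by (simp add: s_def)
    finally show ?thesis by simp
  qed
  have w': "form_word t = rotate s (form_word t')"
    unfolding w rotate_rotate using rs len rotate_conv_mod [of "s + r" "form_word t"] by (simp add: k_def add.commute)
  have "(p + s) mod k = (p' + (r + s)) mod k"
    using p(3) unfolding k_def [symmetric] by (metis add.assoc mod_add_left_eq)
  also have "\<dots> = p'" using rs pk by (metis add.right_neutral mod_add_right_eq mod_less)
  finally have "(p + s) mod (2 * half a' b' c') = p'" using h k_def by simp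
  from piece_maximal [OF t' t w' p(2,1) this] c have "a' \<le> a" by simp
  then show "a = a'" using le by simp
  then have "p = p'" using c by simp
  then have "(p + r mod k) mod k = p" using p(3) by (simp add: k_def mod_add_right_eq)
  moreover obtain \<rho> where \<rho>: "r mod k = \<rho>" "\<rho> < k" using kpos by simp
  ultimately have "r mod k = 0" using pk unfolding \<rho>(1) by (cases "p + \<rho> < k") (simp_all add: le_mod_geq)
  then show "form_word t' = form_word t"
    unfolding w using rotate_conv_mod [of r "form_word t"] len by (simp add: k_def)
qed

lemma form_unique:
  assumes t: "t \<in> forms i a b c" and t': "t' \<in> forms i' a b c'" and w: "form_word t = form_word t'"
  shows "t = t'"
proof -
  obtain X Y Z x1 x2 x3 y1 y2 y3 where tt: "t = (X, Y, Z, [x1], [x2], [y1], [y2])"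
    and len: "length X = a" "length Y = b" "length Z = c"
    and w1: "form_word t = X @ [x1] @ Y @ [y1] @ Z @ [x2] @ winv X @ [y2] @ winv Y @ [x3] @ winv Z @ [y3]"
    by (rule formsE [OF t])
  obtain X' Y' Z' x1' x2' x3' y1' y2' y3' where tt': "t' = (X', Y', Z', [x1'], [x2'], [y1'], [y2'])"
    and len': "length X' = a" "length Y' = b" "length Z' = c'"
    and w2: "form_word t' = X' @ [x1'] @ Y' @ [y1'] @ Z' @ [x2'] @ winv X' @ [y2'] @ winv Y' @ [x3'] @ winv Z' @ [y3']"
    by (rule formsE [OF t'])
  have "c = c'" using form_word_props(3) [OF t] form_word_props(3) [OF t'] w by (simp add: half_def)
  moreover have "X @ [x1] @ Y @ [y1] @ Z @ [x2] @ winv X @ [y2] @ winv Y @ [x3] @ winv Z @ [y3] =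
      X' @ [x1'] @ Y' @ [y1'] @ Z' @ [x2'] @ winv X' @ [y2'] @ winv Y' @ [x3'] @ winv Z' @ [y3']"
    using w unfolding w1 w2 .
  ultimately show ?thesis using len len' unfolding tt tt' by simp
qed

end

section \<open>Counting words\<close>

locale two_finite_groups = two_groups +
  assumes finite_G: "finite (carrier G)" and finite_H: "finite (carrier H)"
    and nontrivial_G: "carrier G \<noteq> {\<one>\<^bsub>G\<^esub>}" and nontrivial_H: "carrier H \<noteq> {\<one>\<^bsub>H\<^esub>}"
begin

definition letters :: "bool \<Rightarrow> ('a + 'b) set" where
  "letters i = {x \<in> fp_letters G H. isl x = i}"

definition q :: "bool \<Rightarrow> nat" where "q i = card (letters i)"

definition Q :: nat where "Q = q True * q False"

lemma letters_eq: "letters True = Inl ` (carrier G - {\<one>\<^bsub>G\<^esub>})" "letters False = Inr ` (carrier H - {\<one>\<^bsub>H\<^esub>})"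
  by (auto simp: letters_def fp_letters_def)

lemma finite_letters [simp]: "finite (letters i)"
  using finite_G finite_H by (cases i) (simp_all add: letters_eq)

lemma q_eq: "q True = order G - 1" "q False = order H - 1"
  using finite_G finite_H by (simp_all add: q_def letters_eq card_image order_def)

lemma q_pos: "q i > 0"
proof -
  have "\<exists>x \<in> carrier G. x \<noteq> \<one>\<^bsub>G\<^esub>" "\<exists>x \<in> carrier H. x \<noteq> \<one>\<^bsub>H\<^esub>"
    using nontrivial_G nontrivial_H G.one_closed H.one_closed by blast+
  then have "letters i \<noteq> {}" by (cases i) (auto simp: letters_eq)
  then show ?thesis by (simp add: q_def card_gt_0_iff)
qed

lemma Q_eq: "q i * q (\<not> i) = Q"
  by (cases i) (simp_all add: Q_def mult.commute)

lemma Q_pos: "Q > 0"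
  using q_pos by (simp add: Q_def)

definition words_of :: "bool \<Rightarrow> nat \<Rightarrow> ('a + 'b) list set" where
  "words_of i l = {w \<in> W. length w = l \<and> (w \<noteq> [] \<longrightarrow> isl (hd w) = i)}"

lemma words_of_Suc: "words_of i (Suc l) = (\<lambda>(x, w). x # w) ` (letters i \<times> words_of (\<not> i) l)"
proof (intro equalityI subsetI)
  fix w assume "w \<in> words_of i (Suc l)"
  then obtain x u where w: "w = x # u" "length u = l" "x # u \<in> W" "isl x = i"
    unfolding words_of_def by (cases w) auto
  then have "x \<in> letters i" "u \<in> words_of (\<not> i) l"
    by (auto simp: letters_def words_of_def words_Cons joinable_def)
  then show "w \<in> (\<lambda>(x, w). x # w) ` (letters i \<times> words_of (\<not> i) l)" using w by auto
next
  fix w assume "w \<in> (\<lambda>(x, w). x # w) ` (letters i \<times> words_of (\<not> i) l)"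
  then obtain x u where "w = x # u" "x \<in> letters i" "u \<in> words_of (\<not> i) l" by auto
  then show "w \<in> words_of i (Suc l)"
    by (auto simp: letters_def words_of_def words_Cons joinable_def)
qed

lemma words_of_0: "words_of i 0 = {[]}"
  by (auto simp: words_of_def)

lemma card_words_of: "finite (words_of i l)" "card (words_of i l) = q i ^ ((l + 1) div 2) * q (\<not> i) ^ (l div 2)"
proof -
  have "finite (words_of i l) \<and> card (words_of i l) = q i ^ ((l + 1) div 2) * q (\<not> i) ^ (l div 2)"
  proof (induction l arbitrary: i)
    case (Suc l)
    have "inj_on (\<lambda>(x, w). x # w) (letters i \<times> words_of (\<not> i) l)" by (auto simp: inj_on_def)
    then show ?case
      using Suc [of "\<not> i"] by (simp add: words_of_Suc card_image card_cartesian_product q_def)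
  qed (simp add: words_of_0)
  then show "finite (words_of i l)" "card (words_of i l) = q i ^ ((l + 1) div 2) * q (\<not> i) ^ (l div 2)"
    by simp_all
qed

lemma words_of_nth:
  "w \<in> words_of i l \<Longrightarrow> p < l \<Longrightarrow> w ! p \<in> letters (if even p then i else \<not> i)"
proof (induction p arbitrary: w i l)
  case 0
  then obtain l' where "l = Suc l'" by (cases l) auto
  then show ?case using 0 by (auto simp: words_of_Suc)
next
  case (Suc p)
  then obtain l' where l: "l = Suc l'" by (cases l) auto
  then obtain x u where "w = x # u" "u \<in> words_of (\<not> i) l'" using Suc by (auto simp: words_of_Suc)
  then show ?case using Suc.IH [of u "\<not> i" l'] Suc.prems l by (cases "even p") simp_all
qed

text \<open>\<open>card_compatible_functions\<close> is applied once to the even and once to the odd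
  positions, whose letters come from different factors. Both exponents are raised to their maximum
  so that the two alphabets combine to a power of \<open>Q\<close>; accordingly \<open>e\<close>
  bounds the agreements within one parity. The summand 48 is 4 * 12: two forms leave at most twelve
  positions unpaired, each of weight 6 instead of 2.\<close>

lemma card_two_pairings:
  fixes g :: "nat \<Rightarrow> nat"
  assumes odd: "odd a" "odd b" "odd c"
    and S: "S \<subseteq> words_of i (2 * half a b c)"
    and Sf: "\<And>w p. w \<in> S \<Longrightarrow> p \<in> paired a b c \<Longrightarrow> w ! pairing a b c p = linv (w ! p)"
    and D': "D' \<subseteq> {..<2 * half a b c}"
    and g: "\<And>p. p \<in> D' \<Longrightarrow> g p \<in> D' \<and> g (g p) = p \<and> g p \<noteq> p \<and> even (g p) = even p"
    and Sg: "\<And>w p. w \<in> S \<Longrightarrow> p \<in> D' \<Longrightarrow> w ! g p = linv (w ! p)"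
    and e: "\<And>\<epsilon>. card {p \<in> paired a b c \<inter> D'. pairing a b c p = g p \<and> even p = \<epsilon>} \<le> e"
    and rest: "card ({..<2 * half a b c} - paired a b c \<inter> D') \<le> 12"
  shows "\<exists>m. card S \<le> Q ^ m \<and> 6 * m \<le> 2 * half a b c + e + 48"
proof -
  define k where "k = 2 * half a b c"
  define P where "P \<epsilon> = {p. p < k \<and> even p = \<epsilon>}" for \<epsilon>
  define L where "L \<epsilon> = (if \<epsilon> then i else \<not> i)" for \<epsilon>
  have fin: "finite (P \<epsilon>)" for \<epsilon> by (simp add: P_def)
  have cP: "card (P \<epsilon>) = half a b c" for \<epsilon>
  proof -
    have "bij_betw (\<lambda>n. if \<epsilon> then 2 * n else 2 * n + 1) {..<half a b c} (P \<epsilon>)"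
      unfolding bij_betw_def
    proof
      show "inj_on (\<lambda>n. if \<epsilon> then 2 * n else 2 * n + 1) {..<half a b c}" by (auto simp: inj_on_def)
      show "(\<lambda>n. if \<epsilon> then 2 * n else 2 * n + 1) ` {..<half a b c} = P \<epsilon>"
      proof (intro equalityI subsetI)
        fix p assume "p \<in> P \<epsilon>"
        then have "p = (if \<epsilon> then 2 * (p div 2) else 2 * (p div 2) + 1)" "p div 2 < half a b c"
          by (auto simp: P_def k_def)
        then show "p \<in> (\<lambda>n. if \<epsilon> then 2 * n else 2 * n + 1) ` {..<half a b c}" by blast
      qed (cases \<epsilon>; auto simp: P_def k_def)
    qed
    then show ?thesis by (metis bij_betw_same_card card_lessThan)
  qed
  have pk: "paired a b c \<subseteq> {..<k}" by (auto simp: paired_def k_def)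
  have "\<exists>m. card ((\<lambda>s. restrict s (P \<epsilon>)) ` ((!) ` S)) \<le> q (L \<epsilon>) ^ m \<and> 6 * m \<le> k + e + 48" for \<epsilon>
  proof -
    have "\<exists>m. card ((\<lambda>s. restrict s (P \<epsilon>)) ` ((!) ` S)) \<le> card (letters (L \<epsilon>)) ^ m \<and>
      6 * m \<le> 2 * card (P \<epsilon>) + card {p \<in> (paired a b c \<inter> P \<epsilon>) \<inter> (D' \<inter> P \<epsilon>). pairing a b c p = g p} +
        4 * card (P \<epsilon> - (paired a b c \<inter> P \<epsilon>) \<inter> (D' \<inter> P \<epsilon>))"
    proof (rule card_compatible_functions [where f = "pairing a b c" and g = g])
      fix p assume p: "p \<in> paired a b c \<inter> P \<epsilon>"
      then have "even (pairing a b c p) = even p" using odd by (auto simp: pairing_even)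
      then show "pairing a b c p \<in> paired a b c \<inter> P \<epsilon> \<and> pairing a b c (pairing a b c p) = p \<and> pairing a b c p \<noteq> p"
        using p pairing [of p a b c] by (auto simp: P_def k_def)
    next
      fix p assume p: "p \<in> D' \<inter> P \<epsilon>"
      then show "g p \<in> D' \<inter> P \<epsilon> \<and> g (g p) = p \<and> g p \<noteq> p"
        using g [of p] D' by (auto simp: P_def k_def)
    next
      fix s p assume "s \<in> (!) ` S" "p \<in> P \<epsilon>"
      then obtain w where w: "w \<in> words_of i k" "s = (!) w" "p < k" "even p = \<epsilon>"
        using S by (auto simp: P_def k_def)
      then show "s p \<in> letters (L \<epsilon>)" using words_of_nth [OF w(1,3)] by (simp add: L_def)
    qed (use fin Sf Sg in auto)
    then obtain m where m: "card ((\<lambda>s. restrict s (P \<epsilon>)) ` ((!) ` S)) \<le> q (L \<epsilon>) ^ m"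
      "6 * m \<le> 2 * card (P \<epsilon>) + card {p \<in> (paired a b c \<inter> P \<epsilon>) \<inter> (D' \<inter> P \<epsilon>). pairing a b c p = g p} +
        4 * card (P \<epsilon> - (paired a b c \<inter> P \<epsilon>) \<inter> (D' \<inter> P \<epsilon>))"
      unfolding q_def by blast
    have "{p \<in> (paired a b c \<inter> P \<epsilon>) \<inter> (D' \<inter> P \<epsilon>). pairing a b c p = g p} =
        {p \<in> paired a b c \<inter> D'. pairing a b c p = g p \<and> even p = \<epsilon>}"
      using pk by (auto simp: P_def)
    moreover have "card (P \<epsilon> - (paired a b c \<inter> P \<epsilon>) \<inter> (D' \<inter> P \<epsilon>)) \<le> card ({..<k} - paired a b c \<inter> D')"
      by (rule card_mono) (auto simp: P_def)
    ultimately have "6 * m \<le> k + e + 48"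
      using m(2) cP [of \<epsilon>] e [of \<epsilon>] rest unfolding k_def by simp
    then show ?thesis using m(1) by blast
  qed
  then obtain m where m: "\<And>\<epsilon>. card ((\<lambda>s. restrict s (P \<epsilon>)) ` ((!) ` S)) \<le> q (L \<epsilon>) ^ m \<epsilon>"
    "\<And>\<epsilon>. 6 * m \<epsilon> \<le> k + e + 48"
    by metis
  define M where "M = max (m True) (m False)"
  let ?h = "\<lambda>w. (restrict ((!) w) (P True), restrict ((!) w) (P False))"
  have "finite S" using S card_words_of(1) finite_subset by blast
  then have fin2: "finite ((\<lambda>s. restrict s (P \<epsilon>)) ` ((!) ` S))" for \<epsilon> by simp
  have "inj_on ?h S"
  proof (rule inj_onI)
    fix v w assume vw: "v \<in> S" "w \<in> S" "?h v = ?h w"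
    show "v = w"
    proof (rule nth_equalityI)
      have len: "length u = k" if "u \<in> S" for u
        using subsetD [OF S that] by (simp add: words_of_def k_def)
      show "length v = length w" using vw len by simp
      fix p assume "p < length v"
      then have "p \<in> P (even p)" using len [OF vw(1)] by (simp add: P_def)
      moreover have "restrict ((!) v) (P (even p)) = restrict ((!) w) (P (even p))"
        using vw(3) unfolding prod.inject by (cases "even p") simp_all
      then have "restrict ((!) v) (P (even p)) p = restrict ((!) w) (P (even p)) p" by (rule fun_cong)
      ultimately show "v ! p = w ! p" by simp
    qed
  qed
  then have "card S \<le> card ((\<lambda>s. restrict s (P True)) ` ((!) ` S) \<times> (\<lambda>s. restrict s (P False)) ` ((!) ` S))"
    using fin2 by (intro card_inj_on_le [of ?h]) auto
  also have "\<dots> \<le> q (L True) ^ m True * q (L False) ^ m False"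
    unfolding card_cartesian_product by (intro mult_mono m(1)) simp_all
  also have "\<dots> \<le> q (L True) ^ M * q (L False) ^ M"
    using q_pos by (intro mult_mono power_increasing) (simp_all add: M_def Suc_le_eq)
  also have "\<dots> = Q ^ M" using Q_eq [of i] by (simp add: L_def flip: power_mult_distrib)
  finally have "card S \<le> Q ^ M" .
  moreover have "6 * M \<le> k + e + 48" using m(2) [of True] m(2) [of False] by (simp add: M_def max_def)
  ultimately show ?thesis unfolding k_def by blast
qed

section \<open>Forms whose word carries two pairings\<close>

lemma forms_words_of:
  assumes "t \<in> forms i a b c"
  shows "form_word t \<in> words_of (\<not> i) (2 * half a b c)"
  using form_word_props [OF assms] by (simp add: words_of_def)

lemma card_forms_le:
  assumes "T \<subseteq> forms i a b c" "\<And>t. t \<in> T \<Longrightarrow> form_word t \<in> S" "S \<subseteq> words_of (\<not> i) (2 * half a b c)"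
  shows "card T \<le> card S" "finite T"
proof -
  have inj: "inj_on form_word T" by (rule inj_onI) (meson assms(1) form_unique subsetD)
  have fin: "finite S" using assms(3) card_words_of(1) finite_subset by blast
  show "card T \<le> card S" using assms(2) by (intro card_inj_on_le [OF inj _ fin]) auto
  show "finite T" using inj fin assms(2) by (metis finite_imageD finite_subset image_subsetI)
qed

lemma finite_forms: "finite (forms i a b c)"
  using card_forms_le(2) [of "forms i a b c" i a b c "words_of (\<not> i) (2 * half a b c)"] forms_words_of by blast

text \<open>A nontrivial third entry requires two distinct letters in one factor. This is what
  allows powers of \<open>Q\<close> to absorb polynomial factors.\<close>

lemma forms_Q_ge_2:
  assumes "t \<in> forms i a b c"
  shows "Q \<ge> 2"
proof -
  obtain X Y Z x1 x2 x3 y1 y2 y3 where t: "t = (X, Y, Z, [x1], [x2], [y1], [y2])"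
    and gen: "generic i i X Y Z [x1] [x2] [y1] [y2]" and ne: "x2 \<noteq> linv x1"
    by (rule formsE [OF assms])
  have "{x2, linv x1} \<subseteq> letters i"
    using gen linv_closed by (auto simp: generic_def factor_def letters_def letter_word)
  then have "card {x2, linv x1} \<le> q i" unfolding q_def by (rule card_mono [OF finite_letters])
  then have "2 \<le> q i" using ne by simp
  then show ?thesis using Q_eq [of i] q_pos [of "\<not> i"] by (metis One_nat_def Suc_leI mult.right_neutral mult_le_mono)
qed

lemma paired_complement: "card ({..<2 * half a b c} - paired a b c) \<le> 6"
proof -
  let ?l = "[a, a + b + 1, half a b c - 1, half a b c + a, half a b c + a + b + 1, 2 * half a b c - 1]"
  have "{..<2 * half a b c} - paired a b c \<subseteq> set ?l" by (auto simp: paired_def)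
  then have "card ({..<2 * half a b c} - paired a b c) \<le> card (set ?l)" by (rule card_mono [OF finite_set])
  also have "\<dots> \<le> length ?l" by (rule card_length)
  finally show ?thesis by simp
qed

text \<open>The pairing of \<open>t'\<close> is transported along the rotation \<open>\<phi>\<close>
  to the positions of \<open>t\<close>, where it pairs letters of the same word. By assumption it
  meets the first pairing nowhere, so the agreement term is 0.\<close>

lemma card_forms_disagreeing:
  fixes i :: bool
  assumes h: "half a' b' c' = half a b c" and odd': "odd a'" "odd b'" "odd c'" and r: "r < 2 * half a b c"
    and dis: "\<And>p'. p' \<in> paired a' b' c' \<Longrightarrow> (p' + r) mod (2 * half a b c) \<in> paired a b c \<Longrightarrow>
      (pairing a' b' c' p' + r) mod (2 * half a b c) \<noteq> pairing a b c ((p' + r) mod (2 * half a b c))"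
  defines "T \<equiv> {t \<in> forms i a b c. \<exists>i'. \<exists>t' \<in> forms i' a' b' c'. form_word t' = rotate r (form_word t)}"
  shows "\<exists>m. card T \<le> Q ^ m \<and> 6 * m \<le> 2 * half a b c + 48"
proof (cases "T = {}")
  case True
  then show ?thesis by (intro exI [of _ 0]) simp
next
  case False
  define k where "k = 2 * half a b c"
  have odd: "odd a" "odd b" "odd c" using False form_word_props(5-7) unfolding T_def by blast+
  define \<phi> where "\<phi> p = (p + r) mod k" for p
  have kpos: "k > 0" by (simp add: k_def half_def)
  have inj: "inj_on \<phi> {..<k}"
  proof (rule inj_onI)
    fix x y assume xy: "x \<in> {..<k}" "y \<in> {..<k}" "\<phi> x = \<phi> y"
    then have "k dvd int (x + r) - int (y + r)" unfolding \<phi>_def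
      by (metis mod_eq_dvd_iff of_nat_mod)
    then have "int k dvd int x - int y" by simp
    moreover have "\<bar>int x - int y\<bar> < int k" using xy(1,2) by auto
    ultimately have "int x - int y = 0" using dvd_imp_le_int [of "int x - int y" "int k"] by linarith
    then show "x = y" by simp
  qed
  have pk: "paired a' b' c' \<subseteq> {..<k}" by (auto simp: paired_def k_def h)
  define \<psi> where "\<psi> = the_inv_into (paired a' b' c') \<phi>"
  have inj': "inj_on \<phi> (paired a' b' c')" using inj pk inj_on_subset by blast
  have \<psi>: "\<psi> (\<phi> p) = p" if "p \<in> paired a' b' c'" for p
    using that inj' by (simp add: \<psi>_def the_inv_into_f_f)
  define g where "g x = \<phi> (pairing a' b' c' (\<psi> x))" for x
  define D' where "D' = \<phi> ` paired a' b' c'"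
  define S where "S = {w \<in> words_of (\<not> i) k. (\<forall>p \<in> paired a b c. w ! pairing a b c p = linv (w ! p)) \<and>
    (\<forall>p \<in> D'. w ! g p = linv (w ! p))}"
  have even_\<phi>: "even (\<phi> p) = even (p + r)" for p
    unfolding \<phi>_def k_def by (metis dvd_mod_iff dvd_triv_left)
  have "\<exists>m. card S \<le> Q ^ m \<and> 6 * m \<le> 2 * half a b c + 0 + 48"
  proof (rule card_two_pairings [OF odd, where i = "\<not> i" and D' = D' and g = g])
    show "D' \<subseteq> {..<2 * half a b c}" using kpos by (auto simp: D'_def \<phi>_def k_def)
    fix x assume "x \<in> D'"
    then obtain p where p: "p \<in> paired a' b' c'" "x = \<phi> p" by (auto simp: D'_def)
    note pp = pairing(1-3) [OF p(1)]
    have "g x = \<phi> (pairing a' b' c' p)" using p \<psi> by (simp add: g_def)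
    moreover have "\<phi> (pairing a' b' c' p) \<noteq> \<phi> p" using pp inj' p(1) by (metis inj_onD)
    ultimately show "g x \<in> D' \<and> g (g x) = x \<and> g x \<noteq> x \<and> even (g x) = even x"
      using p pp \<psi> pairing_even [OF p(1) odd'] by (simp add: D'_def g_def even_\<phi>)
  next
    fix \<epsilon>
    have "pairing a b c x \<noteq> g x" if x: "x \<in> paired a b c" "x \<in> D'" for x
    proof -
      obtain p where p: "p \<in> paired a' b' c'" "x = \<phi> p" using x(2) by (auto simp: D'_def)
      have "g x = (pairing a' b' c' p + r) mod (2 * half a b c)" using p \<psi> by (simp add: g_def \<phi>_def k_def)
      then show ?thesis using dis [OF p(1)] x(1) unfolding p(2) \<phi>_def k_def by metis
    qed
    then have "{p \<in> paired a b c \<inter> D'. pairing a b c p = g p \<and> even p = \<epsilon>} = {}" by blast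
    then show "card {p \<in> paired a b c \<inter> D'. pairing a b c p = g p \<and> even p = \<epsilon>} \<le> 0" by (simp only: card.empty)
  next
    have "{..<k} - D' \<subseteq> \<phi> ` ({..<k} - paired a' b' c')"
    proof -
      have "\<phi> ` {..<k} = {..<k}" using inj kpos by (intro endo_inj_surj) (auto simp: \<phi>_def)
      then show ?thesis unfolding D'_def by blast
    qed
    then have "card ({..<k} - D') \<le> card ({..<k} - paired a' b' c')"
      by (meson card_image_le card_mono finite_Diff finite_imageI finite_lessThan le_trans)
    also have "\<dots> \<le> 6" using paired_complement [of a' b' c'] by (simp add: k_def h)
    finally have "card ({..<k} - D') \<le> 6" .
    moreover have split: "{..<k} - paired a b c \<inter> D' = ({..<k} - paired a b c) \<union> ({..<k} - D')" by blast
    moreover have "card ({..<k} - paired a b c) \<le> 6" using paired_complement by (simp add: k_def)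
    ultimately show "card ({..<2 * half a b c} - paired a b c \<inter> D') \<le> 12"
      unfolding k_def [symmetric] split using card_Un_le [of "{..<k} - paired a b c" "{..<k} - D'"] by linarith
  qed (auto simp: S_def k_def)
  moreover have "card T \<le> card S"
  proof (rule card_forms_le(1))
    show "T \<subseteq> forms i a b c" by (auto simp: T_def)
    show "S \<subseteq> words_of (\<not> i) (2 * half a b c)" by (auto simp: S_def k_def)
    fix t assume "t \<in> T"
    then obtain i' t' where t: "t \<in> forms i a b c" "t' \<in> forms i' a' b' c'" "form_word t' = rotate r (form_word t)"
      by (auto simp: T_def)
    have nth: "form_word t' ! p = form_word t ! \<phi> p" if "p < k" for p
      using that form_word_props(3) [OF t(1)] unfolding t(3) by (simp add: nth_rotate \<phi>_def k_def add.commute)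
    have "form_word t ! g x = linv (form_word t ! x)" if x: "x \<in> D'" for x
    proof -
      obtain p where p: "p \<in> paired a' b' c'" "x = \<phi> p" using x by (auto simp: D'_def)
      then have "p < k" "pairing a' b' c' p < k" using pk pairing(1) by blast+
      then show ?thesis
        using form_word_paired [OF t(2) p(1)] nth p \<psi> by (simp add: g_def)
    qed
    then show "form_word t \<in> S"
      using forms_words_of [OF t(1)] form_word_paired [OF t(1)] by (simp add: S_def k_def)
  qed
  ultimately show ?thesis using le_trans by fastforce
qed

text \<open>In \<open>Y\<close> and \<open>Z\<close> the two pairings are reflections, and equal
  mates would force equal centres. As \<open>b + c\<close> equals \<open>b' + c'\<close>, this would
  give \<open>b = b'\<close>.\<close>

lemma pairing_eq_first_piece:
  assumes "half a b' c' = half a b c" "b \<noteq> b'" "p \<in> paired a b c" "p \<in> paired a b' c'"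
    "pairing a b c p = pairing a b' c' p"
  shows "p < a \<or> (half a b c \<le> p \<and> p < half a b c + a)"
proof (rule ccontr)
  assume n: "\<not> ?thesis"
  have eq: "b + c = b' + c'" using assms(1) by (simp add: half_def)
  have p: "p \<noteq> a" "p \<noteq> half a b c + a" "p < 2 * half a b c" using assms(3) by (auto simp: paired_def)
  show False
  proof (cases "p < half a b c")
    case True
    then show False using n p eq assms(2,5) unfolding pairing_def assms(1) by (auto simp: half_def split: if_splits)
  next
    case False
    then show False using n p eq assms(2,5) unfolding pairing_def assms(1) by (auto simp: half_def split: if_splits)
  qed
qed

lemma card_forms_sharing_piece:
  fixes i :: bool
  assumes h: "half a b' c' = half a b c" and b: "b \<noteq> b'" and odd': "odd b'" "odd c'"
  defines "T \<equiv> {t \<in> forms i a b c. \<exists>i'. \<exists>t' \<in> forms i' a b' c'. form_word t' = form_word t}"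
  shows "\<exists>m. card T \<le> Q ^ m \<and> 6 * m \<le> 2 * half a b c + (a + 1) + 48"
proof (cases "T = {}")
  case True
  then show ?thesis by (intro exI [of _ 0]) simp
next
  case False
  define k where "k = 2 * half a b c"
  have odd: "odd a" "odd b" "odd c" using False form_word_props(5-7) unfolding T_def by blast+
  define S where "S = {w \<in> words_of (\<not> i) k. (\<forall>p \<in> paired a b c. w ! pairing a b c p = linv (w ! p)) \<and>
    (\<forall>p \<in> paired a b' c'. w ! pairing a b' c' p = linv (w ! p))}"
  have "\<exists>m. card S \<le> Q ^ m \<and> 6 * m \<le> 2 * half a b c + (a + 1) + 48"
  proof (rule card_two_pairings [OF odd, where i = "\<not> i" and D' = "paired a b' c'" and g = "pairing a b' c'"])
    show "paired a b' c' \<subseteq> {..<2 * half a b c}" by (auto simp: paired_def h)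
    fix p assume p: "p \<in> paired a b' c'"
    show "pairing a b' c' p \<in> paired a b' c' \<and> pairing a b' c' (pairing a b' c' p) = p \<and>
        pairing a b' c' p \<noteq> p \<and> even (pairing a b' c' p) = even p"
      using pairing(1-3) [OF p] pairing_even [OF p odd(1) odd'] by simp
  next
    fix \<epsilon>
    let ?E = "{p \<in> paired a b c \<inter> paired a b' c'. pairing a b c p = pairing a b' c' p \<and> even p = \<epsilon>}"
    \<comment> \<open>Agreements lie in \<open>X\<close> and \<open>X\<inverse>\<close>, and about
      half of those positions have the parity \<open>\<epsilon>\<close>. Since
      \<open>half a b c\<close> is even, the shift by one gives the second block the opposite
      parity, so both blocks interleave injectively in \<open>{..a}\<close>.\<close>
    let ?f = "\<lambda>p. if p < a then p else p - half a b c + 1"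
    have E: "(p < a \<or> (half a b c \<le> p \<and> p < half a b c + a)) \<and> even p = \<epsilon>" if "p \<in> ?E" for p
      using that pairing_eq_first_piece [OF h b] by auto
    have ev: "even (half a b c)" using odd by (simp add: half_def)
    have par: "even (?f p) = (if p < a then \<epsilon> else \<not> \<epsilon>)" if "p \<in> ?E" for p
      using E [OF that] ev by auto
    have "inj_on ?f ?E"
    proof (rule inj_onI)
      fix x y assume xy: "x \<in> ?E" "y \<in> ?E" "?f x = ?f y"
      then have "(x < a) = (y < a)" using par [of x] par [of y] by (metis (full_types))
      then show "x = y" using xy(3) E [OF xy(1)] E [OF xy(2)] by (auto split: if_splits)
    qed
    moreover have "?f ` ?E \<subseteq> {..a}" using E by fastforce
    ultimately show "card ?E \<le> a + 1"
      using card_inj_on_le [of ?f ?E "{..a}"] by simp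
  next
    have "{..<k} - paired a b c \<inter> paired a b' c' = ({..<k} - paired a b c) \<union> ({..<k} - paired a b' c')" by blast
    then show "card ({..<2 * half a b c} - paired a b c \<inter> paired a b' c') \<le> 12"
      using card_Un_le [of "{..<k} - paired a b c" "{..<k} - paired a b' c'"]
        paired_complement [of a b c] paired_complement [of a b' c'] unfolding k_def h by simp
  qed (auto simp: S_def k_def)
  moreover have "card T \<le> card S"
  proof (rule card_forms_le(1))
    show "T \<subseteq> forms i a b c" by (auto simp: T_def)
    show "S \<subseteq> words_of (\<not> i) (2 * half a b c)" by (auto simp: S_def k_def)
    fix t assume "t \<in> T"
    then obtain i' t' where t: "t \<in> forms i a b c" "t' \<in> forms i' a b' c'" "form_word t' = form_word t"
      by (auto simp: T_def)
    show "form_word t \<in> S"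
      using forms_words_of [OF t(1)] form_word_paired [OF t(1)] form_word_paired [OF t(2)] t(3) by (simp add: S_def k_def)
  qed
  ultimately show ?thesis using le_trans by fastforce
qed

end

section \<open>Forms whose class has further representations\<close>

text \<open>The fifth power counts the choices of \<open>a\<close>, \<open>b\<close>,
  \<open>a'\<close>, \<open>b'\<close> and a rotation; for \<open>n = 4 * K\<close> the exponent is
  \<open>K div 3\<close>, the room left by disagreeing pairings. The factor 60 is 12 * 5, from
  rounding in two divisions.\<close>

lemma power5_le: "n ^ 5 \<le> 60 ^ 5 * 2 ^ (n div 12)" for n :: nat
proof -
  define m where "m = n div 12"
  have "n \<le> 12 * (m + 1)" unfolding m_def by presburger
  also have "m + 1 \<le> 5 * (m div 5 + 1)" by presburger
  also have "m div 5 + 1 \<le> 2 ^ (m div 5)" using less_exp [of "m div 5"] by linarith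
  finally have "n \<le> 60 * 2 ^ (m div 5)" by simp
  then have "n ^ 5 \<le> (60 * 2 ^ (m div 5)) ^ 5" by (rule power_mono) simp
  also have "\<dots> = 60 ^ 5 * 2 ^ (5 * (m div 5))"
    by (simp only: power_mult_distrib power_mult [symmetric] mult.commute)
  also have "\<dots> \<le> 60 ^ 5 * 2 ^ m" by (intro mult_left_mono power_increasing) simp_all
  finally show ?thesis by (simp add: m_def)
qed

lemma card_UN_bound:
  assumes "finite I" "\<And>i. i \<in> I \<Longrightarrow> card (A i) \<le> n" "card I \<le> N"
  shows "card (\<Union>i\<in>I. A i) \<le> N * n"
proof -
  have "card (\<Union>i\<in>I. A i) \<le> (\<Sum>i\<in>I. card (A i))" by (rule card_UN_le [OF assms(1)])
  also have "\<dots> \<le> (\<Sum>i\<in>I. n)" by (rule sum_mono) (rule assms(2))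
  also have "\<dots> \<le> N * n" using assms(3) by simp
  finally show ?thesis .
qed

lemma card_le_fibres:
  assumes A: "finite A" and f: "\<And>x. x \<in> A - B \<Longrightarrow> card {y \<in> A. f y = f x} \<le> n" and B: "B \<subseteq> A"
  shows "card A \<le> card (f ` A) * n + card B"
proof -
  have "A - B \<subseteq> (\<Union>z\<in>f ` (A - B). {y \<in> A. f y = z})" by auto
  then have "card (A - B) \<le> card (\<Union>z\<in>f ` (A - B). {y \<in> A. f y = z})"
    using A by (intro card_mono) auto
  also have "\<dots> \<le> card (f ` A) * n"
    using A f by (intro card_UN_bound card_mono) auto
  finally show ?thesis using card_Diff_subset [of B A] B A finite_subset [OF B A] by simp
qed

lemma fibres_le_card:
  assumes A: "finite A" and f: "\<And>x. x \<in> A - B \<Longrightarrow> n \<le> card {y \<in> A. f y = f x}"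
  shows "card (f ` (A - B)) * n \<le> card A"
proof -
  have "card (f ` (A - B)) * n = (\<Sum>z\<in>f ` (A - B). n)" by simp
  also have "\<dots> \<le> (\<Sum>z\<in>f ` (A - B). card {y \<in> A. f y = z})" using f by (intro sum_mono) auto
  also have "\<dots> = card (\<Union>z\<in>f ` (A - B). {y \<in> A. f y = z})"
    using A by (intro card_UN_disjoint [symmetric]) auto
  also have "\<dots> \<le> card A" using A by (intro card_mono) auto
  finally show ?thesis .
qed

context two_finite_groups
begin

definition all_forms :: "nat \<Rightarrow> ('a, 'b) form set" where
  "all_forms K = {t. \<exists>i a b c. t \<in> forms i a b c \<and> half a b c = 2 * K}"

definition disagreeing :: "nat \<Rightarrow> ('a, 'b) form set" where
  "disagreeing K = {t. \<exists>i a b c i' a' b' c' r. t \<in> forms i a b c \<and> half a b c = 2 * K \<and> half a' b' c' = 2 * K \<and> r < 4 * K \<and>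
     (\<exists>t' \<in> forms i' a' b' c'. form_word t' = rotate r (form_word t)) \<and>
     (\<forall>p' \<in> paired a' b' c'. (p' + r) mod (4 * K) \<in> paired a b c \<longrightarrow>
        (pairing a' b' c' p' + r) mod (4 * K) \<noteq> pairing a b c ((p' + r) mod (4 * K)))}"

text \<open>What remains when two pairings agree somewhere: by then the agreement has been rotated
  into the first pieces, which makes these pieces and the two words equal.\<close>

definition sharing_piece :: "nat \<Rightarrow> ('a, 'b) form set" where
  "sharing_piece K = {t. \<exists>i a b c i' b' c'. t \<in> forms i a b c \<and> half a b c = 2 * K \<and> b \<noteq> b' \<and>
     (\<exists>t' \<in> forms i' a b' c'. form_word t' = form_word t)}"

lemma finite_all_forms: "finite (all_forms K)"
proof -
  have "all_forms K \<subseteq> (\<Union>(i, a, b, c) \<in> UNIV \<times> {..2 * K} \<times> {..2 * K} \<times> {..2 * K}. forms i a b c)"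
    unfolding all_forms_def half_def by fastforce
  then show ?thesis by (rule finite_subset) (auto intro: finite_forms)
qed

lemma all_forms_Q: "t \<in> all_forms K \<Longrightarrow> Q \<ge> 2"
  using forms_Q_ge_2 unfolding all_forms_def by blast

text \<open>Each choice of shapes and rotation allows \<open>Q ^ ((4 * K + 48) div 6)\<close> forms,
  and the polynomial number of choices costs another \<open>Q ^ (K div 3)\<close>; the exponents add
  up to at most \<open>K + 8\<close>.\<close>

lemma card_disagreeing: "card (disagreeing K) \<le> 2 * 60 ^ 5 * Q ^ (K + 8)"
proof (cases "disagreeing K = {}")
  case True
  then show ?thesis by simp
next
  case False
  then have Q2: "Q \<ge> 2" using all_forms_Q [of _ K] unfolding disagreeing_def all_forms_def by blast
  define c where "c a b = 2 * K - 3 - a - b" for a b :: nat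
  define B where "B = (\<lambda>(i, a, b, a', b', r). {t \<in> forms i a b (c a b). half a b (c a b) = 2 * K \<and> half a' b' (c a' b') = 2 * K \<and>
     (\<exists>i'. \<exists>t' \<in> forms i' a' b' (c a' b'). form_word t' = rotate r (form_word t)) \<and>
     (\<forall>p' \<in> paired a' b' (c a' b'). (p' + r) mod (4 * K) \<in> paired a b (c a b) \<longrightarrow>
        (pairing a' b' (c a' b') p' + r) mod (4 * K) \<noteq> pairing a b (c a b) ((p' + r) mod (4 * K)))})"
  define I where "I = (UNIV :: bool set) \<times> {..<4 * K} \<times> {..<4 * K} \<times> {..<4 * K} \<times> {..<4 * K} \<times> {..<4 * K}"
  have "disagreeing K \<subseteq> (\<Union>x\<in>I. B x)"
  proof
    fix t assume "t \<in> disagreeing K"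
    then obtain i a b c' i' a' b' c'' r where *: "t \<in> forms i a b c'" "half a b c' = 2 * K" "half a' b' c'' = 2 * K" "r < 4 * K"
      "\<exists>t' \<in> forms i' a' b' c''. form_word t' = rotate r (form_word t)"
      "\<forall>p' \<in> paired a' b' c''. (p' + r) mod (4 * K) \<in> paired a b c' \<longrightarrow>
        (pairing a' b' c'' p' + r) mod (4 * K) \<noteq> pairing a b c' ((p' + r) mod (4 * K))"
      unfolding disagreeing_def by blast
    have c: "c' = c a b" "c'' = c a' b'" using *(2,3) by (simp_all add: half_def c_def)
    have "a < 4 * K" "b < 4 * K" "a' < 4 * K" "b' < 4 * K" using *(2,3) by (simp_all add: half_def)
    then have "(i, a, b, a', b', r) \<in> I" using *(4) by (simp add: I_def)
    moreover have "t \<in> B (i, a, b, a', b', r)" using * unfolding c B_def by blast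
    ultimately show "t \<in> (\<Union>x\<in>I. B x)" by blast
  qed
  moreover have finB: "finite (B x)" for x
    by (cases x) (auto simp: B_def intro: finite_subset [OF _ finite_forms])
  moreover have finI: "finite I" by (simp add: I_def)
  ultimately have "card (disagreeing K) \<le> card (\<Union>x\<in>I. B x)" by (intro card_mono) auto
  also have "\<dots> \<le> 2 * (4 * K) ^ 5 * Q ^ ((4 * K + 48) div 6)"
  proof (rule card_UN_bound [OF finI])
    show "card I \<le> 2 * (4 * K) ^ 5" by (simp add: I_def card_cartesian_product eval_nat_numeral)
    fix x assume "x \<in> I"
    obtain i a b a' b' r where x: "x = (i, a, b, a', b', r)" by (cases x) auto
    have r: "r < 4 * K" using \<open>x \<in> I\<close> by (simp add: I_def x)
    show "card (B x) \<le> Q ^ ((4 * K + 48) div 6)"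
    proof (cases "B x = {}")
      case True
      then show ?thesis by simp
    next
      case False
      then obtain t i' t' where *: "half a b (c a b) = 2 * K" "half a' b' (c a' b') = 2 * K"
        "t' \<in> forms i' a' b' (c a' b')"
        "\<forall>p' \<in> paired a' b' (c a' b'). (p' + r) mod (4 * K) \<in> paired a b (c a b) \<longrightarrow>
          (pairing a' b' (c a' b') p' + r) mod (4 * K) \<noteq> pairing a b (c a b) ((p' + r) mod (4 * K))"
        unfolding B_def x by blast
      have k: "2 * half a b (c a b) = 4 * K" using *(1) by simp
      have eq: "half a' b' (c a' b') = half a b (c a b)" using *(1,2) by simp
      obtain m where m: "card {t \<in> forms i a b (c a b). \<exists>i'. \<exists>t' \<in> forms i' a' b' (c a' b'). form_word t' = rotate r (form_word t)} \<le> Q ^ m"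
        "6 * m \<le> 4 * K + 48"
        using card_forms_disagreeing [OF eq form_word_props(5-7) [OF *(3)], of r i] r *(4) unfolding k by blast
      have "card (B x) \<le> card {t \<in> forms i a b (c a b). \<exists>i'. \<exists>t' \<in> forms i' a' b' (c a' b'). form_word t' = rotate r (form_word t)}"
        by (rule card_mono) (auto simp: B_def x finite_forms)
      also have "\<dots> \<le> Q ^ m" by (rule m(1))
      also have "\<dots> \<le> Q ^ ((4 * K + 48) div 6)" using Q_pos m(2) by (intro power_increasing) auto
      finally show ?thesis .
    qed
  qed
  also have "\<dots> \<le> 2 * (60 ^ 5 * 2 ^ (K div 3)) * Q ^ ((4 * K + 48) div 6)"
    using power5_le [of "4 * K"] by (intro mult_right_mono mult_left_mono) simp_all
  also have "\<dots> \<le> 2 * (60 ^ 5 * Q ^ (K div 3)) * Q ^ ((4 * K + 48) div 6)"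
    using Q2 by (intro mult_right_mono mult_left_mono power_mono) simp_all
  also have "\<dots> = 2 * 60 ^ 5 * Q ^ (K div 3 + (4 * K + 48) div 6)" by (simp add: power_add)
  also have "\<dots> \<le> 2 * 60 ^ 5 * Q ^ (K + 8)"
    using Q_pos by (intro mult_left_mono power_increasing) auto
  finally show ?thesis .
qed

text \<open>For a long shared piece there is little room below \<open>Q ^ K\<close>, so a uniform
  estimate fails. With \<open>a\<close> fixed, \<open>n\<close> is \<open>b + c + 1\<close>; at most
  \<open>n * n\<close> pairs \<open>b\<close>, \<open>b'\<close> remain, and they are absorbed by
  the available \<open>Q ^ (n div 6)\<close>. Only the sum over \<open>a\<close> and the factor is
  not absorbed, whence the linear factor \<open>4 * K\<close>.\<close>

lemma card_sharing_piece: "card (sharing_piece K) \<le> 4 * K * (60 ^ 5 * Q ^ (K + 8))"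
proof (cases "sharing_piece K = {}")
  case True
  then show ?thesis by simp
next
  case False
  then have Q2: "Q \<ge> 2" using all_forms_Q [of _ K] unfolding sharing_piece_def all_forms_def by blast
  define B where "B = (\<lambda>(i, a). {t. \<exists>b c i' b' c'. t \<in> forms i a b c \<and> half a b c = 2 * K \<and> b \<noteq> b' \<and>
     (\<exists>t' \<in> forms i' a b' c'. form_word t' = form_word t)})"
  define I where "I = (UNIV :: bool set) \<times> {..<2 * K}"
  have "sharing_piece K \<subseteq> (\<Union>x\<in>I. B x)"
  proof
    fix t assume "t \<in> sharing_piece K"
    then obtain i a b c i' b' c' where *: "t \<in> forms i a b c" "half a b c = 2 * K" "b \<noteq> b'"
     "\<exists>t' \<in> forms i' a b' c'. form_word t' = form_word t"
      unfolding sharing_piece_def by blast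
    then have "(i, a) \<in> I" by (simp add: I_def half_def)
    moreover have "t \<in> B (i, a)" using * unfolding B_def by blast
    ultimately show "t \<in> (\<Union>x\<in>I. B x)" by blast
  qed
  moreover have finI: "finite I" by (simp add: I_def)
  moreover have "B x \<subseteq> all_forms K" for x by (auto simp: B_def all_forms_def)
  then have "(\<Union>x\<in>I. B x) \<subseteq> all_forms K" by blast
  then have "finite (\<Union>x\<in>I. B x)" using finite_all_forms finite_subset by blast
  ultimately have "card (sharing_piece K) \<le> card (\<Union>x\<in>I. B x)" by (intro card_mono)
  also have "\<dots> \<le> 4 * K * (60 ^ 5 * Q ^ (K + 8))"
  proof (rule card_UN_bound [OF finI])
    show "card I \<le> 4 * K" by (simp add: I_def card_cartesian_product)
    fix x assume "x \<in> I"
    then obtain i a where x: "x = (i, a)" "a < 2 * K" by (auto simp: I_def)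
    define n where "n = 2 * K - 2 - a"
    define J where "J = {..<n} \<times> {..<n}"
    define D where "D = (\<lambda>(b, b'). {t. \<exists>i'. t \<in> forms i a b (n - 1 - b) \<and> half a b (n - 1 - b) = 2 * K \<and> b \<noteq> b' \<and>
       (\<exists>t' \<in> forms i' a b' (n - 1 - b'). form_word t' = form_word t)})"
    have "B x \<subseteq> (\<Union>y\<in>J. D y)"
    proof
      fix t assume "t \<in> B x"
      then obtain b c i' b' c' t' where *: "t \<in> forms i a b c" "half a b c = 2 * K" "b \<noteq> b'"
       "t' \<in> forms i' a b' c'" "form_word t' = form_word t"
        unfolding B_def x by blast
      have "half a b' c' = 2 * K" using form_word_props(3) [OF *(1)] form_word_props(3) [OF *(4)] *(2,5) by simp
      then have "c = n - 1 - b" "c' = n - 1 - b'" "b < n" "b' < n" using *(2) by (auto simp: half_def n_def)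
      then have "(b, b') \<in> J" "t \<in> D (b, b')" using * unfolding D_def J_def by blast+
      then show "t \<in> (\<Union>y\<in>J. D y)" by blast
    qed
    moreover have "D y \<subseteq> all_forms K" for y by (cases y) (auto simp: D_def all_forms_def)
    then have "(\<Union>y\<in>J. D y) \<subseteq> all_forms K" by blast
    then have "finite (\<Union>y\<in>J. D y)" using finite_all_forms finite_subset by blast
    ultimately have "card (B x) \<le> card (\<Union>y\<in>J. D y)" by (intro card_mono)
    also have "\<dots> \<le> (n * n) * Q ^ (K + 8 - n div 6)"
    proof (rule card_UN_bound)
      show "finite J" "card J \<le> n * n" by (simp_all add: J_def card_cartesian_product)
      fix y assume "y \<in> J"
      obtain b b' where y: "y = (b, b')" by (cases y)
      show "card (D y) \<le> Q ^ (K + 8 - n div 6)"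
      proof (cases "D y = {}")
        case True
        then show ?thesis by simp
      next
        case False
        then obtain t i' t' where *: "half a b (n - 1 - b) = 2 * K" "b \<noteq> b'" "t \<in> forms i a b (n - 1 - b)"
          "t' \<in> forms i' a b' (n - 1 - b')" "form_word t' = form_word t"
          unfolding D_def y by blast
        have h: "half a b' (n - 1 - b') = half a b (n - 1 - b)"
          using form_word_props(3) [OF *(3)] form_word_props(3) [OF *(4)] *(5) by simp
        obtain m where m: "card {t \<in> forms i a b (n - 1 - b). \<exists>i'. \<exists>t' \<in> forms i' a b' (n - 1 - b'). form_word t' = form_word t} \<le> Q ^ m"
          "6 * m \<le> 2 * (2 * K) + (a + 1) + 48"
          using card_forms_sharing_piece [OF h *(2) form_word_props(6,7) [OF *(4)], of i] *(1) by auto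
        have "card (D y) \<le> card {t \<in> forms i a b (n - 1 - b). \<exists>i'. \<exists>t' \<in> forms i' a b' (n - 1 - b'). form_word t' = form_word t}"
          by (rule card_mono) (auto simp: D_def y finite_forms)
        also have "\<dots> \<le> Q ^ m" by (rule m(1))
        also have "\<dots> \<le> Q ^ (K + 8 - n div 6)"
        proof (rule power_increasing)
          have "a + n + 2 = 2 * K" using *(1) by (simp add: half_def n_def)
          then have "6 * m + n \<le> 6 * K + 48" using m(2) by linarith
          then show "m \<le> K + 8 - n div 6" by linarith
        qed (use Q_pos in simp)
        finally show ?thesis .
      qed
    qed
    also have "\<dots> \<le> (60 ^ 5 * Q ^ (n div 6)) * Q ^ (K + 8 - n div 6)"
    proof (rule mult_right_mono)
      have "n * n \<le> n ^ 5" by (cases "n = 0") (auto simp: eval_nat_numeral)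
      also have "\<dots> \<le> 60 ^ 5 * 2 ^ (n div 12)" by (rule power5_le)
      also have "\<dots> \<le> 60 ^ 5 * 2 ^ (n div 6)" by (intro mult_left_mono power_increasing div_le_mono2) simp_all
      also have "\<dots> \<le> 60 ^ 5 * Q ^ (n div 6)" using Q2 by (intro mult_left_mono power_mono) simp_all
      finally show "n * n \<le> 60 ^ 5 * Q ^ (n div 6)" .
    qed simp
    also have "\<dots> = 60 ^ 5 * Q ^ (n div 6 + (K + 8 - n div 6))" by (simp add: power_add)
    also have "n div 6 + (K + 8 - n div 6) = K + 8" using x(2) unfolding n_def by linarith
    finally show "card (B x) \<le> 60 ^ 5 * Q ^ (K + 8)" .
  qed
  finally show ?thesis .
qed

section \<open>Forms representing the same conjugacy class\<close>

definition form_class :: "('a, 'b) form \<Rightarrow> ('a + 'b) list set" where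
  "form_class t = conjugacy_class F (form_word t)"

lemma self_in_class: "w \<in> W \<Longrightarrow> w \<in> conjugacy_class F w"
  unfolding conjugacy_class_def by (rule image_eqI [of _ _ "[]"]) simp_all

lemma class_subset:
  assumes "w \<in> W" "v \<in> conjugacy_class F w"
  shows "conjugacy_class F v \<subseteq> conjugacy_class F w"
proof -
  have "conj_closed (conjugacy_class F w)"
    using assms(1) by (intro class_conj_closed) (simp add: conjugacy_classes_def)
  from conj_closedD [OF this _ assms(2)] show ?thesis by (auto simp: conjugacy_class_def [of F v])
qed

lemma class_eqI:
  assumes "w \<in> W" "v \<in> conjugacy_class F w"
  shows "conjugacy_class F v = conjugacy_class F w"
proof -
  obtain g where g: "g \<in> W" "v = g \<cdot> w \<cdot> inv\<^bsub>F\<^esub> g"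
    using assms(2) by (auto simp: conjugacy_class_def)
  have "w = inv\<^bsub>F\<^esub> g \<cdot> v \<cdot> inv\<^bsub>F\<^esub> (inv\<^bsub>F\<^esub> g)"
    using g assms(1) by (simp add: F.free_group_simps)
  then have "w \<in> conjugacy_class F v"
    using g(1) unfolding conjugacy_class_def carrier_F by (intro image_eqI [of _ _ "inv\<^bsub>F\<^esub> g"]) simp_all
  moreover have "v \<in> W" using g assms(1) by simp
  ultimately show ?thesis using class_subset assms by blast
qed

lemma form_class_rotation:
  assumes t: "t \<in> forms i a b c" and t': "t' \<in> forms i' a' b' c'" and eq: "form_class t' = form_class t"
  shows "\<exists>r < 2 * half a b c. form_word t' = rotate r (form_word t)"
proof -
  note p = form_word_props(1-3) [OF t] and p' = form_word_props(1-3) [OF t']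
  have "form_word t' \<in> conjugacy_class F (form_word t)"
    using self_in_class [OF p'(2)] eq by (simp add: form_class_def)
  then obtain g where g: "g \<in> W" "form_word t' = g \<cdot> form_word t \<cdot> inv\<^bsub>F\<^esub> g"
    by (auto simp: conjugacy_class_def)
  obtain r where "form_word t' = rotate r (form_word t)"
    using conj_cyc_reduced [OF g(1) p(1)] p'(1) unfolding g(2) by blast
  then have "form_word t' = rotate (r mod (2 * half a b c)) (form_word t)"
    using rotate_conv_mod [of r "form_word t"] p(3) by simp
  moreover have "r mod (2 * half a b c) < 2 * half a b c" by (simp add: half_def)
  ultimately show ?thesis by blast
qed

lemma rot_all_forms:
  assumes "t \<in> all_forms K"
  shows "(rot ^^ n) t \<in> all_forms K" "form_class ((rot ^^ n) t) = form_class t" "(rot ^^ (6 * n)) t = t"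
proof -
  have 1: "rot t \<in> all_forms K \<and> form_class (rot t) = form_class t" if t: "t \<in> all_forms K" for t
  proof -
    obtain i a b c where f: "t \<in> forms i a b c" "half a b c = 2 * K" using t by (auto simp: all_forms_def)
    obtain X Y Z x1 x2 x3 y1 y2 y3 where tt: "t = (X, Y, Z, [x1], [x2], [y1], [y2])"
      and W: "X \<in> W" "Y \<in> W" "Z \<in> W" "[x1] \<in> W" "[x2] \<in> W" "[y1] \<in> W" "[y2] \<in> W"
      by (rule formsE [OF f(1)])
    have "form_word (rot t) = inv\<^bsub>F\<^esub> (X \<cdot> [x1]) \<cdot> form_word t \<cdot> inv\<^bsub>F\<^esub> (inv\<^bsub>F\<^esub> (X \<cdot> [x1]))"
      using F.wicks_rotate [of X Y Z "[x1]" "[x2]" "[y1]" "[y2]"] W by (simp add: form_word_def rot_def tt)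
    then have "form_word (rot t) \<in> conjugacy_class F (form_word t)"
      using W unfolding conjugacy_class_def carrier_F by (intro image_eqI [of _ _ "inv\<^bsub>F\<^esub> (X \<cdot> [x1])"]) simp_all
    then have "form_class (rot t) = form_class t"
      unfolding form_class_def by (rule class_eqI [OF form_word_props(2) [OF f(1)]])
    moreover have "half b c a = half a b c" by (simp add: half_def)
    ultimately show ?thesis using rot_forms(1) [OF f(1)] f(2) unfolding all_forms_def by auto
  qed
  have 2: "(rot ^^ n) t \<in> all_forms K \<and> form_class ((rot ^^ n) t) = form_class t"
    using 1 assms by (induction n) simp_all
  then show "(rot ^^ n) t \<in> all_forms K" "form_class ((rot ^^ n) t) = form_class t" by simp_all
  have 6: "(rot ^^ 6) t = t" using rot_forms(3) assms unfolding all_forms_def by blast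
  show "(rot ^^ (6 * n)) t = t"
    by (induction n) (simp, simp add: funpow_add 6 del: funpow.simps)
qed

text \<open>As \<open>t\<close> is not in \<open>disagreeing K\<close>, the pairings agree at some
  position, which is rotated into the first piece of both forms. \<open>common_piece\<close> then
  gives equal words and equal first pieces, the exclusion of \<open>sharing_piece K\<close> equal
  second pieces, and so the rotated forms coincide.\<close>

lemma same_class_rotations:
  assumes t: "t \<in> all_forms K" and t': "t' \<in> all_forms K" and eq: "form_class t' = form_class t"
    and d: "t \<notin> disagreeing K" and s: "\<And>n. (rot ^^ n) t \<notin> sharing_piece K"
  shows "\<exists>n. t' = (rot ^^ n) t"
proof -
  define k where "k = 4 * K"
  obtain i a b c where f: "t \<in> forms i a b c" "half a b c = 2 * K" using t by (auto simp: all_forms_def)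
  obtain i' a' b' c' where f': "t' \<in> forms i' a' b' c'" "half a' b' c' = 2 * K" using t' by (auto simp: all_forms_def)
  have k: "2 * half a b c = k" "2 * half a' b' c' = k" using f f' by (simp_all add: k_def)
  have kpos: "k > 0" using k(1) by (simp add: half_def flip: k(1))
  obtain r where r: "r < k" "form_word t' = rotate r (form_word t)"
    using form_class_rotation [OF f(1) f'(1) eq] unfolding k by blast
  obtain p' where p': "p' \<in> paired a' b' c'" "(p' + r) mod k \<in> paired a b c"
    "(pairing a' b' c' p' + r) mod k = pairing a b c ((p' + r) mod k)"
    using d f f' r unfolding disagreeing_def k_def by blast
  obtain n\<^sub>1 a1 b1 c1 p1 r1 where 1: "(rot ^^ n\<^sub>1) t \<in> forms i a1 b1 c1" "p1 < a1" "half a1 b1 c1 = half a b c"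
    "form_word ((rot ^^ n\<^sub>1) t) = rotate r1 (form_word t)" "(p1 + r1) mod k = (p' + r) mod k"
    "(pairing a1 b1 c1 p1 + r1) mod k = pairing a b c ((p' + r) mod k)"
    using move_to_first_piece [OF f(1) p'(2)] unfolding k by blast
  obtain n\<^sub>2 a2 b2 c2 p2 r2 where 2: "(rot ^^ n\<^sub>2) t' \<in> forms i' a2 b2 c2" "p2 < a2" "half a2 b2 c2 = half a' b' c'"
    "form_word ((rot ^^ n\<^sub>2) t') = rotate r2 (form_word t')" "(p2 + r2) mod k = p'"
    "(pairing a2 b2 c2 p2 + r2) mod k = pairing a' b' c' p'"
    using move_to_first_piece [OF f'(1) p'(1)] unfolding k by blast
  define s1 where "s1 = k - r1 mod k"
  have s1: "(r1 + s1) mod k = 0"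
  proof -
    have "(r1 + s1) mod k = (r1 mod k + s1) mod k" by (simp add: mod_add_left_eq)
    also have "r1 mod k + s1 = k" using kpos mod_less_divisor [OF kpos, of r1] by (simp add: s1_def)
    finally show ?thesis by simp
  qed
  have len: "length (form_word t) = k" using form_word_props(3) [OF f(1)] k by simp
  have move: "(y + (r2 + r + s1)) mod k = x" if "(y + r2) mod k = z" "(z + r) mod k = (x + r1) mod k" "x < k" for x y z
  proof -
    have "(y + (r2 + r + s1)) mod k = ((y + r2) mod k + r + s1) mod k"
      by (metis add.assoc mod_add_left_eq)
    also have "\<dots> = ((x + r1) mod k + s1) mod k"
      unfolding that(1) by (metis mod_add_left_eq that(2))
    also have "\<dots> = (x + (r1 + s1) mod k) mod k" by (metis add.assoc mod_add_left_eq mod_add_right_eq)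
    finally show ?thesis using s1 that(3) by simp
  qed
  have k1: "2 * half a1 b1 c1 = k" "2 * half a2 b2 c2 = k" using 1(3) 2(3) k by simp_all
  have "p1 < k" using 1(2) k1 by (simp add: half_def)
  have "pairing a1 b1 c1 p1 < k"
    using 1(2) pairing_value(1) [of 0 a1 a1 b1 c1 p1 "a1 - 1 - p1"] k1(1) unfolding half_def by simp
  have w: "form_word ((rot ^^ n\<^sub>2) t') = rotate (r2 + r + s1) (form_word ((rot ^^ n\<^sub>1) t))"
  proof -
    have "rotate (r2 + r + s1) (form_word ((rot ^^ n\<^sub>1) t)) = rotate (r2 + r + (r1 + s1)) (form_word t)"
      unfolding 1(4) by (simp add: rotate_rotate add_ac)
    also have "\<dots> = rotate (r2 + r) (rotate ((r1 + s1) mod k) (form_word t))"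
      using rotate_conv_mod [of "r1 + s1" "form_word t"] len by (simp add: rotate_rotate [symmetric])
    also have "\<dots> = form_word ((rot ^^ n\<^sub>2) t')" using s1 2(4) r(2) by (simp add: rotate_rotate)
    finally show ?thesis by simp
  qed
  have m1: "(p2 + (r2 + r + s1)) mod (2 * half a1 b1 c1) = p1"
    unfolding k1 by (rule move [OF 2(5) 1(5) [symmetric] \<open>p1 < k\<close>])
  have m2: "(pairing a2 b2 c2 p2 + (r2 + r + s1)) mod (2 * half a1 b1 c1) = pairing a1 b1 c1 p1"
    unfolding k1 using move [OF 2(6) _ \<open>pairing a1 b1 c1 p1 < k\<close>] p'(3) 1(6) by simp
  have a: "a1 = a2" and weq: "form_word ((rot ^^ n\<^sub>2) t') = form_word ((rot ^^ n\<^sub>1) t)"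
    using common_piece [OF 1(1) 2(1) w 1(2) 2(2) m1 m2] by simp_all
  have "b1 = b2"
  proof (rule ccontr)
    assume "b1 \<noteq> b2"
    then have "(rot ^^ n\<^sub>1) t \<in> sharing_piece K"
      using 1(1) 1(3) [unfolded f(2)] 2(1) weq unfolding sharing_piece_def a by blast
    then show False using s by blast
  qed
  then have "(rot ^^ n\<^sub>2) t' = (rot ^^ n\<^sub>1) t"
    using form_unique [of "(rot ^^ n\<^sub>2) t'" i' a2 b2 c2 "(rot ^^ n\<^sub>1) t" i c1] 1(1) 2(1) a weq by simp
  \<comment> \<open>Since \<open>rot\<close> has order dividing 6, five times the number of
    rotations undoes them.\<close>
  then have "(rot ^^ (5 * n\<^sub>2 + n\<^sub>2)) t' = (rot ^^ (5 * n\<^sub>2 + n\<^sub>1)) t" by (simp only: funpow_add comp_apply)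
  moreover have "5 * n\<^sub>2 + n\<^sub>2 = 6 * n\<^sub>2" by simp
  ultimately have "t' = (rot ^^ (5 * n\<^sub>2 + n\<^sub>1)) t" by (simp only: rot_all_forms(3) [OF t'])
  then show ?thesis ..
qed

lemma rotations_mod:
  assumes "t \<in> all_forms K"
  shows "(rot ^^ n) t = (rot ^^ (n mod 6)) t"
proof -
  have "(rot ^^ n) t = (rot ^^ (n mod 6)) ((rot ^^ (6 * (n div 6))) t)"
    using funpow_add [of "n mod 6" "6 * (n div 6)" rot] by (simp add: mod_mult_div_eq)
  then show ?thesis by (simp only: rot_all_forms(3) [OF assms])
qed

text \<open>Outside \<open>B\<close> the forms of a class are among the six rotations of one of
  them. A conflict of second pieces may show up in any of the six rotations, so all rotations of
  \<open>sharing_piece K\<close> are discarded, which turns 4 into 24.\<close>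

theorem card_all_forms_le:
  "card (all_forms K) \<le> card (form_class ` all_forms K) * 6 + (2 * 60 ^ 5 + 24 * K * 60 ^ 5) * Q ^ (K + 8)"
proof -
  define B where "B = {t \<in> all_forms K. t \<in> disagreeing K \<or> (\<exists>n. (rot ^^ n) t \<in> sharing_piece K)}"
  have "card (all_forms K) \<le> card (form_class ` all_forms K) * 6 + card B"
  proof (rule card_le_fibres [OF finite_all_forms])
    fix t assume t: "t \<in> all_forms K - B"
    have "{y \<in> all_forms K. form_class y = form_class t} \<subseteq> (\<lambda>n. (rot ^^ n) t) ` {..<6}"
    proof
      fix y assume y: "y \<in> {y \<in> all_forms K. form_class y = form_class t}"
      then obtain n where "y = (rot ^^ n) t" using same_class_rotations [of t K y] t unfolding B_def by blast
      then have "y = (rot ^^ (n mod 6)) t" using rotations_mod [of t K n] t by simp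
      then show "y \<in> (\<lambda>n. (rot ^^ n) t) ` {..<6}" by auto
    qed
    from card_mono [OF _ this] card_image_le [of "{..<6}" "\<lambda>n. (rot ^^ n) t"]
    show "card {y \<in> all_forms K. form_class y = form_class t} \<le> 6" by simp
  qed (auto simp: B_def)
  moreover have "card B \<le> card (disagreeing K) + card (sharing_piece K) * 6"
  proof -
    have sub: "disagreeing K \<subseteq> all_forms K" "sharing_piece K \<subseteq> all_forms K"
      unfolding disagreeing_def sharing_piece_def all_forms_def by blast+
    then have fin: "finite (disagreeing K)" "finite (sharing_piece K)"
      using finite_all_forms finite_subset by blast+
    have "B \<subseteq> disagreeing K \<union> (\<Union>m\<in>{..<6}. (rot ^^ m) ` sharing_piece K)"
    proof
      fix t assume t: "t \<in> B"
      show "t \<in> disagreeing K \<union> (\<Union>m\<in>{..<6}. (rot ^^ m) ` sharing_piece K)"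
      proof (cases "t \<in> disagreeing K")
        case False
        then obtain n where n: "(rot ^^ n) t \<in> sharing_piece K" and ta: "t \<in> all_forms K" using t by (auto simp: B_def)
        have "5 * n + n = 6 * n" by simp
        then have "t = (rot ^^ (5 * n + n)) t" by (simp only: rot_all_forms(3) [OF ta])
        also have "\<dots> = (rot ^^ (5 * n)) ((rot ^^ n) t)" by (simp only: funpow_add comp_apply)
        also have "\<dots> = (rot ^^ ((5 * n) mod 6)) ((rot ^^ n) t)"
          by (rule rotations_mod [OF rot_all_forms(1) [OF ta]])
        finally have "t \<in> (rot ^^ ((5 * n) mod 6)) ` sharing_piece K" using n by blast
        then show ?thesis by auto
      qed simp
    qed
    then have "card B \<le> card (disagreeing K \<union> (\<Union>m\<in>{..<6}. (rot ^^ m) ` sharing_piece K))"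
      using fin by (intro card_mono) auto
    also have "\<dots> \<le> card (disagreeing K) + card (\<Union>m\<in>{..<6}. (rot ^^ m) ` sharing_piece K)" by (rule card_Un_le)
    also have "card (\<Union>m\<in>{..<6}. (rot ^^ m) ` sharing_piece K) \<le> 6 * card (sharing_piece K)"
      using fin by (intro card_UN_bound card_image_le) auto
    finally show ?thesis by simp
  qed
  moreover have "card (disagreeing K) + card (sharing_piece K) * 6 \<le> (2 * 60 ^ 5 + 24 * K * 60 ^ 5) * Q ^ (K + 8)"
  proof -
    have "card (disagreeing K) + card (sharing_piece K) * 6 \<le>
        2 * 60 ^ 5 * Q ^ (K + 8) + 4 * K * (60 ^ 5 * Q ^ (K + 8)) * 6"
      by (intro add_mono mult_right_mono card_disagreeing card_sharing_piece) simp
    also have "\<dots> = (2 * 60 ^ 5 + 24 * K * 60 ^ 5) * Q ^ (K + 8)" by (simp only: algebra_simps)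
    finally show ?thesis .
  qed
  ultimately show ?thesis by linarith
qed

end

section \<open>Upper bounds\<close>

context two_finite_groups
begin

text \<open>A period above \<open>2 * K\<close> is replaced by its complement
  \<open>4 * K - d\<close>. The first half of the word then determines the rest, and there are
  \<open>Q ^ K\<close> first halves for a given initial factor.\<close>

lemma card_periodic_words: "card {w. \<exists>i d. w \<in> words_of i (4 * K) \<and> 0 < d \<and> d < 4 * K \<and> rotate d w = w} \<le> 4 * K * Q ^ K"
  "finite {w. \<exists>i d. w \<in> words_of i (4 * K) \<and> 0 < d \<and> d < 4 * K \<and> rotate d w = w}"
proof -
  let ?P = "{w. \<exists>i d. w \<in> words_of i (4 * K) \<and> 0 < d \<and> d < 4 * K \<and> rotate d w = w}"
  define B where "B = (\<lambda>(i, d). {w \<in> words_of i (4 * K). rotate d w = w})"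
  define I where "I = (UNIV :: bool set) \<times> {1..2 * K}"
  have len: "length w = 4 * K" if "w \<in> words_of i (4 * K)" for i w using that by (simp add: words_of_def)
  have sub: "?P \<subseteq> (\<Union>x\<in>I. B x)"
  proof
    fix w assume "w \<in> ?P"
    then obtain i d where w: "w \<in> words_of i (4 * K)" "0 < d" "d < 4 * K" "rotate d w = w" by blast
    have "rotate (4 * K - d) w = rotate (4 * K - d) (rotate d w)" using w(4) by simp
    also have "\<dots> = w" using w(3) len [OF w(1)] by (simp add: rotate_rotate)
    finally have "w \<in> B (i, 4 * K - d)" using w(1) by (simp add: B_def)
    moreover have "w \<in> B (i, d)" using w by (simp add: B_def)
    moreover have "(i, d) \<in> I \<or> (i, 4 * K - d) \<in> I" using w(2,3) by (auto simp: I_def)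
    ultimately show "w \<in> (\<Union>x\<in>I. B x)" by blast
  qed
  have fin: "finite (\<Union>x\<in>I. B x)" using card_words_of(1) by (auto simp: I_def B_def)
  show "finite ?P" by (rule finite_subset [OF sub fin])
  have "card ?P \<le> card (\<Union>x\<in>I. B x)" by (rule card_mono [OF fin sub])
  also have "\<dots> \<le> 4 * K * Q ^ K"
  proof (rule card_UN_bound)
    show "finite I" "card I \<le> 4 * K" by (simp_all add: I_def card_cartesian_product)
    fix x assume "x \<in> I"
    then obtain i d where x: "x = (i, d)" "1 \<le> d" "d \<le> 2 * K" by (auto simp: I_def)
    have step: "w ! p = w ! (p - d)" if "w \<in> B x" "d \<le> p" "p < 4 * K" for w p
    proof -
      have w: "length w = 4 * K" "rotate d w = w" using that len by (auto simp: B_def x)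
      have "w ! (p - d) = rotate d w ! (p - d)" using w by simp
      also have "\<dots> = w ! ((d + (p - d)) mod length w)" using that w(1) x(2) by (intro nth_rotate) simp
      finally show ?thesis using that w(1) by simp
    qed
    have "inj_on (take (2 * K)) (B x)"
    proof (rule inj_onI)
      fix v w assume vw: "v \<in> B x" "w \<in> B x" "take (2 * K) v = take (2 * K) w"
      show "v = w"
      proof (rule nth_equalityI)
        have l: "length v = 4 * K" "length w = 4 * K" using vw len by (auto simp: B_def x)
        then show "length v = length w" by simp
        fix p assume "p < length v"
        then have "p < 4 * K" using l by simp
        then show "v ! p = w ! p"
        proof (induction p rule: less_induct)
          case (less p)
          show ?case
          proof (cases "p < 2 * K")
            case True
            then show ?thesis using vw(3) by (metis nth_take)
          next
            case False
            then have "v ! (p - d) = w ! (p - d)" using less x by simp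
            then show ?thesis using step [OF vw(1)] step [OF vw(2)] False less.prems x(3) by simp
          qed
        qed
      qed
    qed
    moreover have "take (2 * K) ` B x \<subseteq> words_of i (2 * K)"
    proof
      fix u assume "u \<in> take (2 * K) ` B x"
      then obtain w where w: "u = take (2 * K) w" "w \<in> words_of i (4 * K)" by (auto simp: B_def x)
      have "take (2 * K) w @ drop (2 * K) w \<in> W" using w(2) by (simp add: words_of_def)
      then have "u \<in> W" unfolding w(1) words_append by blast
      then show "u \<in> words_of i (2 * K)" using w x by (auto simp: words_of_def)
    qed
    ultimately have "card (B x) \<le> card (words_of i (2 * K))" using card_words_of(1) by (intro card_inj_on_le)
    then show "card (B x) \<le> Q ^ K" using Q_eq [of i] by (simp add: card_words_of(2) flip: power_mult_distrib)
  qed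
  finally show "card ?P \<le> 4 * K * Q ^ K" .
qed

text \<open>The amount by which \<open>n\<close> applications of \<open>rot\<close> rotate the word
  of a form of shape \<open>(a, b, c)\<close>. It grows strictly and reaches the full length at
  \<open>n = 6\<close>, so two coinciding rotations of a form yield a proper period of its
  word.\<close>

fun offset :: "nat \<Rightarrow> nat \<Rightarrow> nat \<Rightarrow> nat \<Rightarrow> nat" where
  "offset a b c 0 = 0"
| "offset a b c (Suc n) = (a + 1) + offset b c a n"

lemma offset_less_Suc: "offset a b c n < offset a b c (Suc n)"
  by (induction n arbitrary: a b c) simp_all

lemma offset_less: "n < m \<Longrightarrow> offset a b c n < offset a b c m"
  using lift_Suc_mono_less [of "offset a b c"] offset_less_Suc by blast

lemma offset_6: "offset a b c 6 = 2 * half a b c"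
  by (simp add: eval_nat_numeral half_def)

lemma form_word_rot_power:
  "t \<in> forms i a b c \<Longrightarrow> form_word ((rot ^^ n) t) = rotate (offset a b c n) (form_word t)"
proof (induction n arbitrary: t a b c)
  case (Suc n)
  have "form_word ((rot ^^ Suc n) t) = form_word ((rot ^^ n) (rot t))" by (simp only: funpow_Suc_right comp_apply)
  also have "\<dots> = rotate (offset b c a n) (rotate (a + 1) (form_word t))"
    unfolding Suc.IH [OF rot_forms(1) [OF Suc.prems]] rot_forms(2) [OF Suc.prems] ..
  finally show ?case by (simp only: rotate_rotate offset.simps add.commute)
qed simp

lemma rotations_distinct:
  assumes t: "t \<in> forms i a b c" and nm: "n < m" "m < 6" and eq: "(rot ^^ n) t = (rot ^^ m) t"
  shows "\<exists>d. 0 < d \<and> d < 2 * half a b c \<and> rotate d (form_word t) = form_word t"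
proof -
  define k where "k = 2 * half a b c"
  let ?o = "offset a b c"
  have o: "?o n < ?o m" "?o m < k" using offset_less nm offset_6 [of a b c] unfolding k_def by metis+
  have len: "length (form_word t) = k" using form_word_props(3) [OF t] by (simp add: k_def)
  have "rotate (k - ?o n) (rotate (?o n) (form_word t)) = rotate (k - ?o n) (rotate (?o m) (form_word t))"
    using form_word_rot_power [OF t, of n] form_word_rot_power [OF t, of m] eq by simp
  then have "rotate ((k - ?o n) + ?o n) (form_word t) = rotate ((k - ?o n) + ?o m) (form_word t)"
    by (simp only: rotate_rotate)
  moreover have "(k - ?o n) + ?o n = k" "(k - ?o n) + ?o m = (?o m - ?o n) + k" using o by simp_all
  ultimately have "rotate k (form_word t) = rotate ((?o m - ?o n) + k) (form_word t)" by simp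
  moreover have "((?o m - ?o n) + k) mod k = ?o m - ?o n" using o by (simp only: mod_add_self2) simp
  ultimately have "rotate (?o m - ?o n) (form_word t) = form_word t"
    using rotate_conv_mod [of k "form_word t"] rotate_conv_mod [of "(?o m - ?o n) + k" "form_word t"]
    unfolding len by simp
  then show ?thesis using o unfolding k_def by (intro exI [of _ "?o m - ?o n"]) auto
qed

text \<open>Forms with an aperiodic word have six distinct rotations in their class. The fibres of
  the others may be smaller, so their classes are bounded by the number of periodic words
  instead.\<close>

theorem card_form_classes_le:
  "card (form_class ` all_forms K) * 6 \<le> card (all_forms K) + 24 * K * Q ^ K"
proof -
  let ?P = "{w. \<exists>i d. w \<in> words_of i (4 * K) \<and> 0 < d \<and> d < 4 * K \<and> rotate d w = w}"
  define B where "B = {t \<in> all_forms K. form_word t \<in> ?P}"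
  have fibre: "6 \<le> card {y \<in> all_forms K. form_class y = form_class t}" if t: "t \<in> all_forms K - B" for t
  proof -
    obtain i a b c where f: "t \<in> forms i a b c" "half a b c = 2 * K" using t unfolding all_forms_def by blast
    have w: "form_word t \<in> words_of (\<not> i) (4 * K)" using forms_words_of [OF f(1)] f(2) by simp
    have ne: "(rot ^^ n) t \<noteq> (rot ^^ m) t" if "n < m" "m < 6" for n m
    proof
      assume "(rot ^^ n) t = (rot ^^ m) t"
      from rotations_distinct [OF f(1) that this] have "form_word t \<in> ?P" using w f(2) by auto
      then show False using t by (simp add: B_def)
    qed
    have "inj_on (\<lambda>n. (rot ^^ n) t) {..<6}"
      by (rule linorder_inj_onI) (use ne in auto)
    then have "6 = card ((\<lambda>n. (rot ^^ n) t) ` {..<6})" by (simp add: card_image)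
    also have "\<dots> \<le> card {y \<in> all_forms K. form_class y = form_class t}"
      using rot_all_forms(1,2) [of t K] t finite_all_forms by (intro card_mono) auto
    finally show ?thesis .
  qed
  have 1: "card (form_class ` (all_forms K - B)) * 6 \<le> card (all_forms K)"
    by (rule fibres_le_card [OF finite_all_forms fibre])
  have finB: "finite B" by (simp add: B_def finite_all_forms)
  have "form_class ` B = conjugacy_class F ` form_word ` B" by (simp add: image_image form_class_def)
  then have "card (form_class ` B) \<le> card (form_word ` B)" using finB by (simp add: card_image_le)
  also have "\<dots> \<le> card ?P" by (rule card_mono [OF card_periodic_words(2)]) (auto simp: B_def)
  finally have 2: "card (form_class ` B) \<le> 4 * K * Q ^ K" using card_periodic_words(1) [of K] by linarith
  have "form_class ` all_forms K = form_class ` (all_forms K - B) \<union> form_class ` B" by (auto simp: B_def)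
  then have "card (form_class ` all_forms K) \<le> card (form_class ` (all_forms K - B)) + card (form_class ` B)"
    by (simp add: card_Un_le)
  then show ?thesis using 1 2 by linarith
qed

section \<open>Classes of degenerate representatives\<close>

definition N :: nat where "N = order G * order H"

lemma q_N: "q True + 1 = order G" "q False + 1 = order H" "q True + q False + 2 \<le> N" "q i \<le> N" "Q \<le> N" "N > 0"
proof -
  have pos: "order G > 0" "order H > 0" using finite_G finite_H G.one_closed H.one_closed
    by (auto simp: order_def card_gt_0_iff)
  then show o: "q True + 1 = order G" "q False + 1 = order H" by (simp_all add: q_eq)
  have N: "N = Q + q True + q False + 1" by (simp add: N_def Q_def algebra_simps flip: o)
  then show "q True + q False + 2 \<le> N" "Q \<le> N" "N > 0" using Q_pos by simp_all
  show "q i \<le> N" using N by (cases i) simp_all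
qed

lemma card_words_of_le: "card (words_of i l) \<le> N * Q ^ (l div 2)"
proof -
  have "q i ^ ((l + 1) div 2) \<le> q i ^ Suc (l div 2)" using q_pos by (intro power_increasing) (auto simp: Suc_le_eq)
  then have "card (words_of i l) \<le> q i ^ Suc (l div 2) * q (\<not> i) ^ (l div 2)"
    unfolding card_words_of(2) by (rule mult_right_mono) simp
  also have "\<dots> = q i * Q ^ (l div 2)" by (simp add: power_mult_distrib flip: Q_eq [of i])
  also have "\<dots> \<le> N * Q ^ (l div 2)" using q_N(4) by (intro mult_right_mono) simp_all
  finally show ?thesis .
qed

lemma card_factors: "finite (factor True \<union> factor False)" "card (factor True \<union> factor False) \<le> N"
proof -
  have sub: "factor True \<union> factor False \<subseteq> insert [] ((\<lambda>x. [x]) ` (letters True \<union> letters False))"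
    by (auto simp: factor_def letters_def letter_word)
  then show "finite (factor True \<union> factor False)" by (rule finite_subset) simp
  have "card (factor True \<union> factor False) \<le> card (insert [] ((\<lambda>x. [x]) ` (letters True \<union> letters False)))"
    by (rule card_mono [OF _ sub]) simp
  also have "\<dots> \<le> Suc (card ((\<lambda>x. [x]) ` (letters True \<union> letters False)))" by (rule card_insert_le_m1) simp_all
  also have "\<dots> \<le> Suc (card (letters True \<union> letters False))" by (simp add: card_image_le)
  also have "\<dots> \<le> Suc (q True + q False)" using card_Un_le by (simp add: q_def)
  also have "\<dots> \<le> N" using q_N(3) by simp
  finally show "card (factor True \<union> factor False) \<le> N" .
qed

definition degenerate_classes :: "nat \<Rightarrow> ('a + 'b) list set set" where
  "degenerate_classes K = {C \<in> conjugacy_classes F. \<exists>i j Y Z a1 a2 b1 b2. rep C i j [] Y Z a1 a2 b1 b2 \<and>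
     2 * (length Y + length Z) \<le> 4 * K \<and> 4 * K \<le> 2 * (length Y + length Z) + 6}"

lemma class_of_element:
  assumes "C \<in> conjugacy_classes F" "w \<in> C"
  shows "C = conjugacy_class F w"
  using assms class_eqI unfolding conjugacy_classes_def carrier_F by blast

text \<open>\<open>Y\<close> and \<open>Z\<close> together have between \<open>2 * K - 3\<close> and
  \<open>2 * K\<close> letters, about \<open>Q ^ K\<close> choices once one length and the deficit
  \<open>e\<close> are fixed. \<open>N ^ 2\<close> pays for odd lengths, \<open>N ^ 4\<close> for
  the four free entries, and 16 for both factor choices and the four values of
  \<open>e\<close>.\<close>

lemma card_degenerate_classes:
  "finite (degenerate_classes K)" "card (degenerate_classes K) \<le> 16 * (2 * K + 1) * N ^ 6 * Q ^ K"
proof -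
  define A where "A = factor True \<union> factor False"
  define B where "B = (\<lambda>(i, j, l, e). words_of i l \<times> words_of j (2 * K - l - e))"
  define I where "I = (UNIV :: bool set) \<times> (UNIV :: bool set) \<times> {..2 * K} \<times> {..<4 :: nat}"
  define J where "J = (\<Union>x\<in>{x \<in> I. fst (snd (snd x)) + snd (snd (snd x)) \<le> 2 * K}. B x)"
  define h where "h = (\<lambda>((Y, Z), a1, a2, b1, b2). conjugacy_class F (F.wicks [] Y Z a1 a2 b1 b2))"
  have finI: "finite I" by (simp add: I_def)
  have finB: "finite (B x)" for x using card_words_of(1) by (cases x) (simp add: B_def)
  have finJ: "finite J" unfolding J_def using finI finB by simp
  have finA: "finite A" unfolding A_def by (rule card_factors(1))
  have sub: "degenerate_classes K \<subseteq> h ` (J \<times> A \<times> A \<times> A \<times> A)"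
  proof
    fix C assume C: "C \<in> degenerate_classes K"
    then obtain i j Y Z a1 a2 b1 b2 where r: "rep C i j [] Y Z a1 a2 b1 b2"
      and le: "2 * (length Y + length Z) \<le> 4 * K" "4 * K \<le> 2 * (length Y + length Z) + 6"
      and C: "C \<in> conjugacy_classes F"
      unfolding degenerate_classes_def by blast
    have "C = h ((Y, Z), a1, a2, b1, b2)"
      using class_of_element [OF C] r unfolding h_def rep_def by simp
    moreover have "{a1, a2, b1, b2} \<subseteq> A"
    proof -
      have "factor i' \<subseteq> A" for i' by (cases i') (auto simp: A_def)
      then show ?thesis using r unfolding rep_def by blast
    qed
    moreover have "(Y, Z) \<in> J"
    proof -
      define e where "e = 2 * K - length Y - length Z"
      have e: "length Z = 2 * K - length Y - e" "e < 4" "length Y + e \<le> 2 * K" "length Y \<le> 2 * K" using le by (simp_all add: e_def)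
      \<comment> \<open>For an empty piece \<open>hd\<close> is arbitrary; this is harmless because
        \<open>words_of\<close> constrains the first letter of nonempty words only.\<close>
      have "Y \<in> words_of (isl (hd Y)) (length Y)" "Z \<in> words_of (isl (hd Z)) (length Z)"
        using r by (simp_all add: rep_def words_of_def)
      then have "(Y, Z) \<in> B (isl (hd Y), isl (hd Z), length Y, e)" using e(1) by (simp add: B_def)
      then show ?thesis unfolding J_def using e by (intro UN_I [of "(isl (hd Y), isl (hd Z), length Y, e)"]) (simp_all add: I_def)
    qed
    ultimately show "C \<in> h ` (J \<times> A \<times> A \<times> A \<times> A)" by blast
  qed
  have fin: "finite (J \<times> A \<times> A \<times> A \<times> A)" using finJ finA by simp
  then show "finite (degenerate_classes K)" using sub finite_surj by blast
  have "card (degenerate_classes K) \<le> card (J \<times> A \<times> A \<times> A \<times> A)" by (rule surj_card_le [OF fin sub])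
  also have "\<dots> = card J * card A ^ 4" by (simp add: card_cartesian_product eval_nat_numeral)
  also have "\<dots> \<le> (16 * (2 * K + 1) * (N ^ 2 * Q ^ K)) * N ^ 4"
  proof (intro mult_mono power_mono)
    show "card J \<le> 16 * (2 * K + 1) * (N ^ 2 * Q ^ K)"
      unfolding J_def
    proof (rule card_UN_bound)
      have "card {x \<in> I. fst (snd (snd x)) + snd (snd (snd x)) \<le> 2 * K} \<le> card I"
        by (rule card_mono [OF finI]) auto
      also have "\<dots> = 16 * (2 * K + 1)" by (simp add: I_def card_cartesian_product)
      finally show "card {x \<in> I. fst (snd (snd x)) + snd (snd (snd x)) \<le> 2 * K} \<le> 16 * (2 * K + 1)" .
      fix x assume x: "x \<in> {x \<in> I. fst (snd (snd x)) + snd (snd (snd x)) \<le> 2 * K}"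
      obtain i j l e where xe: "x = (i, j, l, e)" by (cases x) auto
      have "card (B x) = card (words_of i l) * card (words_of j (2 * K - l - e))"
        by (simp add: B_def xe card_cartesian_product)
      also have "\<dots> \<le> (N * Q ^ (l div 2)) * (N * Q ^ ((2 * K - l - e) div 2))"
        by (intro mult_mono card_words_of_le) simp_all
      also have "\<dots> = N ^ 2 * Q ^ (l div 2 + (2 * K - l - e) div 2)" by (simp add: power_add power2_eq_square)
      also have "\<dots> \<le> N ^ 2 * Q ^ K"
      proof (intro mult_left_mono power_increasing)
        have "l + e \<le> 2 * K" using x by (simp add: xe)
        then show "l div 2 + (2 * K - l - e) div 2 \<le> K" by linarith
      qed (use Q_pos in simp_all)
      finally show "card (B x) \<le> N ^ 2 * Q ^ K" .
    qed (use finI in simp)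
    show "card A \<le> N" unfolding A_def by (rule card_factors(2))
  qed simp_all
  also have "\<dots> = 16 * (2 * K + 1) * (N ^ 2 * N ^ 4) * Q ^ K" by (simp only: mult_ac)
  also have "N ^ 2 * N ^ 4 = N ^ 6" by (simp flip: power_add)
  finally show "card (degenerate_classes K) \<le> 16 * (2 * K + 1) * N ^ 6 * Q ^ K" .
qed

section \<open>Commutator classes as classes of forms\<close>

lemma class_subset_commutators:
  assumes "w \<in> derived_set F (carrier F)"
  shows "conjugacy_class F w \<subseteq> derived_set F (carrier F)"
proof
  fix v assume "v \<in> conjugacy_class F w"
  then obtain g where g: "g \<in> W" "v = g \<cdot> w \<cdot> inv\<^bsub>F\<^esub> g" by (auto simp: conjugacy_class_def)
  obtain x y where xy: "x \<in> W" "y \<in> W" "w = x \<cdot> y \<cdot> inv\<^bsub>F\<^esub> x \<cdot> inv\<^bsub>F\<^esub> y" using assms by auto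
  let ?x = "g \<cdot> x \<cdot> inv\<^bsub>F\<^esub> g" and ?y = "g \<cdot> y \<cdot> inv\<^bsub>F\<^esub> g"
  have "v = ?x \<cdot> ?y \<cdot> inv\<^bsub>F\<^esub> ?x \<cdot> inv\<^bsub>F\<^esub> ?y"
    using g xy by (simp add: F.free_group_simps)
  moreover have "?x \<in> W" "?y \<in> W" using g xy by simp_all
  ultimately show "v \<in> derived_set F (carrier F)" unfolding carrier_F by blast
qed

theorem commutator_classes_eq:
  assumes K: "K > 0"
  shows "form_class ` all_forms K \<subseteq> commutator_classes F (fp_gens G H) (4 * K)"
    "commutator_classes F (fp_gens G H) (4 * K) \<subseteq> form_class ` all_forms K \<union> degenerate_classes K"
proof -
  show "form_class ` all_forms K \<subseteq> commutator_classes F (fp_gens G H) (4 * K)"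
  proof
    fix C assume "C \<in> form_class ` all_forms K"
    then obtain i a b c t where t: "t \<in> forms i a b c" "half a b c = 2 * K" "C = conjugacy_class F (form_word t)"
      unfolding all_forms_def form_class_def by blast
    note p = form_word_props(1-3) [OF t(1)]
    have C: "C \<in> conjugacy_classes F" using p(2) by (simp add: t(3) conjugacy_classes_def)
    moreover have "C \<subseteq> derived_set F (carrier F)"
      unfolding t(3) by (rule class_subset_commutators [OF form_word_commutator [OF t(1)]])
    moreover have "class_length F (fp_gens G H) C = 4 * K"
      using class_lengthI [OF C _ p(1)] self_in_class [OF p(2)] p(3) t(2,3) by simp
    ultimately show "C \<in> commutator_classes F (fp_gens G H) (4 * K)" unfolding commutator_classes_def by blast
  qed
  show "commutator_classes F (fp_gens G H) (4 * K) \<subseteq> form_class ` all_forms K \<union> degenerate_classes K"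
  proof
    fix C assume "C \<in> commutator_classes F (fp_gens G H) (4 * K)"
    then have C: "C \<in> conjugacy_classes F" "C \<subseteq> derived_set F (carrier F)" "class_length F (fp_gens G H) C = 4 * K"
      by (auto simp: commutator_classes_def)
    have "0 < 4 * K" "4 dvd 4 * K" using K by simp_all
    from C this show "C \<in> form_class ` all_forms K \<union> degenerate_classes K"
    proof (cases rule: commutator_class_cases)
      case (generic i X Y Z a1 a2 b1 b2)
      let ?t = "(X, Y, Z, a1, a2, b1, b2)"
      have t: "?t \<in> forms i (length X) (length Y) (length Z)" using generic(1) by (simp add: forms_def)
      have w: "form_word ?t \<in> C" using generic(2) by (simp add: form_word_def)
      have "2 * half (length X) (length Y) (length Z) = 4 * K"
        using class_lengthI [OF C(1) w form_word_props(1) [OF t]] form_word_props(3) [OF t] C(3) by simp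
      then have "?t \<in> all_forms K" using t unfolding all_forms_def by auto
      moreover have "C = form_class ?t" unfolding form_class_def by (rule class_of_element [OF C(1) w])
      ultimately show ?thesis by blast
    next
      case (degenerate i j Y Z a1 a2 b1 b2)
      then show ?thesis using C(1) unfolding degenerate_classes_def by blast
    qed
  qed
qed

section \<open>Counting generic forms\<close>

definition letter_pairs :: "bool \<Rightarrow> (('a + 'b) list \<times> ('a + 'b) list) set" where
  "letter_pairs i = {(u, v). {u, v} \<subseteq> factor i - {[]} \<and> inv\<^bsub>F\<^esub> u \<cdot> inv\<^bsub>F\<^esub> v \<noteq> []}"

lemma card_letter_pairs: "card (letter_pairs i) = q i * (q i - 1)"
proof -
  have inv: "inv\<^bsub>F\<^esub> [x] \<cdot> inv\<^bsub>F\<^esub> [y] = [] \<longleftrightarrow> y = linv x" if "x \<in> letters i" "y \<in> letters i" for x y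
  proof -
    have l: "x \<in> fp_letters G H" "y \<in> fp_letters G H" and e: "isl (linv x) = isl (linv y)"
      using that by (simp_all add: letters_def)
    have "inv\<^bsub>F\<^esub> [x] \<cdot> inv\<^bsub>F\<^esub> [y] = [linv x] \<cdot> [linv y]" using l by (simp add: inv_letter)
    moreover have "linv y = linv (linv x) \<longleftrightarrow> y = linv x"
      using linv_linv [OF l(2)] linv_linv [OF linv_closed [OF l(1)]] by metis
    ultimately show ?thesis
      using letter_mult [OF linv_closed [OF l(1)] linv_closed [OF l(2)] e] by (elim disjE conjE exE) simp_all
  qed
  have "letter_pairs i = (\<lambda>(x, y). ([x], [y])) ` (SIGMA x:letters i. letters i - {linv x})"
  proof (intro equalityI subsetI)
    fix s assume "s \<in> letter_pairs i"
    then obtain u v where s: "s = (u, v)" "u \<in> factor i" "u \<noteq> []" "v \<in> factor i" "v \<noteq> []" "inv\<^bsub>F\<^esub> u \<cdot> inv\<^bsub>F\<^esub> v \<noteq> []"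
      by (auto simp: letter_pairs_def)
    obtain x y where xy: "u = [x]" "v = [y]" "x \<in> letters i" "y \<in> letters i"
      using factor_nonempty [OF s(2,3)] factor_nonempty [OF s(4,5)] unfolding letters_def by blast
    then have "y \<noteq> linv x" using inv s(6) by blast
    then show "s \<in> (\<lambda>(x, y). ([x], [y])) ` (SIGMA x:letters i. letters i - {linv x})" using xy s(1) by auto
  next
    fix s assume "s \<in> (\<lambda>(x, y). ([x], [y])) ` (SIGMA x:letters i. letters i - {linv x})"
    then obtain x y where s: "s = ([x], [y])" "x \<in> letters i" "y \<in> letters i" "y \<noteq> linv x" by auto
    have "[x] \<in> factor i" "[y] \<in> factor i"
      using s(2,3) by (intro letter_factor; simp add: letters_def letter_word)+
    then show "s \<in> letter_pairs i" using inv s by (simp add: letter_pairs_def)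
  qed
  moreover have "inj_on (\<lambda>(x, y). ([x], [y])) (SIGMA x:letters i. letters i - {linv x})" by (auto simp: inj_on_def)
  moreover have "card (letters i - {linv x}) = q i - 1" if "x \<in> letters i" for x
    using that linv_closed by (simp add: q_def letters_def)
  ultimately show ?thesis by (simp add: card_image card_SigmaI q_def)
qed

text \<open>A word of odd length that begins in the factor \<open>\<not> i\<close> also ends there,
  so \<open>words_of\<close> describes the pieces exactly, and the pieces and the two pairs of
  entries are chosen independently.\<close>

lemma card_forms:
  assumes "odd a" "odd b" "odd c"
  shows "card (forms i a b c) = card (words_of (\<not> i) a) * card (words_of (\<not> i) b) * card (words_of (\<not> i) c) * (q i * (q i - 1))\<^sup>2"
proof -
  define h :: "('a + 'b) list \<times> ('a + 'b) list \<times> ('a + 'b) list \<times> (('a + 'b) list \<times> ('a + 'b) list) \<times> ('a + 'b) list \<times> ('a + 'b) list \<Rightarrow> ('a, 'b) form"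
    where "h = (\<lambda>(X, Y, Z, (a1, a2), (b1, b2)). (X, Y, Z, a1, a2, b1, b2))"
  have ends: "X \<in> words_of (\<not> i) n \<longleftrightarrow> X \<in> W - {[]} \<and> length X = n \<and> isl (hd X) = (\<not> i) \<and> isl (last X) = (\<not> i)"
    if "odd n" for X n
    using word_parity [of X] that by (cases "X = []") (auto simp: words_of_def odd_pos)
  have "forms i a b c = h ` (words_of (\<not> i) a \<times> words_of (\<not> i) b \<times> words_of (\<not> i) c \<times> letter_pairs i \<times> letter_pairs i)" (is "_ = h ` ?P")
  proof (intro equalityI subsetI)
    fix t assume t: "t \<in> forms i a b c"
    obtain X Y Z a1 a2 s where t1: "t = (X, Y, Z, a1, a2, s)" by (cases t) auto
    obtain b1 b2 where t2: "s = (b1, b2)" by (cases s)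
    have "(X, Y, Z, (a1, a2), (b1, b2)) \<in> ?P"
      using t unfolding t1 t2 forms_def generic_def letter_pairs_def by (simp add: ends assms)
    then show "t \<in> h ` ?P" unfolding t1 t2 by (intro image_eqI [of _ h "(X, Y, Z, (a1, a2), (b1, b2))"]) (simp_all add: h_def)
  next
    fix t assume "t \<in> h ` ?P"
    then obtain X Y Z a1 a2 b1 b2 where "t = (X, Y, Z, a1, a2, b1, b2)" "(X, Y, Z, (a1, a2), (b1, b2)) \<in> ?P"
      unfolding h_def by auto
    then show "t \<in> forms i a b c" unfolding forms_def generic_def letter_pairs_def by (simp add: ends assms)
  qed
  moreover have "inj_on h ?P" by (auto simp: inj_on_def h_def)
  ultimately show ?thesis
    by (simp add: card_image card_cartesian_product card_letter_pairs power2_eq_square)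
qed

lemma two_card_triangle: "2 * card {(a, b). a + b + 3 \<le> K} = (K - 1) * (K - 2)" for K :: nat
proof -
  have "{(a, b). a + b + 3 \<le> K} = (SIGMA a:{..<K - 2}. {..<K - 2 - a})" by auto
  then have c: "card {(a, b). a + b + 3 \<le> K} = (\<Sum>a<K - 2. K - 2 - a)" by simp
  have "2 * (\<Sum>a<M. M - a) = Suc M * M" for M :: nat
    by (induction M) (simp_all del: sum.lessThan_Suc add: sum.lessThan_Suc_shift)
  from this [of "K - 2"] have "2 * card {(a, b). a + b + 3 \<le> K} = Suc (K - 2) * (K - 2)" unfolding c .
  also have "\<dots> = (K - 1) * (K - 2)"
  proof (cases "K \<le> 2")
    case False
    then have "Suc (K - 2) = K - 1" by simp
    then show ?thesis by simp
  qed simp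
  finally show ?thesis .
qed

text \<open>The lengths are \<open>2 * a + 1\<close>, \<open>2 * b + 1\<close>,
  \<open>2 * c + 1\<close> with \<open>a + b + c = K - 3\<close>, and the number of forms depends on
  a shape only through this sum. Doubling avoids halving the number of triples.\<close>

lemma two_card_all_forms:
  "2 * card (all_forms K) = (K - 1) * (K - 2) * (q False * (q True - 1)\<^sup>2 + q True * (q False - 1)\<^sup>2) * Q ^ (K - 1)"
proof -
  define J where "J = {(a, b). a + b + 3 \<le> K}"
  define A where "A i = (\<lambda>(a, b). forms i (2 * a + 1) (2 * b + 1) (2 * (K - 3 - a - b) + 1))" for i
  have finJ: "finite J" by (rule finite_subset [of _ "{..K} \<times> {..K}"]) (auto simp: J_def)
  have eq: "all_forms K = (\<Union>i. \<Union>x\<in>J. A i x)"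
  proof (intro equalityI subsetI)
    fix t assume "t \<in> all_forms K"
    then obtain i a b c where t: "t \<in> forms i a b c" "half a b c = 2 * K" unfolding all_forms_def by blast
    obtain a' b' c' where o: "a = 2 * a' + 1" "b = 2 * b' + 1" "c = 2 * c' + 1"
      using form_word_props(5-7) [OF t(1)] by (metis oddE)
    then have "(a', b') \<in> J" "c' = K - 3 - a' - b'" using t(2) by (simp_all add: J_def half_def)
    then show "t \<in> (\<Union>i. \<Union>x\<in>J. A i x)" using t(1) unfolding o A_def by blast
  next
    fix t assume "t \<in> (\<Union>i. \<Union>x\<in>J. A i x)"
    then obtain i a b where "t \<in> A i (a, b)" "a + b + 3 \<le> K" by (auto simp: J_def)
    moreover from this have "half (2 * a + 1) (2 * b + 1) (2 * (K - 3 - a - b) + 1) = 2 * K" by (simp add: half_def)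
    ultimately show "t \<in> all_forms K" unfolding A_def all_forms_def prod.case by blast
  qed
  have disj: "A i x \<inter> A j y = {}" if "i \<noteq> j \<or> x \<noteq> y" for i j x y
  proof -
    have False if t: "t \<in> A i x" "t \<in> A j y" for t
    proof -
      obtain a b a' b' where xy: "x = (a, b)" "y = (a', b')" by (cases x, cases y)
      note t' = t [unfolded A_def xy prod.case]
      have "i = j" using form_word_props(4) [OF t'(1)] form_word_props(4) [OF t'(2)] by simp
      moreover have "length (fst t) = 2 * a + 1 \<and> length (fst (snd t)) = 2 * b + 1"
        "length (fst t) = 2 * a' + 1 \<and> length (fst (snd t)) = 2 * b' + 1"
        using t' unfolding forms_def by auto
      then have "x = y" by (simp add: xy)
      ultimately show False using \<open>i \<noteq> j \<or> x \<noteq> y\<close> by simp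
    qed
    then show ?thesis by blast
  qed
  have cA: "card (A i x) = (q (\<not> i) * (q i - 1)\<^sup>2) * Q ^ (K - 1)" if "x \<in> J" for i x
  proof -
    obtain a b where x: "x = (a, b)" "a + b + 3 \<le> K" using \<open>x \<in> J\<close> by (auto simp: J_def)
    define c where "c = K - 3 - a - b"
    have K: "K = a + b + c + 3" using x(2) by (simp add: c_def)
    have "card (A i x) = q (\<not> i) ^ (a + 1) * q i ^ a * (q (\<not> i) ^ (b + 1) * q i ^ b) * (q (\<not> i) ^ (c + 1) * q i ^ c) * (q i * (q i - 1))\<^sup>2"
    proof -
      have "A i x = forms i (2 * a + 1) (2 * b + 1) (2 * c + 1)" by (simp only: A_def x(1) prod.case c_def)
      then show ?thesis by (simp add: card_forms card_words_of(2))
    qed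
    also have "\<dots> = (q (\<not> i) * (q i - 1)\<^sup>2) * (q i * q (\<not> i)) ^ (K - 1)"
    proof -
      have "v ^ (a + 1) * u ^ a * (v ^ (b + 1) * u ^ b) * (v ^ (c + 1) * u ^ c) * (u * s)\<^sup>2 = (v * s\<^sup>2) * (u * v) ^ (a + b + c + 2)"
        for u v s :: nat
        by (simp add: power_add power_mult_distrib power2_eq_square)
      moreover have "K - 1 = a + b + c + 2" by (simp add: K)
      ultimately show ?thesis by simp
    qed
    finally show ?thesis by (simp add: Q_eq)
  qed
  have finA: "finite (A i x)" for i x by (cases x) (simp add: A_def finite_forms)
  have c1: "card (\<Union>x\<in>J. A i x) = card J * ((q (\<not> i) * (q i - 1)\<^sup>2) * Q ^ (K - 1))" for i
  proof -
    have "card (\<Union>x\<in>J. A i x) = (\<Sum>x\<in>J. card (A i x))"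
      using finJ finA disj by (intro card_UN_disjoint) auto
    also have "\<dots> = (\<Sum>x\<in>J. (q (\<not> i) * (q i - 1)\<^sup>2) * Q ^ (K - 1))" by (intro sum.cong cA) simp_all
    finally show ?thesis by simp
  qed
  have "(\<Union>x\<in>J. A True x) \<inter> (\<Union>x\<in>J. A False x) = {}" using disj [of True False] by blast
  then have "card (all_forms K) = card (\<Union>x\<in>J. A True x) + card (\<Union>x\<in>J. A False x)"
    using finJ finA unfolding eq UNIV_bool by (simp add: card_Un_disjoint Un_commute Int_commute)
  then have "2 * card (all_forms K) = 2 * card J * (q False * (q True - 1)\<^sup>2 + q True * (q False - 1)\<^sup>2) * Q ^ (K - 1)"
    unfolding c1 by (simp add: algebra_simps)
  then show ?thesis using two_card_triangle [of K] unfolding J_def by simp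
qed

text \<open>All deviations are measured in the common unit \<open>R\<close>: degenerate classes,
  periodic words, overlapping forms, and the lower terms of
  \<open>(K - 1) * (K - 2)\<close>.\<close>

theorem commutator_class_count:
  assumes K: "K > 0"
  shows "finite (commutator_classes F (fp_gens G H) (4 * K))"
    "\<bar>real (card (commutator_classes F (fp_gens G H) (4 * K))) -
       (real K)\<^sup>2 / 12 * (real (q True) * (real (q False) - 1)\<^sup>2 + (real (q True) - 1)\<^sup>2 * real (q False)) * real Q ^ (K - 1)\<bar>
     \<le> real (60 ^ 6 * N ^ 8) * real K * real Q ^ K"
proof -
  define x where "x = card (form_class ` all_forms K)"
  define y where "y = card (commutator_classes F (fp_gens G H) (4 * K))"
  define a where "a = card (all_forms K)"
  define E where "E = (q False * (q True - 1)\<^sup>2 + q True * (q False - 1)\<^sup>2) * Q ^ (K - 1)"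
  define R where "R = N ^ 8 * (K * Q ^ K)"
  note cc = commutator_classes_eq [OF K]
  have fin: "finite (form_class ` all_forms K \<union> degenerate_classes K)"
    using finite_all_forms card_degenerate_classes(1) by simp
  show finC: "finite (commutator_classes F (fp_gens G H) (4 * K))" by (rule finite_subset [OF cc(2) fin])
  have Npow: "N ^ m * (K * Q ^ K) \<le> R" if "m \<le> 8" for m
    unfolding R_def using that q_N(6) by (intro mult_right_mono power_increasing) simp_all
  have D: "card (degenerate_classes K) \<le> 48 * R"
  proof -
    have "card (degenerate_classes K) \<le> (16 * (2 * K + 1)) * N ^ 6 * Q ^ K" using card_degenerate_classes(2) [of K] by simp
    also have "\<dots> \<le> (48 * K) * N ^ 6 * Q ^ K" using K by (intro mult_right_mono) simp_all
    also have "\<dots> = 48 * (N ^ 6 * (K * Q ^ K))" by simp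
    finally show ?thesis using Npow [of 6] by simp
  qed
  have xy: "x \<le> y" unfolding x_def y_def by (rule card_mono [OF finC cc(1)])
  have "y \<le> card (form_class ` all_forms K \<union> degenerate_classes K)" unfolding y_def by (rule card_mono [OF fin cc(2)])
  also have "\<dots> \<le> x + card (degenerate_classes K)" unfolding x_def by (rule card_Un_le)
  finally have yx: "y \<le> x + 48 * R" using D by simp
  have up: "x * 6 \<le> a + 24 * R"
    using card_form_classes_le [of K] Npow [of 0] unfolding x_def a_def by simp
  have lo: "a \<le> x * 6 + 26 * 60 ^ 5 * R"
  proof -
    \<comment> \<open>The surplus \<open>Q ^ 8\<close>, which stems from the unpaired positions (48
      / 6 = 8), is bounded by \<open>N ^ 8\<close>; this fixes the exponent of \<open>N\<close> in
      the error constant.\<close>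
    have "(2 * 60 ^ 5 + 24 * K * 60 ^ 5) * Q ^ (K + 8) \<le> (26 * 60 ^ 5 * K) * (Q ^ K * N ^ 8)"
      unfolding power_add using K q_N(5) by (intro mult_mono power_mono) simp_all
    also have "\<dots> = 26 * 60 ^ 5 * R" by (simp add: R_def)
    finally show ?thesis using card_all_forms_le [of K] unfolding x_def a_def by linarith
  qed
  \<comment> \<open>Replacing \<open>(K - 1) * (K - 2)\<close> by the square of \<open>K\<close>
    costs a multiple of \<open>K * E\<close>, which has the order of the error.\<close>
  have ER: "K * E \<le> R"
  proof -
    have le: "q (\<not> i) * (q i - 1)\<^sup>2 \<le> Q * q i" for i
    proof -
      have "q (\<not> i) * (q i - 1)\<^sup>2 \<le> q (\<not> i) * (q i)\<^sup>2" by (intro mult_left_mono power_mono) simp_all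
      then show ?thesis using Q_eq [of i] by (simp add: power2_eq_square mult_ac)
    qed
    have "E \<le> (Q * q True + Q * q False) * Q ^ (K - 1)"
      unfolding E_def using le [of True] le [of False] by (intro mult_right_mono add_mono) simp_all
    also have "\<dots> = (q True + q False) * Q ^ K" using K by (cases K) (simp_all add: algebra_simps)
    also have "\<dots> \<le> N * Q ^ K" using q_N(3) by (intro mult_right_mono) simp_all
    finally have "K * E \<le> K * (N * Q ^ K)" by (rule mult_left_mono) simp
    also have "\<dots> = N ^ 1 * (K * Q ^ K)" by simp
    also have "\<dots> \<le> R" by (rule Npow) simp
    finally show ?thesis .
  qed
  have "2 * a = (K - 1) * (K - 2) * E" using two_card_all_forms [of K] by (simp add: a_def E_def)
  then have ra: "2 * real a = real ((K - 1) * (K - 2)) * real E" by (metis of_nat_mult of_nat_numeral)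
  have rK: "real ((K - 1) * (K - 2)) = (real K - 1) * (real K - 2)"
    using K by (cases "K = 1") (simp_all add: of_nat_diff)
  have a: "real a = ((real K)\<^sup>2 - 3 * real K + 2) / 2 * real E"
    using ra unfolding rK by (simp add: algebra_simps power2_eq_square)
  define M where "M = (real K)\<^sup>2 / 12 * real E"
  have M6: "6 * M = real a + (3 * (real K * real E) - 2 * real E) / 2"
    unfolding M_def a by (simp add: field_simps)
  have KE: "real K * real E \<le> real R" using ER by (metis of_nat_le_iff of_nat_mult)
  have "real E \<le> real K * real E" using K by (simp add: mult_le_cancel_right1)
  moreover have "\<bar>m - n\<bar> \<le> 2 * r" if "m = n + (3 * p - 2 * e) / 2" "p \<le> r" "e \<le> p" "0 \<le> e" for m n p e r :: real
    using that by (simp add: abs_le_iff)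
  ultimately have "\<bar>6 * M - real a\<bar> \<le> 2 * real R" using M6 KE by simp
  moreover have "real x * 6 \<le> real a + 24 * real R" using up by (metis (mono_tags) of_nat_add of_nat_le_iff of_nat_mult of_nat_numeral)
  moreover have "real a \<le> real x * 6 + 26 * 60 ^ 5 * real R"
    using lo by (metis (mono_tags) of_nat_add of_nat_le_iff of_nat_mult of_nat_numeral of_nat_power)
  moreover have "real x \<le> real y" "real y \<le> real x + 48 * real R" using xy yx by linarith+
  \<comment> \<open>The largest contribution is 26 * 60^5 / 6 from overlapping forms; adding 48 from
    degenerate classes and the small remainder stays far below 60^6.\<close>
  ultimately have "\<bar>real y - M\<bar> \<le> 60 ^ 6 * real R" by (simp add: abs_le_iff)
  moreover have "real E = (real (q True) * (real (q False) - 1)\<^sup>2 + (real (q True) - 1)\<^sup>2 * real (q False)) * real Q ^ (K - 1)"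
    using q_pos [of True] q_pos [of False] by (simp add: E_def of_nat_diff Suc_leI algebra_simps)
  ultimately show "\<bar>real (card (commutator_classes F (fp_gens G H) (4 * K))) -
       (real K)\<^sup>2 / 12 * (real (q True) * (real (q False) - 1)\<^sup>2 + (real (q True) - 1)\<^sup>2 * real (q False)) * real Q ^ (K - 1)\<bar>
     \<le> real (60 ^ 6 * N ^ 8) * real K * real Q ^ K"
    by (simp add: M_def y_def R_def mult.assoc)
qed

end

section \<open>Computability of the error constant\<close>

text \<open>Only values on lists of length \<open>n\<close> are meaningful, while
  \<open>recursive_fun\<close> is a predicate on functions of all lists. Demanding agreement on the
  meaningful lists lets recursive functions be replaced by explicit formulas.\<close>

definition recursive_on :: "nat \<Rightarrow> (nat list \<Rightarrow> nat) \<Rightarrow> bool" where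
  "recursive_on n h \<longleftrightarrow> (\<exists>f. recursive_fun n f \<and> (\<forall>xs. length xs = n \<longrightarrow> f xs = h xs))"

lemma recursive_on_compose:
  assumes f: "recursive_on (length hs) f" and h: "\<And>h. h \<in> set hs \<Longrightarrow> recursive_on n h"
  shows "recursive_on n (\<lambda>xs. f (map (\<lambda>h. h xs) hs))"
proof -
  obtain f' where f': "recursive_fun (length hs) f'" "\<And>xs. length xs = length hs \<Longrightarrow> f' xs = f xs"
    using f unfolding recursive_on_def by blast
  obtain r where r: "\<And>h. h \<in> set hs \<Longrightarrow> recursive_fun n (r h) \<and> (\<forall>xs. length xs = n \<longrightarrow> r h xs = h xs)"
    using h unfolding recursive_on_def by metis
  have "recursive_fun n (\<lambda>xs. f' (map (\<lambda>g. g xs) (map r hs)))"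
    using f'(1) r by (intro recursive_fun.comp) simp_all
  moreover have "f' (map (\<lambda>g. g xs) (map r hs)) = f (map (\<lambda>h. h xs) hs)" if "length xs = n" for xs
  proof -
    have "map (\<lambda>g. g xs) (map r hs) = map (\<lambda>h. h xs) hs" using r that by simp
    then show ?thesis by (simp only: f'(2) length_map)
  qed
  ultimately show ?thesis unfolding recursive_on_def by blast
qed

lemma recursive_on_proj: "i < n \<Longrightarrow> recursive_on n (\<lambda>xs. xs ! i)"
  unfolding recursive_on_def using recursive_fun.proj by blast

lemma recursive_on_Suc: "recursive_on n h \<Longrightarrow> recursive_on n (\<lambda>xs. Suc (h xs))"
  using recursive_on_compose [of "[h]" "\<lambda>xs. Suc (xs ! 0)" n] recursive_fun.succ
  by (auto simp: recursive_on_def)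

lemma recursive_on_const: "recursive_on n (\<lambda>_. m)"
proof (induction m)
  case 0
  show ?case unfolding recursive_on_def using recursive_fun.zero by blast
qed (rule recursive_on_Suc)

lemma recursive_on_rec:
  assumes "recursive_on n f" "recursive_on (Suc (Suc n)) g"
  shows "recursive_on (Suc n) (\<lambda>xs. rec_nat (f (tl xs)) (\<lambda>i r. g (i # r # tl xs)) (hd xs))"
proof -
  obtain f' g' where fg: "recursive_fun n f'" "\<And>xs. length xs = n \<Longrightarrow> f' xs = f xs"
    "recursive_fun (Suc (Suc n)) g'" "\<And>xs. length xs = Suc (Suc n) \<Longrightarrow> g' xs = g xs"
    using assms unfolding recursive_on_def by metis
  have "rec_nat (f' (tl xs)) (\<lambda>i r. g' (i # r # tl xs)) m = rec_nat (f (tl xs)) (\<lambda>i r. g (i # r # tl xs)) m"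
    if "length xs = Suc n" for xs m
    using that fg(2,4) by (induction m) simp_all
  then show ?thesis unfolding recursive_on_def using recursive_fun.prec [OF fg(1,3)] by blast
qed

lemma recursive_on_add:
  assumes "recursive_on n f" "recursive_on n g"
  shows "recursive_on n (\<lambda>xs. f xs + g xs)"
proof -
  have "recursive_on (Suc 1) (\<lambda>xs. rec_nat (tl xs ! 0) (\<lambda>i r. Suc ((i # r # tl xs) ! 1)) (hd xs))"
    by (intro recursive_on_rec recursive_on_proj recursive_on_Suc) simp_all
  moreover have "rec_nat y (\<lambda>i r. Suc r) m = m + y" for m y :: nat by (induction m) simp_all
  ultimately have "recursive_on 2 (\<lambda>xs. hd xs + tl xs ! 0)" by (simp add: numeral_2_eq_2)
  then show ?thesis using recursive_on_compose [of "[f, g]" "\<lambda>xs. hd xs + tl xs ! 0" n] assms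
    by (auto simp: numeral_2_eq_2)
qed

lemma recursive_on_mult:
  assumes "recursive_on n f" "recursive_on n g"
  shows "recursive_on n (\<lambda>xs. f xs * g xs)"
proof -
  have "recursive_on (Suc 1) (\<lambda>xs. rec_nat 0 (\<lambda>i r. (i # r # tl xs) ! 1 + (i # r # tl xs) ! 2) (hd xs))"
    by (rule recursive_on_rec [of 1 "\<lambda>_. 0"]) (intro recursive_on_const recursive_on_add recursive_on_proj; simp)+
  moreover have "rec_nat 0 (\<lambda>i r. r + y) m = m * y" for m y :: nat by (induction m) simp_all
  ultimately have "recursive_on 2 (\<lambda>xs. hd xs * tl xs ! 0)" by (simp add: numeral_2_eq_2)
  then show ?thesis using recursive_on_compose [of "[f, g]" "\<lambda>xs. hd xs * tl xs ! 0" n] assms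
    by (auto simp: numeral_2_eq_2)
qed

lemma recursive_on_power: "recursive_on n f \<Longrightarrow> recursive_on n (\<lambda>xs. f xs ^ m)"
  by (induction m) (simp_all add: recursive_on_const recursive_on_mult)

lemma computable2_constant: "computable2 (\<lambda>m n. 60 ^ 6 * (m * n) ^ 8)"
proof -
  have "recursive_on 2 (\<lambda>xs. 60 ^ 6 * (xs ! 0 * xs ! 1) ^ 8)"
    by (intro recursive_on_mult recursive_on_const recursive_on_power recursive_on_proj) simp_all
  then obtain f where "recursive_fun 2 f" "\<And>xs. length xs = 2 \<Longrightarrow> f xs = 60 ^ 6 * (xs ! 0 * xs ! 1) ^ 8"
    unfolding recursive_on_def by blast
  then show ?thesis unfolding computable2_def by (intro exI [of _ f]) simp
qed

text \<open>The function \<open>c\<close> is chosen before the groups, which expresses that the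
  constant depends on their orders alone. At \<open>k = 0\<close> the main term and the error bound
  both vanish although the trivial class is counted, so the estimate is stated for positive
  \<open>k\<close>.\<close>

theorem theorem1p4:
  shows "\<exists>c. computable2 c \<and>
    (\<forall>(G1 :: 'a monoid) (G2 :: 'b monoid).
      group G1 \<and> finite (carrier G1) \<and> carrier G1 \<noteq> {\<one>\<^bsub>G1\<^esub>} \<and>
      group G2 \<and> finite (carrier G2) \<and> carrier G2 \<noteq> {\<one>\<^bsub>G2\<^esub>} \<longrightarrow>
      (\<forall>k::nat. k > 0 \<and> 4 dvd k \<longrightarrow>
        finite (commutator_classes (free_product G1 G2) (fp_gens G1 G2) k) \<and>
        \<bar>real (card (commutator_classes (free_product G1 G2) (fp_gens G1 G2) k)) -
          1 / 192 * ((real (order G1) - 1) * (real (order G2) - 2)\<^sup>2 +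
                     (real (order G1) - 2)\<^sup>2 * (real (order G2) - 1)) *
            real k ^ 2 * (real (order G1) - 1) ^ (k div 4 - 1) * (real (order G2) - 1) ^ (k div 4 - 1)\<bar>
        \<le> real (c (order G1) (order G2)) *
            (real k * (real (order G1) - 1) ^ (k div 4) * (real (order G2) - 1) ^ (k div 4))))"
proof (intro exI conjI allI impI; (elim conjE)?)
  show "computable2 (\<lambda>m n. 60 ^ 6 * (m * n) ^ 8)" by (rule computable2_constant)
  fix G1 :: "'a monoid" and G2 :: "'b monoid" and k :: nat
  assume G: "group G1" "finite (carrier G1)" "carrier G1 \<noteq> {\<one>\<^bsub>G1\<^esub>}"
    "group G2" "finite (carrier G2)" "carrier G2 \<noteq> {\<one>\<^bsub>G2\<^esub>}" and k: "k > 0" "4 dvd k"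
  interpret two_finite_groups G1 G2
    by (intro two_finite_groups.intro two_groups.intro two_finite_groups_axioms.intro G)
  obtain K where K: "k = 4 * K" "K > 0" using k by auto
  show "finite (commutator_classes (free_product G1 G2) (fp_gens G1 G2) k)"
    unfolding K(1) by (rule commutator_class_count(1) [OF K(2)])
  define u v where "u = real (q True)" and "v = real (q False)"
  have o: "real (order G1) = u + 1" "real (order G2) = v + 1" by (simp_all add: u_def v_def flip: q_N(1,2))
  have uv: "real Q = u * v" "u \<ge> 0" "v \<ge> 0" by (simp_all add: Q_def u_def v_def)
  have main: "1 / 192 * ((real (order G1) - 1) * (real (order G2) - 2)\<^sup>2 + (real (order G1) - 2)\<^sup>2 * (real (order G2) - 1)) *
      real k ^ 2 * (real (order G1) - 1) ^ (k div 4 - 1) * (real (order G2) - 1) ^ (k div 4 - 1) =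
     (real K)\<^sup>2 / 12 * (u * (v - 1)\<^sup>2 + (u - 1)\<^sup>2 * v) * real Q ^ (K - 1)"
    unfolding K(1) o uv(1) by (simp add: power_mult_distrib)
  have err: "real (60 ^ 6 * N ^ 8) * real K * real Q ^ K \<le> real (60 ^ 6 * N ^ 8) * (real k * u ^ K * v ^ K)"
    unfolding K(1) uv(1) using uv(2,3) by (simp add: power_mult_distrib mult_mono)
  have rhs: "real (60 ^ 6 * (order G1 * order G2) ^ 8) *
      (real k * (real (order G1) - 1) ^ (k div 4) * (real (order G2) - 1) ^ (k div 4)) =
     real (60 ^ 6 * N ^ 8) * (real k * u ^ K * v ^ K)"
    unfolding N_def o K(1) by simp
  show "\<bar>real (card (commutator_classes (free_product G1 G2) (fp_gens G1 G2) k)) -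
          1 / 192 * ((real (order G1) - 1) * (real (order G2) - 2)\<^sup>2 +
                     (real (order G1) - 2)\<^sup>2 * (real (order G2) - 1)) *
            real k ^ 2 * (real (order G1) - 1) ^ (k div 4 - 1) * (real (order G2) - 1) ^ (k div 4 - 1)\<bar>
        \<le> real (60 ^ 6 * (order G1 * order G2) ^ 8) *
            (real k * (real (order G1) - 1) ^ (k div 4) * (real (order G2) - 1) ^ (k div 4))"
    unfolding main rhs unfolding K(1)
    by (rule order.trans [OF commutator_class_count(2) [OF K(2), folded u_def v_def] err [unfolded K(1)]])
qed

end
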